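(* Let $0<p,q\leq\infty$ and let $g$ be an entire function on $\mathbb{C}$. Let $I_gf(z)=\int_0^z f'(w)g(w)\,dw$ and $M_gf=gf$. Then: (i) If $p\neq q$, the following statements are equivalent: (a) $I_g:\mathcal{F}_p^\psi\to\mathcal{F}_q^\psi$ is bounded; (b) $M_g:\mathcal{F}_p^\psi\to\mathcal{F}_q^\psi$ is bounded; (c) $g$ is the zero function. (ii) If $0<p\leq\infty$, the following statements are equivalent: (a) $I_g:\mathcal{F}_p^\psi\to\mathcal{F}_p^\psi$ is bounded; (b) $M_g:\mathcal{F}_p^\psi\to\mathcal{F}_p^\psi$ is bounded; (c) $g$ is a constant function. (iii) If $0<p\leq\infty$, the following statements are equivalent: (a) $I_g:\mathcal{F}_p^\psi\to\mathcal{F}_p^\psi$ is compact; (b) $M_g:\mathcal{F}_p^\psi\to\mathcal{F}_p^\psi$ is compact; (c) $g$ is the zero function.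
   Context: Notation: $U\simeq V$ means that there is a constant $C>0$ with $C^{-1}V\le U\le CV$ throughout the set in question. $dm$ is Lebesgue area measure on $\mathbb{C}$. Standing assumptions on the weight: $\psi:[0,\infty)\to[0,\infty)$ is twice continuously differentiable and is extended to $\mathbb{C}$ by $\psi(z)=\psi(|z|)$. The Laplacian $\Delta\psi$ of the extended function is positive. There is a positive, radial, differentiable function $\tau$ on $\mathbb{C}$ (write $\tau(z)=\tau(|z|)$) with $\tau(z)\simeq 1$ for $0\le|z|<1$ and $\tau(z)\simeq(\Delta\psi(z))^{-1/2}$ for $|z|\ge1$, such that $\lim_{r\to\infty}\tau(r)=0$ and $\lim_{r\to\infty}\tau'(r)=0$. In addition, either there exists a constant $C>0$ such that $\tau(r)r^C$ is increasing for large $r$, or $\lim_{r\to\infty}\tau'(r)\log\frac1{\tau(r)}=0$. Spaces: for $0<p<\infty$, $\mathcal{F}_p^\psi$ is the space of entire functions $f$ with $\|f\|_{\mathcal{F}_p^\psi}^p=\int_{\mathbb{C}}|f(z)|^pe^{-p\psi(z)}\,dm(z)<\infty$; $\mathcal{F}_\infty^\psi$ is the space of entire functions $f$ with $\|f\|_{\mathcal{F}_\infty^\psi}=\sup_{z\in\mathbb{C}}|f(z)|e^{-\psi(z)}<\infty$. A linear operator $T$ between two such spaces is bounded if it maps the first space into the second and there is a constant $C$ with $\|Tf\|\le C\|f\|$ for all $f$; it is compact if it maps bounded sets to relatively compact sets. *)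

theory Defs
  imports "HOL-Complex_Analysis.Complex_Analysis"
begin

definition comparable_on :: "complex set \<Rightarrow> (complex \<Rightarrow> real) \<Rightarrow> (complex \<Rightarrow> real) \<Rightarrow> bool" where
  "comparable_on S U V \<longleftrightarrow>
     (\<exists>C>0. \<forall>z\<in>S. inverse C * V z \<le> U z \<and> U z \<le> C * V z)"

definition laplacian :: "(complex \<Rightarrow> real) \<Rightarrow> complex \<Rightarrow> real" where
  "laplacian u z =
     deriv (deriv (\<lambda>x. u (Complex x (Im z)))) (Re z) +
     deriv (deriv (\<lambda>y. u (Complex (Re z) y))) (Im z)"

definition C2_halfline :: "(real \<Rightarrow> real) \<Rightarrow> bool" where
  "C2_halfline \<psi> \<longleftrightarrow> (\<exists>\<psi>' \<psi>''.
     (\<forall>r\<ge>0. (\<psi> has_real_derivative \<psi>' r) (at r within {0..})) \<and>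
     (\<forall>r\<ge>0. (\<psi>' has_real_derivative \<psi>'' r) (at r within {0..})) \<and>
     continuous_on {0..} \<psi>'')"

text \<open>
  A radial function on the plane is given by its profile, a function on the reals of which
  only the values on the half-line matter. Smoothness of the profile of the weight gives a
  Laplacian only off the origin; at the origin it need not exist (\<open>\<psi> r = exp r\<close>) or need not
  be positive (\<open>\<psi> r = r ^ 4\<close>). Its positivity is therefore required for \<open>z \<noteq> 0\<close>.
\<close>

definition admissible_weight :: "(real \<Rightarrow> real) \<Rightarrow> bool" where
  "admissible_weight \<psi> \<longleftrightarrow>
     C2_halfline \<psi> \<and>
     (\<forall>r\<ge>0. 0 \<le> \<psi> r) \<and>
     (\<forall>z. z \<noteq> 0 \<longrightarrow> 0 < laplacian (\<lambda>w. \<psi> (cmod w)) z) \<and>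
     (\<exists>\<tau> :: real \<Rightarrow> real.
        (\<forall>r\<ge>0. 0 < \<tau> r) \<and>
        (\<lambda>z::complex. \<tau> (cmod z)) differentiable_on UNIV \<and>
        comparable_on {z. cmod z < 1} (\<lambda>z. \<tau> (cmod z)) (\<lambda>z. 1) \<and>
        comparable_on {z. 1 \<le> cmod z} (\<lambda>z. \<tau> (cmod z))
          (\<lambda>z. laplacian (\<lambda>w. \<psi> (cmod w)) z powr (- 1 / 2)) \<and>
        (\<tau> \<longlongrightarrow> 0) at_top \<and>
        (deriv \<tau> \<longlongrightarrow> 0) at_top \<and>
        ((\<exists>C>0. \<exists>R>0. mono_on {R..} (\<lambda>r. \<tau> r * r powr C)) \<or>
         ((\<lambda>r. deriv \<tau> r * ln (1 / \<tau> r)) \<longlongrightarrow> 0) at_top))"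

definition fock_space :: "(real \<Rightarrow> real) \<Rightarrow> ennreal \<Rightarrow> (complex \<Rightarrow> complex) set" where
  "fock_space \<psi> p = {f. f holomorphic_on UNIV \<and>
     (if p = \<infinity> then bdd_above (range (\<lambda>z. cmod (f z) * exp (- \<psi> (cmod z))))
      else integrable lborel
        (\<lambda>z. cmod (f z) powr enn2real p * exp (- enn2real p * \<psi> (cmod z))))}"

definition fock_norm :: "(real \<Rightarrow> real) \<Rightarrow> ennreal \<Rightarrow> (complex \<Rightarrow> complex) \<Rightarrow> real" where
  "fock_norm \<psi> p f =
     (if p = \<infinity> then (SUP z. cmod (f z) * exp (- \<psi> (cmod z)))
      else (LINT z|lborel. cmod (f z) powr enn2real p * exp (- enn2real p * \<psi> (cmod z)))
             powr (1 / enn2real p))"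

text \<open>
  For \<open>p < 1\<close> the norm is only a quasi-norm, so the topology is given through its balls. They are
  also the balls of the metric \<open>fock_norm \<psi> p (f - h) powr min 1 p\<close>.
\<close>

definition fock_open :: "(real \<Rightarrow> real) \<Rightarrow> ennreal \<Rightarrow> (complex \<Rightarrow> complex) set \<Rightarrow> bool" where
  "fock_open \<psi> p U \<longleftrightarrow> U \<subseteq> fock_space \<psi> p \<and>
     (\<forall>f\<in>U. \<exists>e>0. \<forall>h\<in>fock_space \<psi> p. fock_norm \<psi> p (\<lambda>z. h z - f z) < e \<longrightarrow> h \<in> U)"

definition fock_topology :: "(real \<Rightarrow> real) \<Rightarrow> ennreal \<Rightarrow> (complex \<Rightarrow> complex) topology" where
  "fock_topology \<psi> p = topology (fock_open \<psi> p)"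

lemma istopology_fock_open: "istopology (fock_open \<psi> p)"
  unfolding istopology_def
proof (intro conjI allI impI)
  fix S T assume S: "fock_open \<psi> p S" and T: "fock_open \<psi> p T"
  show "fock_open \<psi> p (S \<inter> T)"
    unfolding fock_open_def
  proof (intro conjI ballI)
    show "S \<inter> T \<subseteq> fock_space \<psi> p" using S by (auto simp: fock_open_def)
    fix f assume f: "f \<in> S \<inter> T"
    obtain d where d: "d > 0"
        "\<forall>h\<in>fock_space \<psi> p. fock_norm \<psi> p (\<lambda>z. h z - f z) < d \<longrightarrow> h \<in> S"
      using S f by (auto simp: fock_open_def)
    obtain e where e: "e > 0"
        "\<forall>h\<in>fock_space \<psi> p. fock_norm \<psi> p (\<lambda>z. h z - f z) < e \<longrightarrow> h \<in> T"
      using T f by (auto simp: fock_open_def)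
    show "\<exists>e>0. \<forall>h\<in>fock_space \<psi> p. fock_norm \<psi> p (\<lambda>z. h z - f z) < e \<longrightarrow> h \<in> S \<inter> T"
      using d e by (intro exI[of _ "min d e"]) auto
  qed
next
  fix K assume "\<forall>S\<in>K. fock_open \<psi> p S"
  then show "fock_open \<psi> p (\<Union>K)"
    unfolding fock_open_def by (meson Sup_least UnionE UnionI)
qed

lemma openin_fock_topology: "openin (fock_topology \<psi> p) U \<longleftrightarrow> fock_open \<psi> p U"
  by (simp add: fock_topology_def istopology_fock_open topology_inverse')

lemma topspace_fock_topology: "topspace (fock_topology \<psi> p) = fock_space \<psi> p"
proof
  show "topspace (fock_topology \<psi> p) \<subseteq> fock_space \<psi> p"
    by (auto simp: topspace_def openin_fock_topology fock_open_def)
  have "fock_open \<psi> p (fock_space \<psi> p)"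
    unfolding fock_open_def by (auto intro: exI[of _ 1])
  then show "fock_space \<psi> p \<subseteq> topspace (fock_topology \<psi> p)"
    by (simp add: openin_fock_topology openin_subset)
qed

definition bounded_operator ::
  "(real \<Rightarrow> real) \<Rightarrow> ennreal \<Rightarrow> ennreal \<Rightarrow> ((complex \<Rightarrow> complex) \<Rightarrow> (complex \<Rightarrow> complex)) \<Rightarrow> bool" where
  "bounded_operator \<psi> p q T \<longleftrightarrow>
     T ` fock_space \<psi> p \<subseteq> fock_space \<psi> q \<and>
     (\<exists>C. \<forall>f\<in>fock_space \<psi> p. fock_norm \<psi> q (T f) \<le> C * fock_norm \<psi> p f)"

definition compact_operator ::
  "(real \<Rightarrow> real) \<Rightarrow> ennreal \<Rightarrow> ennreal \<Rightarrow> ((complex \<Rightarrow> complex) \<Rightarrow> (complex \<Rightarrow> complex)) \<Rightarrow> bool" where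
  "compact_operator \<psi> p q T \<longleftrightarrow>
     T ` fock_space \<psi> p \<subseteq> fock_space \<psi> q \<and>
     (\<forall>B. B \<subseteq> fock_space \<psi> p \<and> (\<exists>M. \<forall>f\<in>B. fock_norm \<psi> p f \<le> M) \<longrightarrow>
        compactin (fock_topology \<psi> q) (fock_topology \<psi> q closure_of (T ` B)))"

definition integral_op :: "(complex \<Rightarrow> complex) \<Rightarrow> (complex \<Rightarrow> complex) \<Rightarrow> complex \<Rightarrow> complex" where
  "integral_op g f z = contour_integral (linepath 0 z) (\<lambda>w. deriv f w * g w)"

definition mult_op :: "(complex \<Rightarrow> complex) \<Rightarrow> (complex \<Rightarrow> complex) \<Rightarrow> complex \<Rightarrow> complex" where
  "mult_op g f z = g z * f z"

end

theory Submission
  imports Defs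
begin

text \<open>
  Write \<open>W f z = \<bar>f z\<bar> exp (- \<psi> \<bar>z\<bar>)\<close> and \<open>x = ln \<bar>z\<bar>\<close>. In the variable \<open>x\<close> the weight is convex, with second
  derivative comparable to \<open>\<omega> x powr (- 2)\<close> where \<open>\<omega> x = \<tau> (exp x) / exp x\<close> varies slowly. Hence the
  monomial whose degree is the slope of the weight at \<open>ln \<bar>a\<bar>\<close>, normalised at \<open>a\<close>, has weighted modulus
  comparable to \<open>1\<close> on the ring of relative width \<open>\<omega>\<close> through \<open>a\<close> and decays rapidly away from it. Division by
  this monomial removes the weight on discs of radius \<open>\<tau>\<close>, so that both \<open>g f\<close> and the derivative \<open>g f'\<close> of
  \<open>I\<^sub>g f\<close> are controlled there by local \<open>L\<^sup>q\<close> means; no Littlewood-Paley formula is needed.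

  If \<open>p \<le> q\<close>, multiply the monomial by a power of an averaged geometric sum, which concentrates it on the
  disc of radius \<open>\<tau> \<bar>a\<bar>\<close> about \<open>a\<close>. Boundedness then gives \<open>\<bar>g a\<bar> \<le> C \<tau> \<bar>a\<bar> powr (2 / p - 2 / q)\<close>, and
  Liouville's theorem applies. Compactness forces the images of the normalised test functions to accumulate
  at \<open>0\<close>, whence \<open>g\<close> tends to \<open>0\<close> at infinity. If \<open>q < p\<close>, sums of the monomials over a grid of radii up to \<open>R\<close>
  have norm at most \<open>C R powr (2 / p)\<close>, while finitely many of them fill the disc of radius \<open>R\<close>; this yields
  \<open>\<integral> \<bar>g\<bar>\<^sup>q \<le> C R powr (2 q / p)\<close> over that disc with \<open>2 q / p < 2\<close>, so \<open>g\<close> vanishes by subharmonicity.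
\<close>

section \<open>Local estimates for holomorphic functions\<close>

text \<open>Each operator shows \<open>g a\<close> without cancellation: \<open>M_g f\<close> in its
  value, \<open>I_g f\<close> in its derivative, which is g f'. The price is that a test function
  must be large at \<open>a\<close> together with its derivative, measured against the slope of the
  weight.

  Degrees are integers while slopes are not. Rounding costs a factor exp \<bar>x - x0\<bar>,
  harmless because \<open>\<omega> \<le> 1\<close> far out makes this small against a decay counted
  in units of \<open>\<omega>\<close>.

  For q < p the obstacle is cancellation between neighbouring rings, in the sum as well as in its
  derivative. The rings are split into residue classes modulo some J; within a class they lie so far
  apart that one term dominates on its own ring. In the derivative the terms carry their degrees as
  weights. This is affordable because the slope grows at most by exp \<delta> per ring while the
  bound for the monomials falls by exp (- 4 \<delta>), where \<delta> = 1 / (64 \<kappa>).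

  Exponents below 1 admit neither the triangle inequality nor the mean value inequality for
  integrals of \<bar>F\<bar>, so everything rests on pointwise bounds and on estimates valid for
  every positive exponent.\<close>

lemma emeasure_lborel_complex_ball:
  "0 \<le> r \<Longrightarrow> emeasure lborel (ball (a::complex) r) = ennreal (pi * r\<^sup>2)"
  by (simp add: emeasure_ball unit_ball_vol_2)

lemma norm_deriv_le_of_cball:
  assumes hol: "f holomorphic_on S" and sub: "cball a r \<subseteq> S" and r: "0 < r"
    and B: "\<And>x. x \<in> cball a r \<Longrightarrow> cmod (f x) \<le> B"
  shows "cmod (deriv f a) \<le> B / r"
proof -
  have "norm ((deriv ^^ 1) f a) \<le> fact 1 * B / r ^ 1"
  proof (rule Cauchy_inequality)
    show "f holomorphic_on ball a r"
      using hol sub ball_subset_cball holomorphic_on_subset by blast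
    show "continuous_on (cball a r) f"
      using hol sub holomorphic_on_imp_continuous_on continuous_on_subset by blast
  qed (use r B in \<open>auto simp: dist_norm\<close>)
  then show ?thesis by simp
qed

text \<open>Cauchy's estimate on discs of radius \<open>d / 4\<close> inside the half ball bounds
  the derivative by \<open>4 * M * cmod (F z0) / d\<close>; over a distance
  \<open>d / (8 * M)\<close> this moves \<open>F\<close> by at most
  \<open>cmod (F z0) / 2\<close>.\<close>

lemma holomorphic_lower_bound_near_maximum:
  fixes F :: "complex \<Rightarrow> complex"
  assumes "d > 0" and hol: "F holomorphic_on ball z0 d" and M: "M \<ge> 1"
    and le: "\<And>z. z \<in> cball z0 (d / 2) \<Longrightarrow> cmod (F z) \<le> M * cmod (F z0)"
    and z: "z \<in> ball z0 (d / (8 * M))"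
  shows "cmod (F z0) / 2 \<le> cmod (F z)"
proof -
  have sub: "ball z0 (d / (8 * M)) \<subseteq> ball z0 (d / 4)"
    using M \<open>d > 0\<close> by (intro subset_ball) (simp add: field_simps)
  have der: "cmod (deriv F w) \<le> 4 * M * cmod (F z0) / d" if w: "w \<in> ball z0 (d / (8 * M))" for w
  proof -
    have "dist z0 w < d / 4" using w sub by auto
    then have sub2: "cball w (d / 4) \<subseteq> cball z0 (d / 2)"
      using \<open>d > 0\<close> by (auto simp: dist_commute) (smt (verit, best) dist_commute dist_triangle field_sum_of_halves)
    then have sub3: "cball w (d / 4) \<subseteq> ball z0 d" using \<open>d > 0\<close> by fastforce
    have "cmod (deriv F w) \<le> M * cmod (F z0) / (d / 4)"
      using sub2 \<open>d > 0\<close> by (intro norm_deriv_le_of_cball[OF hol sub3] le) auto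
    then show ?thesis by (simp add: field_simps)
  qed
  have "norm (F z - F z0) \<le> 4 * M * cmod (F z0) / d * norm (z - z0)"
  proof (rule field_differentiable_bound[of "ball z0 (d / (8 * M))"])
    fix w assume w: "w \<in> ball z0 (d / (8 * M))"
    then have "w \<in> ball z0 d" using sub \<open>d > 0\<close> by fastforce
    then show "(F has_field_derivative deriv F w) (at w within ball z0 (d / (8 * M)))"
      using hol holomorphic_derivI by blast
    show "norm (deriv F w) \<le> 4 * M * cmod (F z0) / d" by (rule der[OF w])
  qed (use z \<open>d > 0\<close> M in auto)
  also have "\<dots> \<le> 4 * M * cmod (F z0) / d * (d / (8 * M))"
    using z \<open>d > 0\<close> M by (intro mult_left_mono) (auto simp: dist_norm norm_minus_commute)
  also have "\<dots> = cmod (F z0) / 2" using \<open>d > 0\<close> M by (simp add: field_simps)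
  finally have "cmod (F z - F z0) \<le> cmod (F z0) / 2" .
  moreover have "cmod (F z0) \<le> cmod (F z) + cmod (F z - F z0)"
    by (metis norm_minus_commute norm_triangle_sub)
  ultimately show ?thesis by linarith
qed

text \<open>
  For small \<open>q\<close> the mean value property says nothing. Instead one maximises
  \<open>dist z (boundary)\<close> to the power \<open>2 / q\<close> times \<open>\<bar>F z\<bar>\<close>; around the maximiser Cauchy's estimate keeps
  \<open>F\<close> from decaying on a ball of comparable size.
\<close>

lemma holomorphic_powr_le_integral:
  assumes q: "(q::real) > 0"
  obtains C where "C > 0"
    "\<And>F a r. r > 0 \<Longrightarrow> F holomorphic_on ball a r \<Longrightarrow>
       ennreal (r\<^sup>2 * cmod (F a) powr q) \<le>
       ennreal C * (\<integral>\<^sup>+z\<in>ball a r. ennreal (cmod (F z) powr q) \<partial>lborel)"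
proof -
  \<comment> \<open>\<open>M\<close> is the factor lost in
    \<open>(R - dist a z) powr (2 / q)\<close> when the distance to the boundary is halved.\<close>
  define M :: real where "M = 2 powr (2 / q)"
  have M1: "M \<ge> 1" unfolding M_def using q by (simp add: ge_one_powr_ge_zero)
  \<comment> \<open>The 4 pays for \<open>R = r / 2\<close>, \<open>2 powr q\<close> for the lower
    bound \<open>cmod (F z0) / 2\<close>, and the rest for the area of the ball of radius
    \<open>d / (8 * M)\<close> compared with \<open>d\<^sup>2\<close>.\<close>
  define C where "C = 4 * 2 powr q * (8 * M)\<^sup>2 / pi"
  have C: "C > 0" unfolding C_def using M1 by simp
  show ?thesis
  proof (rule that[OF C])
    fix F :: "complex \<Rightarrow> complex" and a r
    assume r: "r > 0" and hol: "F holomorphic_on ball a r"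
    show "ennreal (r\<^sup>2 * cmod (F a) powr q) \<le>
       ennreal C * (\<integral>\<^sup>+z\<in>ball a r. ennreal (cmod (F z) powr q) \<partial>lborel)"
    proof (cases "F a = 0")
      case True then show ?thesis using q by simp
    next
      case False
      \<comment> \<open>On this smaller closed disc \<open>F\<close> is continuous, so a maximiser
        exists.\<close>
      define R where "R = r / 2"
      have R: "R > 0" using r by (simp add: R_def)
      define \<Phi> where "\<Phi> z = (R - dist a z) powr (2 / q) * cmod (F z)" for z
      have subR: "cball a R \<subseteq> ball a r" using r by (auto simp: R_def)
      have contF: "continuous_on (cball a R) F"
        using hol subR holomorphic_on_imp_continuous_on continuous_on_subset by blast
      have "continuous_on (cball a R) \<Phi>" unfolding \<Phi>_def using q
        by (intro continuous_intros continuous_on_powr' contF) auto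
      moreover have "cball a R \<noteq> {}" using R by simp
      ultimately obtain z0 where z0: "z0 \<in> cball a R" "\<And>z. z \<in> cball a R \<Longrightarrow> \<Phi> z \<le> \<Phi> z0"
        using continuous_attains_sup[of "cball a R" \<Phi>] by auto
      have a_le: "\<Phi> a \<le> \<Phi> z0" using z0 R by simp
      have a_pos: "\<Phi> a > 0" using R False by (simp add: \<Phi>_def)
      define d where "d = R - dist a z0"
      have "d \<noteq> 0" using a_le a_pos by (auto simp: \<Phi>_def d_def)
      then have d: "d > 0" using z0 by (simp add: d_def)
      have sub1: "ball z0 d \<subseteq> cball a R"
      proof
        fix z assume "z \<in> ball z0 d"
        then show "z \<in> cball a R" using dist_triangle[of a z z0] by (simp add: d_def)
      qed
      have bound: "cmod (F z) \<le> M * cmod (F z0)" if z: "z \<in> cball z0 (d / 2)" for z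
      proof -
        have dz: "R - dist a z \<ge> d / 2" using z dist_triangle[of a z z0] by (simp add: d_def)
        then have "z \<in> cball a R" using d by simp
        then have "\<Phi> z \<le> \<Phi> z0" by (rule z0)
        then have "(R - dist a z) powr (2 / q) * cmod (F z) \<le> d powr (2 / q) * cmod (F z0)"
          by (simp add: \<Phi>_def d_def)
        moreover have "(d / 2) powr (2 / q) \<le> (R - dist a z) powr (2 / q)"
          using dz d q by (intro powr_mono2) auto
        ultimately have "(d / 2) powr (2 / q) * cmod (F z) \<le> d powr (2 / q) * cmod (F z0)"
          by (meson mult_right_mono norm_ge_zero order_trans)
        moreover have "d powr (2 / q) = (d / 2) powr (2 / q) * M"
          using d by (simp add: M_def powr_divide)
        ultimately show ?thesis using d by (simp add: mult.assoc)
      qed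
      define \<rho> where "\<rho> = d / (8 * M)"
      have \<rho>: "\<rho> > 0" using d M1 by (simp add: \<rho>_def)
      have \<rho>_le: "\<rho> \<le> d" using d M1 by (simp add: \<rho>_def field_simps)
      have hol2: "F holomorphic_on ball z0 d"
        using hol sub1 subR holomorphic_on_subset by blast
      have low: "cmod (F z0) / 2 \<le> cmod (F z)" if "z \<in> ball z0 \<rho>" for z
        using holomorphic_lower_bound_near_maximum[OF d hol2 M1 bound] that
        unfolding \<rho>_def by blast
      have subr: "ball z0 \<rho> \<subseteq> ball a r" using sub1 subR subset_ball[OF \<rho>_le, of z0] by blast
      have "ennreal ((cmod (F z0) / 2) powr q) * ennreal (pi * \<rho>\<^sup>2)
          = (\<integral>\<^sup>+z. ennreal ((cmod (F z0) / 2) powr q) * indicator (ball z0 \<rho>) z \<partial>lborel)"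
        using \<rho> by (simp add: nn_integral_cmult_indicator emeasure_lborel_complex_ball)
      also have "\<dots> \<le> (\<integral>\<^sup>+z\<in>ball a r. ennreal (cmod (F z) powr q) \<partial>lborel)"
        using subr low q
        by (intro nn_integral_mono) (auto simp: indicator_def intro!: ennreal_leI powr_mono2)
      finally have int: "ennreal ((cmod (F z0) / 2) powr q) * ennreal (pi * \<rho>\<^sup>2)
          \<le> (\<integral>\<^sup>+z\<in>ball a r. ennreal (cmod (F z) powr q) \<partial>lborel)" .
      \<comment> \<open>The exponent \<open>2 / q\<close> in \<open>\<Phi>\<close> is chosen so that
        the power \<open>q\<close> leaves the square of a distance, to be compared with an
        area.\<close>
      have "\<Phi> a powr q \<le> \<Phi> z0 powr q" using a_le a_pos q by (intro powr_mono2) auto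
      moreover have "\<Phi> a powr q = R\<^sup>2 * cmod (F a) powr q"
        using R q by (simp add: \<Phi>_def powr_mult powr_powr)
      moreover have "\<Phi> z0 powr q = d\<^sup>2 * cmod (F z0) powr q"
        using d q by (simp add: \<Phi>_def powr_mult powr_powr flip: d_def)
      ultimately have "R\<^sup>2 * cmod (F a) powr q \<le> d\<^sup>2 * cmod (F z0) powr q" by simp
      moreover have "C * ((cmod (F z0) / 2) powr q * (pi * \<rho>\<^sup>2)) = 4 * (d\<^sup>2 * cmod (F z0) powr q)"
        using M1 by (simp add: C_def \<rho>_def powr_divide power_divide field_simps power2_eq_square)
      ultimately have "r\<^sup>2 * cmod (F a) powr q \<le> C * ((cmod (F z0) / 2) powr q * (pi * \<rho>\<^sup>2))"
        by (simp add: R_def power_divide)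
      then have "ennreal (r\<^sup>2 * cmod (F a) powr q) \<le> ennreal (C * ((cmod (F z0) / 2) powr q * (pi * \<rho>\<^sup>2)))"
        by (rule ennreal_leI)
      also have "\<dots> = ennreal C * (ennreal ((cmod (F z0) / 2) powr q) * ennreal (pi * \<rho>\<^sup>2))"
        using C by (simp add: ennreal_mult' ennreal_mult'')
      also have "\<dots> \<le> ennreal C * (\<integral>\<^sup>+z\<in>ball a r. ennreal (cmod (F z) powr q) \<partial>lborel)"
        using int by (rule mult_left_mono) simp
      finally show ?thesis .
    qed
  qed
qed

text \<open>One maximiser \<open>z1\<close> of the modulus over \<open>cball a (r/4)\<close> serves
  both entries of the maximum: it dominates \<open>F a\<close>, and by Cauchy's estimate
  \<open>4 * cmod (F z1)\<close> dominates \<open>r * cmod (deriv F a)\<close>. The previous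
  estimate is then applied on \<open>ball z1 (r/2)\<close>, which stays inside
  \<open>ball a r\<close>.\<close>

lemma holomorphic_jet_powr_le_integral:
  assumes q: "(q::real) > 0"
  obtains C where "C > 0"
    "\<And>F a r. r > 0 \<Longrightarrow> F holomorphic_on ball a r \<Longrightarrow>
       ennreal (r\<^sup>2 * max (cmod (F a)) (r * cmod (deriv F a)) powr q) \<le>
       ennreal C * (\<integral>\<^sup>+z\<in>ball a r. ennreal (cmod (F z) powr q) \<partial>lborel)"
proof -
  obtain C where C: "C > 0"
    "\<And>F a r. r > 0 \<Longrightarrow> F holomorphic_on ball a r \<Longrightarrow>
       ennreal (r\<^sup>2 * cmod (F a) powr q) \<le>
       ennreal C * (\<integral>\<^sup>+z\<in>ball a r. ennreal (cmod (F z) powr q) \<partial>lborel)"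
    using holomorphic_powr_le_integral[OF q] by blast
  \<comment> \<open>\<open>4 powr q\<close> comes from the bound by \<open>4 * cmod (F z1)\<close>,
    the other 4 from halving the radius.\<close>
  define D where "D = 4 * 4 powr q * C"
  show ?thesis
  proof (rule that[of D])
    show "D > 0" using C by (simp add: D_def)
    fix F :: "complex \<Rightarrow> complex" and a r
    assume r: "r > 0" and hol: "F holomorphic_on ball a r"
    let ?I = "\<integral>\<^sup>+z\<in>ball a r. ennreal (cmod (F z) powr q) \<partial>lborel"
    have sub: "cball a (r/4) \<subseteq> ball a r" using r by auto
    have "continuous_on (cball a (r/4)) (\<lambda>z. cmod (F z))"
      using hol sub holomorphic_on_imp_continuous_on continuous_on_subset continuous_on_norm by blast
    then obtain z1 where z1: "z1 \<in> cball a (r/4)" "\<And>z. z \<in> cball a (r/4) \<Longrightarrow> cmod (F z) \<le> cmod (F z1)"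
      using continuous_attains_sup[of "cball a (r/4)" "\<lambda>z. cmod (F z)"] r by auto
    have "cmod (deriv F a) \<le> cmod (F z1) / (r / 4)"
      using z1(2) r by (intro norm_deriv_le_of_cball[OF hol sub]) auto
    then have "r * cmod (deriv F a) \<le> 4 * cmod (F z1)" using r by (simp add: field_simps)
    moreover have "cmod (F a) \<le> cmod (F z1)" using z1(2)[of a] r by simp
    ultimately have "max (cmod (F a)) (r * cmod (deriv F a)) \<le> 4 * cmod (F z1)"
      using norm_ge_zero[of "F z1"] by linarith
    then have "max (cmod (F a)) (r * cmod (deriv F a)) powr q \<le> (4 * cmod (F z1)) powr q"
      using r q by (intro powr_mono2) (auto simp: le_max_iff_disj)
    then have "r\<^sup>2 * max (cmod (F a)) (r * cmod (deriv F a)) powr q \<le> 4 * 4 powr q * ((r/2)\<^sup>2 * cmod (F z1) powr q)"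
      using r by (simp add: powr_mult power_divide)
    then have "ennreal (r\<^sup>2 * max (cmod (F a)) (r * cmod (deriv F a)) powr q) \<le> ennreal (4 * 4 powr q) * ennreal ((r/2)\<^sup>2 * cmod (F z1) powr q)"
      by (subst ennreal_mult[symmetric]) (auto intro: ennreal_leI)
    also have "\<dots> \<le> ennreal (4 * 4 powr q) * (ennreal C * (\<integral>\<^sup>+z\<in>ball z1 (r/2). ennreal (cmod (F z) powr q) \<partial>lborel))"
    proof (intro mult_left_mono)
      have "ball z1 (r/2) \<subseteq> ball a r"
      proof
        fix z assume "z \<in> ball z1 (r/2)"
        then show "z \<in> ball a r" using z1(1) r dist_triangle[of a z z1] by simp
      qed
      then have "F holomorphic_on ball z1 (r / 2)" using hol holomorphic_on_subset by blast
      then show "ennreal ((r/2)\<^sup>2 * cmod (F z1) powr q)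
          \<le> ennreal C * (\<integral>\<^sup>+z\<in>ball z1 (r/2). ennreal (cmod (F z) powr q) \<partial>lborel)"
        using r by (intro C) auto
    qed auto
    also have "\<dots> \<le> ennreal (4 * 4 powr q) * (ennreal C * ?I)"
    proof (rule mult_left_mono[OF mult_left_mono[OF nn_integral_mono]])
      fix z show "ennreal (cmod (F z) powr q) * indicator (ball z1 (r/2)) z
        \<le> ennreal (cmod (F z) powr q) * indicator (ball a r) z"
        using z1(1) r dist_triangle[of a z z1] by (auto simp: indicator_def)
    qed auto
    also have "\<dots> = ennreal D * ?I"
      using C by (simp add: D_def ennreal_mult' ennreal_mult'' mult.assoc)
    finally show "ennreal (r\<^sup>2 * max (cmod (F a)) (r * cmod (deriv F a)) powr q) \<le> ennreal D * ?I" .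
  qed
qed

section \<open>Weighted spaces of entire functions\<close>

lemma enn2real_pos: "0 < p \<Longrightarrow> p \<noteq> \<infinity> \<Longrightarrow> 0 < enn2real p"
  by (simp add: enn2real_positive_iff top.not_eq_extremum)

definition weighted_abs :: "(real \<Rightarrow> real) \<Rightarrow> (complex \<Rightarrow> complex) \<Rightarrow> complex \<Rightarrow> real" where
  "weighted_abs \<psi> f z = cmod (f z) * exp (- \<psi> (cmod z))"

lemma weighted_abs_nonneg [simp]: "0 \<le> weighted_abs \<psi> f z"
  by (simp add: weighted_abs_def)

lemma weighted_abs_powr:
  "cmod (f z) powr q * exp (- (q * \<psi> (cmod z))) = weighted_abs \<psi> f z powr q"
  by (simp add: weighted_abs_def powr_mult exp_powr_real mult.commute)

locale continuous_weight =
  fixes \<psi> :: "real \<Rightarrow> real"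
  assumes continuous_weight: "continuous_on {0..} \<psi>"
    and weight_nonneg: "\<And>r. 0 \<le> r \<Longrightarrow> 0 \<le> \<psi> r"
begin

abbreviation W where "W \<equiv> weighted_abs \<psi>"
abbreviation \<F> where "\<F> \<equiv> fock_space \<psi>"
abbreviation \<N> where "\<N> \<equiv> fock_norm \<psi>"

lemma continuous_on_radial_weight: "continuous_on A (\<lambda>z::complex. \<psi> (cmod z))"
  by (rule continuous_on_compose2[OF continuous_weight]) (auto intro: continuous_intros)

lemma continuous_on_weighted_abs: "f holomorphic_on UNIV \<Longrightarrow> continuous_on UNIV (W f)"
  unfolding weighted_abs_def
  by (intro continuous_intros continuous_on_radial_weight holomorphic_on_imp_continuous_on)

lemma measurable_weighted_abs:
  "f holomorphic_on UNIV \<Longrightarrow> W f \<in> borel_measurable lborel"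
  using borel_measurable_continuous_onI[OF continuous_on_weighted_abs] by simp

lemma fock_space_holomorphic: "f \<in> \<F> p \<Longrightarrow> f holomorphic_on UNIV"
  by (simp add: fock_space_def)

lemma fock_space_infinity_iff:
  "f \<in> \<F> \<infinity> \<longleftrightarrow> f holomorphic_on UNIV \<and> bdd_above (range (W f))"
  by (simp add: fock_space_def weighted_abs_def [abs_def])

lemma fock_norm_infinity: "\<N> \<infinity> f = (SUP z. W f z)"
  by (simp add: fock_norm_def weighted_abs_def)

lemma weighted_abs_le_fock_norm:
  "f \<in> \<F> \<infinity> \<Longrightarrow> W f z \<le> \<N> \<infinity> f"
  unfolding fock_norm_infinity fock_space_infinity_iff by (auto intro: cSUP_upper)

lemma fock_space_finite_iff:
  assumes "p \<noteq> \<infinity>"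
  shows "f \<in> \<F> p \<longleftrightarrow> f holomorphic_on UNIV \<and>
           (\<integral>\<^sup>+z. ennreal (W f z powr enn2real p) \<partial>lborel) < \<infinity>"
proof (cases "f holomorphic_on UNIV")
  case True
  have "(\<lambda>z. W f z powr enn2real p) \<in> borel_measurable lborel"
    using measurable_weighted_abs[OF True] by measurable
  then show ?thesis
    using assms True by (simp add: fock_space_def weighted_abs_powr integrable_iff_bounded)
qed (simp add: fock_space_def)

lemma fock_norm_finite:
  assumes "p \<noteq> \<infinity>"
  shows "\<N> p f = (LINT z|lborel. W f z powr enn2real p) powr (1 / enn2real p)"
  using assms by (simp add: fock_norm_def weighted_abs_powr)

lemma fock_norm_nonneg: "f \<in> \<F> p \<Longrightarrow> 0 \<le> \<N> p f"
proof (cases "p = \<infinity>")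
  case True
  assume "f \<in> \<F> p"
  then show ?thesis using True weighted_abs_le_fock_norm[of f 0] weighted_abs_nonneg[of \<psi> f 0]
    by (auto intro: order_trans simp del: weighted_abs_nonneg)
qed (simp add: fock_norm_finite)

lemma fock_norm_powr:
  assumes p: "p \<noteq> \<infinity>" "0 < p" and f: "f \<in> \<F> p"
  shows "(\<integral>\<^sup>+z. ennreal (W f z powr enn2real p) \<partial>lborel) = ennreal (\<N> p f powr enn2real p)"
proof -
  have "enn2real p > 0" using p by (simp add: enn2real_pos)
  moreover have "integrable lborel (\<lambda>z. W f z powr enn2real p)"
    using f p by (simp add: fock_space_def weighted_abs_powr)
  ultimately show ?thesis
    by (simp add: nn_integral_eq_integral fock_norm_finite[OF p(1)] powr_powr Bochner_Integration.integral_nonneg)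
qed

lemma fock_normI_finite:
  assumes p: "p \<noteq> \<infinity>" "0 < p" and f: "f holomorphic_on UNIV" and C: "0 \<le> C"
    and le: "(\<integral>\<^sup>+z. ennreal (W f z powr enn2real p) \<partial>lborel) \<le> ennreal (C powr enn2real p)"
  shows "f \<in> \<F> p" "\<N> p f \<le> C"
proof -
  have q: "enn2real p > 0" using p by (simp add: enn2real_pos)
  show f': "f \<in> \<F> p"
    using f le p(1) by (simp add: fock_space_finite_iff order_le_less_trans[OF le])
  have "\<N> p f powr enn2real p \<le> C powr enn2real p"
    using le fock_norm_powr[OF p f'] by simp
  then show "\<N> p f \<le> C"
    using q C fock_norm_nonneg[OF f'] by (meson not_le powr_less_mono2)
qed

lemma fock_normI_infinity:
  assumes f: "f holomorphic_on UNIV" and le: "\<And>z. W f z \<le> C"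
  shows "f \<in> \<F> \<infinity>" "\<N> \<infinity> f \<le> C"
  using assms unfolding fock_space_infinity_iff fock_norm_infinity
  by (auto intro!: cSUP_least bdd_aboveI2)

lemma fock_norm_cong_norm:
  "(\<And>z. cmod (f z) = cmod (h z)) \<Longrightarrow> \<N> p f = \<N> p h"
  by (simp add: fock_norm_def)

lemma fock_space_zero [simp]: "(\<lambda>z. 0) \<in> \<F> p"
  by (simp add: fock_space_def)

lemma fock_norm_zero [simp]: "\<N> p (\<lambda>z. 0) = 0"
  by (simp add: fock_norm_def)

lemma fock_space_mono_norm:
  assumes p: "0 < p" and f: "f \<in> \<F> p" and h: "h holomorphic_on UNIV" and c: "0 \<le> c"
    and le: "\<And>z. cmod (h z) \<le> c * cmod (f z)"
  shows "h \<in> \<F> p" "\<N> p h \<le> c * \<N> p f"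
proof -
  have W: "W h z \<le> c * W f z" for z
    using mult_right_mono[OF le[of z], of "exp (- \<psi> (cmod z))"] by (simp add: weighted_abs_def mult.assoc)
  have "h \<in> \<F> p \<and> \<N> p h \<le> c * \<N> p f"
  proof (cases "p = \<infinity>")
    case True
    have "W h z \<le> c * \<N> \<infinity> f" for z
      using weighted_abs_le_fock_norm[of f z] f True c W[of z]
      by (meson mult_left_mono order_trans)
    then show ?thesis using fock_normI_infinity[OF h] True by auto
  next
    case False
    have q: "enn2real p > 0" using p False by (simp add: enn2real_pos)
    have "(\<integral>\<^sup>+z. ennreal (W h z powr enn2real p) \<partial>lborel)
        \<le> (\<integral>\<^sup>+z. ennreal (c powr enn2real p) * ennreal (W f z powr enn2real p) \<partial>lborel)"
      using q W c by (intro nn_integral_mono)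
        (simp flip: ennreal_mult powr_mult add: powr_mono2)
    also have "\<dots> = ennreal (c powr enn2real p) * ennreal (\<N> p f powr enn2real p)"
      using measurable_weighted_abs[OF fock_space_holomorphic[OF f]]
      by (simp add: nn_integral_cmult fock_norm_powr[OF False p f])
    also have "\<dots> = ennreal ((c * \<N> p f) powr enn2real p)"
      using c fock_norm_nonneg[OF f] by (simp add: powr_mult flip: ennreal_mult)
    finally have "(\<integral>\<^sup>+z. ennreal (W h z powr enn2real p) \<partial>lborel)
        \<le> ennreal ((c * \<N> p f) powr enn2real p)" .
    then show ?thesis
      using fock_normI_finite[OF False p h, of "c * \<N> p f"] c fock_norm_nonneg[OF f] by auto
  qed
  then show "h \<in> \<F> p" "\<N> p h \<le> c * \<N> p f" by auto
qed

lemma radial_weight_bounded: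
  obtains M where "M \<ge> 0" "\<And>z. cmod z \<le> R \<Longrightarrow> \<psi> (cmod z) \<le> M"
proof -
  have "compact ((\<lambda>z::complex. \<psi> (cmod z)) ` cball 0 R)"
    by (intro compact_continuous_image continuous_on_radial_weight) simp
  then obtain M where "\<forall>x\<in>(\<lambda>z::complex. \<psi> (cmod z)) ` cball 0 R. norm x \<le> M"
    using compact_imp_bounded bounded_iff by metis
  then have "\<psi> (cmod z) \<le> max M 0" if "cmod z \<le> R" for z using that by force
  then show ?thesis by (intro that[of "max M 0"]) auto
qed

text \<open>Near \<open>a\<close> the weight is bounded, so the norm controls the unweighted size of
  \<open>F\<close> on the unit disc about \<open>a\<close>, and with it \<open>F a\<close> and
  \<open>deriv F a\<close>. Limits in norm can thus be identified pointwise.\<close>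

lemma fock_evaluation_bounded:
  assumes p: "0 < p"
  obtains C where "C > 0"
    "\<And>F. F \<in> \<F> p \<Longrightarrow> cmod (F a) \<le> C * \<N> p F"
    "\<And>F. F \<in> \<F> p \<Longrightarrow> cmod (deriv F a) \<le> C * \<N> p F"
proof (cases "p = \<infinity>")
  case True
  obtain M where M: "M \<ge> 0" "\<And>z. cmod z \<le> cmod a + 1 \<Longrightarrow> \<psi> (cmod z) \<le> M"
    using radial_weight_bounded by blast
  have le: "cmod (F z) \<le> exp M * \<N> p F"
    if F: "F \<in> \<F> p" and z: "cmod z \<le> cmod a + 1" for F z
  proof -
    have "cmod (F z) = exp (\<psi> (cmod z)) * W F z"
      by (simp add: weighted_abs_def exp_minus)
    also have "\<dots> \<le> exp M * \<N> p F"
      using M z F True weighted_abs_le_fock_norm[of F z] by (intro mult_mono) auto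
    finally show ?thesis .
  qed
  show ?thesis
  proof (rule that[of "exp M"])
    fix F assume F: "F \<in> \<F> p"
    then show "cmod (F a) \<le> exp M * \<N> p F" by (intro le) auto
    have "cmod (deriv F a) \<le> (exp M * \<N> p F) / 1"
    proof (rule norm_deriv_le_of_cball[OF fock_space_holomorphic[OF F]])
      fix x assume "x \<in> cball a 1"
      then show "cmod (F x) \<le> exp M * \<N> p F"
        using F norm_triangle_ineq2[of x a] by (intro le) (auto simp: dist_norm norm_minus_commute)
    qed auto
    then show "cmod (deriv F a) \<le> exp M * \<N> p F" by simp
  qed simp
next
  case False
  define q where "q = enn2real p"
  have q: "q > 0" using p False by (simp add: q_def enn2real_pos)
  obtain M where M: "M \<ge> 0" "\<And>z. cmod z \<le> cmod a + 1 \<Longrightarrow> \<psi> (cmod z) \<le> M"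
    using radial_weight_bounded by blast
  obtain C where C: "C > 0" "\<And>F a r. r > 0 \<Longrightarrow> F holomorphic_on ball a r \<Longrightarrow>
       ennreal (r\<^sup>2 * max (cmod (F a)) (r * cmod (deriv F a)) powr q) \<le>
       ennreal C * (\<integral>\<^sup>+z\<in>ball a r. ennreal (cmod (F z) powr q) \<partial>lborel)"
    using holomorphic_jet_powr_le_integral[OF q] by blast
  define D where "D = (C * exp (M * q)) powr (1 / q)"
  have main: "max (cmod (F a)) (cmod (deriv F a)) \<le> D * \<N> p F"
    if F: "F \<in> \<F> p" for F
  proof -
    define x where "x = max (cmod (F a)) (cmod (deriv F a))"
    have x: "x \<ge> 0" by (simp add: x_def le_max_iff_disj)
    have "F holomorphic_on ball a 1"
      using fock_space_holomorphic[OF F] holomorphic_on_subset by blast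
    from C(2)[OF zero_less_one this]
    have xq: "ennreal (x powr q) \<le> ennreal C * (\<integral>\<^sup>+z\<in>ball a 1. ennreal (cmod (F z) powr q) \<partial>lborel)"
      by (simp add: x_def)
    have "(\<integral>\<^sup>+z\<in>ball a 1. ennreal (cmod (F z) powr q) \<partial>lborel)
        \<le> (\<integral>\<^sup>+z. ennreal (exp (M * q)) * ennreal (W F z powr q) \<partial>lborel)"
    proof (rule nn_integral_mono)
      fix z :: complex
      show "ennreal (cmod (F z) powr q) * indicator (ball a 1) z \<le> ennreal (exp (M * q)) * ennreal (W F z powr q)"
      proof (cases "z \<in> ball a 1")
        case True
        then have "cmod z \<le> cmod a + 1"
          using norm_triangle_ineq2[of z a] by (simp add: dist_norm norm_minus_commute)
        then have "cmod (F z) \<le> exp M * W F z"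
          using M(2)[of z] mult_left_mono[of 1 "exp (M - \<psi> (cmod z))" "cmod (F z)"]
          by (simp add: weighted_abs_def exp_diff exp_minus field_simps)
        then have "cmod (F z) powr q \<le> (exp M * W F z) powr q" using q by (intro powr_mono2) auto
        also have "\<dots> = exp (M * q) * W F z powr q" by (simp add: powr_mult exp_powr_real)
        finally show ?thesis using True by (simp flip: ennreal_mult)
      qed simp
    qed
    also have "\<dots> = ennreal (exp (M * q)) * ennreal (\<N> p F powr q)"
      using measurable_weighted_abs[OF fock_space_holomorphic[OF F]]
      by (simp add: nn_integral_cmult fock_norm_powr[OF False p F, folded q_def])
    finally have "ennreal C * (\<integral>\<^sup>+z\<in>ball a 1. ennreal (cmod (F z) powr q) \<partial>lborel)
       \<le> ennreal C * (ennreal (exp (M * q)) * ennreal (\<N> p F powr q))"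
      by (rule mult_left_mono) simp
    with xq have "ennreal (x powr q) \<le> ennreal C * (ennreal (exp (M * q)) * ennreal (\<N> p F powr q))"
      by (rule order_trans)
    also have "\<dots> = ennreal ((C * exp (M * q)) * \<N> p F powr q)"
      using C(1) by (simp add: mult.assoc flip: ennreal_mult)
    also have "(C * exp (M * q)) * \<N> p F powr q = (D * \<N> p F) powr q"
      using C(1) q fock_norm_nonneg[OF F] by (simp add: D_def powr_mult powr_powr)
    finally have "x powr q \<le> (D * \<N> p F) powr q" by simp
    moreover have "D * \<N> p F \<ge> 0" using fock_norm_nonneg[OF F] by (simp add: D_def)
    ultimately show ?thesis using q x unfolding x_def by (meson not_le powr_less_mono2)
  qed
  show ?thesis
    by (rule that[of D]) (use C(1) main in \<open>auto simp: D_def\<close>)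
qed

lemma fock_norm_eq_0_imp:
  assumes "0 < p" "f \<in> \<F> p" "\<N> p f = 0"
  shows "f = (\<lambda>z. 0)"
proof
  fix a
  obtain C where "C > 0" "\<And>F. F \<in> \<F> p \<Longrightarrow> cmod (F a) \<le> C * \<N> p F"
    using fock_evaluation_bounded[OF assms(1)] by metis
  then have "cmod (f a) \<le> C * \<N> p f" using assms by blast
  then show "f a = 0" using assms(3) by simp
qed

text \<open>
  For \<open>p = \<infinity>\<close> the quotients \<open>2 / enn2real p\<close> and \<open>3 / enn2real p\<close> are \<open>0\<close>, because \<open>enn2real \<infinity> = 0\<close> and
  \<open>x / 0 = 0\<close>; this is the intended value of the exponents below.
\<close>

definition decay_bound :: "(complex \<Rightarrow> complex) \<Rightarrow> complex \<Rightarrow> real \<Rightarrow> real \<Rightarrow> nat \<Rightarrow> bool" where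
  "decay_bound f a t M k \<longleftrightarrow> f holomorphic_on UNIV \<and>
     (\<forall>z. W f z \<le> M \<and> cmod (z - a) ^ k * W f z \<le> M * t ^ k)"

text \<open>For finite \<open>p\<close> the plane is cut into dyadic annuli about \<open>a\<close>.
  At distance about \<open>2 ^ j * t\<close> the decay of order \<open>k\<close> and
  \<open>k * p \<ge> 3\<close> bound the integrand by a multiple of \<open>8\<close> to the power
  \<open>- j\<close>, while the area grows like \<open>4 ^ j\<close>.\<close>

lemma fock_norm_le_of_decay:
  assumes p: "0 < p"
  obtains C where "C > 0"
    "\<And>f a t M k. decay_bound f a t M k \<Longrightarrow> t > 0 \<Longrightarrow> 3 / enn2real p \<le> real k \<Longrightarrow>
       f \<in> \<F> p \<and> \<N> p f \<le> C * M * t powr (2 / enn2real p)"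
proof (cases "p = \<infinity>")
  case True
  show ?thesis
  proof (rule that[of 1])
    fix f a t M k assume "decay_bound f a t M k" "(t::real) > 0"
    then show "f \<in> \<F> p \<and> \<N> p f \<le> 1 * M * t powr (2 / enn2real p)"
      using fock_normI_infinity[of f M] True by (simp add: decay_bound_def)
  qed simp
next
  case False
  define q where "q = enn2real p"
  have q: "q > 0" using p False by (simp add: q_def enn2real_pos)
  show ?thesis
  proof (rule that[of "(16 * pi) powr (1 / q)"])
    fix f :: "complex \<Rightarrow> complex" and a :: complex and t M :: real and k :: nat
    assume decay: "decay_bound f a t M k" and t: "t > 0" and k: "3 / enn2real p \<le> real k"
    have f: "f holomorphic_on UNIV" and b1: "\<And>z. W f z \<le> M"
      and b2: "\<And>z. cmod (z - a) ^ k * W f z \<le> M * t ^ k"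
      using decay by (auto simp: decay_bound_def)
    have M: "M \<ge> 0" using b1[of 0] weighted_abs_nonneg[of \<psi> f 0] by linarith
    have k3: "3 \<le> real k * q" using k q by (simp add: q_def field_simps)
    \<comment> \<open>The factor 8 pays for one index: outside the ball number \<open>i\<close> the
      decay is \<open>(1/8) ^ i\<close>, but the point is counted in the ball
      \<open>j = Suc i\<close>.\<close>
    define c where "c = 8 * M powr q"
    have c: "c \<ge> 0" by (simp add: c_def)
    have pw: "W f z powr q \<le> c * (1/8) ^ j \<and> z \<in> ball a (2 ^ j * t)"
      if j: "j = (LEAST j. cmod (z - a) < 2 ^ j * t)" for z j
    proof -
      have "\<exists>j. cmod (z - a) < 2 ^ j * t"
        using real_arch_pow[of 2 "cmod (z - a) / t"] t by (auto simp: field_simps)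
      then have lt: "cmod (z - a) < 2 ^ j * t" unfolding j by (rule LeastI_ex)
      have "W f z powr q \<le> c * (1/8) ^ j"
      proof (cases j)
        case 0
        have "W f z powr q \<le> M powr q" using b1 q by (intro powr_mono2) auto
        also have "\<dots> \<le> c" by (simp add: c_def)
        finally show ?thesis using 0 by simp
      next
        case (Suc i)
        have "\<not> cmod (z - a) < 2 ^ i * t" using not_less_Least[of i "\<lambda>j. cmod (z - a) < 2 ^ j * t"] Suc j by simp
        then have "(2 ^ i * t) ^ k \<le> cmod (z - a) ^ k" using t by (intro power_mono) auto
        then have "(2 ^ i * t) ^ k * W f z \<le> M * t ^ k"
          using b2[of z] weighted_abs_nonneg[of \<psi> f z] by (meson mult_right_mono order_trans)
        then have "W f z \<le> M * (1 / 2 ^ i) ^ k"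
          using t by (simp add: power_mult_distrib power_divide field_simps)
        then have "W f z powr q \<le> (M * (1 / 2 ^ i) ^ k) powr q" using q by (intro powr_mono2) auto
        also have "\<dots> = M powr q * ((1 / 2 ^ i) powr (real k * q))"
          using M by (simp add: powr_mult powr_powr flip: powr_realpow)
        also have "\<dots> \<le> M powr q * ((1 / 2 ^ i) powr 3)"
          using k3 by (intro mult_left_mono powr_mono') (auto)
        also have "(1 / 2 ^ i) powr 3 = (1/8::real) ^ i"
        proof -
          have "(1 / 2 ^ i) powr 3 = ((1 / 2) ^ i :: real) ^ 3"
            by (simp add: powr_numeral power_one_over)
          also have "\<dots> = ((1 / 2) ^ 3) ^ i" by (metis mult.commute power_mult)
          also have "(1 / 2) ^ 3 = (1 / 8 :: real)" by (simp add: power_divide)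
          finally show ?thesis .
        qed
        also have "M powr q * (1/8) ^ i = c * (1/8) ^ j" by (simp add: c_def Suc)
        finally show ?thesis .
      qed
      then show ?thesis using lt by (simp add: dist_norm norm_minus_commute)
    qed
    have [measurable]: "ball a s \<in> sets borel" for s by simp
    have "(\<integral>\<^sup>+z. ennreal (W f z powr q) \<partial>lborel)
        \<le> (\<integral>\<^sup>+z. (\<Sum>j. ennreal (c * (1/8) ^ j) * indicator (ball a (2 ^ j * t)) z) \<partial>lborel)"
    proof (rule nn_integral_mono)
      fix z :: complex
      define j where "j = (LEAST j. cmod (z - a) < 2 ^ j * t)"
      have "ennreal (W f z powr q) \<le> ennreal (c * (1/8) ^ j) * indicator (ball a (2 ^ j * t)) z"
        using pw[OF j_def] by (auto intro: ennreal_leI)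
      also have "\<dots> \<le> (\<Sum>j. ennreal (c * (1/8) ^ j) * indicator (ball a (2 ^ j * t)) z)"
        using sum_le_suminf[of "\<lambda>j. ennreal (c * (1/8) ^ j) * indicator (ball a (2 ^ j * t)) z" "{j}"]
        by (simp del: sum_mult_indicator)
      finally show "ennreal (W f z powr q) \<le> \<dots>" .
    qed
    also have "\<dots> = (\<Sum>j. ennreal (c * (1/8) ^ j) * ennreal (pi * (2 ^ j * t)\<^sup>2))"
      using t by (subst nn_integral_suminf)
        (simp_all add: nn_integral_cmult_indicator emeasure_lborel_complex_ball, measurable)
    also have "\<dots> = (\<Sum>j. ennreal (c * pi * t\<^sup>2 * (1/2) ^ j))"
    proof (rule suminf_cong)
      fix j
      have "c * (1/8) ^ j * (pi * (2 ^ j * t)\<^sup>2) = c * pi * t\<^sup>2 * ((1/8) ^ j * (2 ^ j)\<^sup>2)"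
        by (simp only: power_mult_distrib mult_ac)
      also have "(1/8) ^ j * (2 ^ j)\<^sup>2 = (1/2::real) ^ j"
      proof -
        have "(2 ^ j)\<^sup>2 = (2\<^sup>2 :: real) ^ j" by (metis mult.commute power_mult)
        then have "(1/8) ^ j * (2 ^ j)\<^sup>2 = (1/8 * 2\<^sup>2 :: real) ^ j" by (simp only: power_mult_distrib)
        then show ?thesis by simp
      qed
      finally show "ennreal (c * (1/8) ^ j) * ennreal (pi * (2 ^ j * t)\<^sup>2) = ennreal (c * pi * t\<^sup>2 * (1/2) ^ j)"
        using c by (simp flip: ennreal_mult)
    qed
    also have "\<dots> = ennreal (\<Sum>j. c * pi * t\<^sup>2 * (1/2) ^ j)"
      using c by (intro suminf_ennreal2 summable_mult summable_geometric) auto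
    also have "(\<Sum>j. c * pi * t\<^sup>2 * (1/2) ^ j) = c * pi * t\<^sup>2 * 2"
      by (subst suminf_mult) (auto simp: suminf_geometric summable_geometric)
    also have "\<dots> = ((16 * pi) powr (1 / q) * M * t powr (2 / q)) powr q"
      using M t q by (simp add: powr_mult powr_powr c_def)
    finally have "(\<integral>\<^sup>+z. ennreal (W f z powr q) \<partial>lborel)
        \<le> ennreal (((16 * pi) powr (1 / q) * M * t powr (2 / q)) powr q)" .
    then show "f \<in> \<F> p \<and> \<N> p f \<le> (16 * pi) powr (1 / q) * M * t powr (2 / enn2real p)"
      using fock_normI_finite[OF False p f, of "(16 * pi) powr (1 / q) * M * t powr (2 / q)"] M
      by (simp add: q_def)
  qed simp
qed

section \<open>The operators with constant symbol\<close>

lemma integral_op_holomorphic: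
  assumes f: "f holomorphic_on UNIV" and g: "g holomorphic_on UNIV"
  shows "integral_op g f holomorphic_on UNIV"
    and "deriv (integral_op g f) z = deriv f z * g z"
    and "integral_op g f 0 = 0"
proof -
  have "(\<lambda>w. deriv f w * g w) holomorphic_on UNIV"
    using f g by (intro holomorphic_intros) auto
  then obtain P where P: "\<And>x. (P has_field_derivative deriv f x * g x) (at x)"
    using holomorphic_convex_primitive'[of UNIV "\<lambda>w. deriv f w * g w"] by auto
  have eq: "integral_op g f = (\<lambda>z. P z - P 0)"
  proof
    fix z
    have "((\<lambda>w. deriv f w * g w) has_contour_integral (P z - P 0)) (linepath 0 z)"
      using contour_integral_primitive[of UNIV P "\<lambda>w. deriv f w * g w" "linepath 0 z"] P by simp
    then show "integral_op g f z = P z - P 0"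
      by (simp add: integral_op_def contour_integral_unique)
  qed
  have der: "((\<lambda>z. P z - P 0) has_field_derivative deriv f z * g z) (at z)" for z
    using P[of z] by (auto intro!: derivative_eq_intros)
  then show "deriv (integral_op g f) z = deriv f z * g z" unfolding eq by (rule DERIV_imp_deriv)
  show "integral_op g f holomorphic_on UNIV"
    unfolding eq holomorphic_on_def using der
    by (auto simp: field_differentiable_def intro: has_field_derivative_at_within)
  show "integral_op g f 0 = 0" by (simp add: eq)
qed

text \<open>By the fundamental theorem of calculus only the value at \<open>0\<close> is subtracted;
  this is why boundedness of \<open>I_g\<close> for constant \<open>g\<close> is derived from the
  constants lying in the space.\<close>

lemma integral_op_const:
  assumes f: "f holomorphic_on UNIV"
  shows "integral_op (\<lambda>z. c) f = (\<lambda>z. c * (f z - f 0))"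
proof
  fix z
  have "((\<lambda>w. c * f w) has_field_derivative deriv f x * c) (at x within UNIV)" for x
    using holomorphic_derivI[OF f open_UNIV, of x] by (auto intro!: derivative_eq_intros)
  then have "((\<lambda>w. deriv f w * c) has_contour_integral (c * f z - c * f 0)) (linepath 0 z)"
    using contour_integral_primitive[of UNIV "\<lambda>w. c * f w" "\<lambda>w. deriv f w * c" "linepath 0 z"] by simp
  then show "integral_op (\<lambda>z. c) f z = c * (f z - f 0)"
    by (simp add: integral_op_def contour_integral_unique algebra_simps)
qed

lemma bounded_mult_op_const: "0 < p \<Longrightarrow> bounded_operator \<psi> p p (mult_op (\<lambda>z. c))"
  unfolding bounded_operator_def mult_op_def
proof (intro conjI exI ballI image_subsetI)
  fix f assume p: "0 < p" and f: "f \<in> \<F> p"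
  have "(\<lambda>z. c * f z) holomorphic_on UNIV"
    using fock_space_holomorphic[OF f] by (intro holomorphic_intros)
  then show "(\<lambda>z. c * f z) \<in> \<F> p" "\<N> p (\<lambda>z. c * f z) \<le> cmod c * \<N> p f"
    using fock_space_mono_norm[OF p f, of "\<lambda>z. c * f z" "cmod c"] by (auto simp: norm_mult)
qed

lemma weighted_abs_diff_le: "W (\<lambda>z. f z - h z) z \<le> W f z + W h z"
  using mult_right_mono[OF norm_triangle_ineq4[of "f z" "h z"], of "exp (- \<psi> (cmod z))"]
  by (simp add: weighted_abs_def algebra_simps)

text \<open>The triangle inequality fails for exponents below 1. The cruder (x + y)^q \<le> 2^q (x^q
  + y^q), a consequence of x + y \<le> 2 max x y, holds for every q > 0 and costs only a
  constant.\<close>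

lemma fock_norm_diff_le:
  assumes p: "0 < p"
  obtains C where "C > 0"
    "\<And>f h. f \<in> \<F> p \<Longrightarrow> h \<in> \<F> p \<Longrightarrow>
       (\<lambda>z. f z - h z) \<in> \<F> p \<and>
       \<N> p (\<lambda>z. f z - h z) \<le> C * (\<N> p f + \<N> p h)"
proof (cases "p = \<infinity>")
  case True
  show ?thesis
  proof (rule that[of 1])
    fix f h assume f: "f \<in> \<F> p" and h: "h \<in> \<F> p"
    have "W (\<lambda>z. f z - h z) z \<le> \<N> \<infinity> f + \<N> \<infinity> h" for z
      using weighted_abs_diff_le[of f h z] weighted_abs_le_fock_norm[of f z]
        weighted_abs_le_fock_norm[of h z] f h True by simp
    moreover have "(\<lambda>z. f z - h z) holomorphic_on UNIV"
      using fock_space_holomorphic[OF f] fock_space_holomorphic[OF h] by (intro holomorphic_intros)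
    ultimately show "(\<lambda>z. f z - h z) \<in> \<F> p \<and>
       \<N> p (\<lambda>z. f z - h z) \<le> 1 * (\<N> p f + \<N> p h)"
      using fock_normI_infinity[of "\<lambda>z. f z - h z" "\<N> \<infinity> f + \<N> \<infinity> h"] True by simp
  qed simp
next
  case False
  define q where "q = enn2real p"
  have q: "q > 0" using p False by (simp add: q_def enn2real_pos)
  \<comment> \<open>The first 2 is the root of \<open>2 powr q\<close>;
    \<open>2 powr (1 / q)\<close> absorbs the sum of two powers, each at most
    \<open>m powr q\<close>.\<close>
  define C where "C = 2 * 2 powr (1 / q)"
  show ?thesis
  proof (rule that[of C])
    fix f h assume f: "f \<in> \<F> p" and h: "h \<in> \<F> p"
    have hol: "(\<lambda>z. f z - h z) holomorphic_on UNIV"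
      using fock_space_holomorphic[OF f] fock_space_holomorphic[OF h] by (intro holomorphic_intros)
    have pw: "W (\<lambda>z. f z - h z) z powr q \<le> 2 powr q * (W f z powr q + W h z powr q)" for z
    proof -
      have "W (\<lambda>z. f z - h z) z \<le> W f z + W h z" by (rule weighted_abs_diff_le)
      also have "\<dots> \<le> 2 * max (W f z) (W h z)" by simp
      finally have "W (\<lambda>z. f z - h z) z powr q \<le> (2 * max (W f z) (W h z)) powr q"
        using q by (intro powr_mono2) auto
      also have "\<dots> = 2 powr q * max (W f z) (W h z) powr q" by (simp add: powr_mult max_def)
      also have "\<dots> \<le> 2 powr q * (W f z powr q + W h z powr q)"
        by (intro mult_left_mono) (auto simp: max_def)
      finally show ?thesis .
    qed
    define m where "m = \<N> p f + \<N> p h"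
    have nn: "\<N> p f \<ge> 0" "\<N> p h \<ge> 0" using f h fock_norm_nonneg by auto
    have "(\<integral>\<^sup>+z. ennreal (W (\<lambda>z. f z - h z) z powr q) \<partial>lborel)
        \<le> (\<integral>\<^sup>+z. ennreal (2 powr q) * (ennreal (W f z powr q) + ennreal (W h z powr q)) \<partial>lborel)"
      using pw by (intro nn_integral_mono) (simp flip: ennreal_mult ennreal_plus add: ennreal_leI)
    also have "\<dots> = ennreal (2 powr q) * (ennreal (\<N> p f powr q) + ennreal (\<N> p h powr q))"
    proof -
      have [measurable]: "W f \<in> borel_measurable lborel" "W h \<in> borel_measurable lborel"
        using measurable_weighted_abs fock_space_holomorphic f h by auto
      show ?thesis
        by (subst nn_integral_cmult, simp, subst nn_integral_add)
          (simp_all only: fock_norm_powr[OF False p f, folded q_def] fock_norm_powr[OF False p h, folded q_def],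
            measurable)
    qed
    also have "\<dots> = ennreal (2 powr q * (\<N> p f powr q + \<N> p h powr q))"
      by (simp flip: ennreal_mult ennreal_plus)
    also have "\<dots> \<le> ennreal (2 powr q * (m powr q + m powr q))"
      using q nn unfolding m_def by (intro ennreal_leI mult_left_mono add_mono powr_mono2) auto
    also have "2 powr q * (m powr q + m powr q) = (C * m) powr q"
      using q nn by (simp add: C_def powr_mult powr_powr m_def)
    finally have le: "(\<integral>\<^sup>+z. ennreal (W (\<lambda>z. f z - h z) z powr q) \<partial>lborel) \<le> ennreal ((C * m) powr q)" .
    have "C * m \<ge> 0" using nn by (simp add: C_def m_def)
    from fock_normI_finite[OF False p hol this le[unfolded q_def]]
    show "(\<lambda>z. f z - h z) \<in> \<F> p \<and>
       \<N> p (\<lambda>z. f z - h z) \<le> C * (\<N> p f + \<N> p h)"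
      by (simp add: m_def)
  qed (simp add: C_def)
qed

lemma fock_space_diff:
  assumes p: "0 < p" and f: "f \<in> \<F> p" and h: "h \<in> \<F> p"
  shows "(\<lambda>z. f z - h z) \<in> \<F> p"
  by (rule fock_norm_diff_le[OF p]) (use f h in blast)

text \<open>The image is \<open>c * (f z - f 0)\<close>. The constant \<open>f 0\<close> has norm at
  most the evaluation bound at the origin times the norm of 1.\<close>

lemma bounded_integral_op_const:
  assumes p: "0 < p" and one: "(\<lambda>z. 1) \<in> \<F> p"
  shows "bounded_operator \<psi> p p (integral_op (\<lambda>z. c))"
proof -
  obtain C1 where C1: "C1 > 0" "\<And>f h. f \<in> \<F> p \<Longrightarrow> h \<in> \<F> p \<Longrightarrow>
       (\<lambda>z. f z - h z) \<in> \<F> p \<and>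
       \<N> p (\<lambda>z. f z - h z) \<le> C1 * (\<N> p f + \<N> p h)"
    using fock_norm_diff_le[OF p] by blast
  obtain C2 where C2: "C2 > 0" "\<And>F. F \<in> \<F> p \<Longrightarrow> cmod (F 0) \<le> C2 * \<N> p F"
    using fock_evaluation_bounded[OF p] by metis
  define N where "N = \<N> p (\<lambda>z. 1)"
  have N: "N \<ge> 0" using fock_norm_nonneg[OF one] by (simp add: N_def)
  have main: "integral_op (\<lambda>z. c) f \<in> \<F> p \<and>
     \<N> p (integral_op (\<lambda>z. c) f) \<le> (cmod c * (C1 * (1 + C2 * N))) * \<N> p f"
    if f: "f \<in> \<F> p" for f
  proof -
    have c0: "(\<lambda>z. f 0) \<in> \<F> p" "\<N> p (\<lambda>z. f 0) \<le> cmod (f 0) * N"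
      using fock_space_mono_norm[OF p one, of "\<lambda>z. f 0" "cmod (f 0)"] by (auto simp: N_def)
    have nf: "\<N> p f \<ge> 0" using f fock_norm_nonneg by auto
    have d: "(\<lambda>z. f z - f 0) \<in> \<F> p"
      "\<N> p (\<lambda>z. f z - f 0) \<le> C1 * (\<N> p f + \<N> p (\<lambda>z. f 0))"
      using C1(2)[OF f c0(1)] by auto
    have "\<N> p (\<lambda>z. f 0) \<le> C2 * \<N> p f * N"
      using c0(2) mult_right_mono[OF C2(2)[OF f] N] by linarith
    then have "C1 * (\<N> p f + \<N> p (\<lambda>z. f 0)) \<le> C1 * (1 + C2 * N) * \<N> p f"
      using C1(1) by (simp add: algebra_simps)
    with d(2) have d2: "\<N> p (\<lambda>z. f z - f 0) \<le> C1 * (1 + C2 * N) * \<N> p f" by linarith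
    have "(\<lambda>z. c * (f z - f 0)) holomorphic_on UNIV"
      using fock_space_holomorphic[OF f] by (intro holomorphic_intros)
    then have "(\<lambda>z. c * (f z - f 0)) \<in> \<F> p \<and>
      \<N> p (\<lambda>z. c * (f z - f 0)) \<le> cmod c * \<N> p (\<lambda>z. f z - f 0)"
      using fock_space_mono_norm[OF p d(1), of "\<lambda>z. c * (f z - f 0)" "cmod c"] by (auto simp: norm_mult)
    moreover have "cmod c * \<N> p (\<lambda>z. f z - f 0) \<le> (cmod c * (C1 * (1 + C2 * N))) * \<N> p f"
      using mult_left_mono[OF d2, of "cmod c"] by (simp add: mult.assoc)
    ultimately show ?thesis
      unfolding integral_op_const[OF fock_space_holomorphic[OF f]] by linarith
  qed
  then show ?thesis unfolding bounded_operator_def by blast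
qed

lemma bounded_operator_zero:
  assumes "\<And>f. f \<in> \<F> p \<Longrightarrow> T f = (\<lambda>z. 0)"
  shows "bounded_operator \<psi> p q T"
  unfolding bounded_operator_def using assms by (auto intro!: exI[of _ 0])

section \<open>Compactness and accumulation points\<close>

lemma closedin_fock_zero:
  assumes p: "0 < p"
  shows "closedin (fock_topology \<psi> p) {\<lambda>z. 0}"
  unfolding closedin_def topspace_fock_topology openin_fock_topology fock_open_def
proof (intro conjI ballI)
  fix f assume f: "f \<in> \<F> p - {\<lambda>z. 0}"
  then have "\<N> p f > 0"
    using fock_norm_eq_0_imp[OF p, of f] fock_norm_nonneg[of f p] by fastforce
  moreover have "\<N> p (\<lambda>z. 0 - f z) = \<N> p f"
    by (rule fock_norm_cong_norm) simp
  ultimately show "\<exists>e>0. \<forall>h\<in>\<F> p. \<N> p (\<lambda>z. h z - f z) < e \<longrightarrow> h \<in> \<F> p - {\<lambda>z. 0}"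
    by (intro exI[of _ "\<N> p f"]) auto
qed auto

text \<open>Compactness concerns the closure of the image; as the zero function alone forms a closed
  set, that closure cannot leave it and is finite.\<close>

lemma compact_operator_zero:
  assumes q: "0 < q" and "\<And>f. f \<in> \<F> p \<Longrightarrow> T f = (\<lambda>z. 0)"
  shows "compact_operator \<psi> p q T"
  unfolding compact_operator_def
proof (intro conjI allI impI)
  show "T ` \<F> p \<subseteq> \<F> q" using assms by auto
  fix B assume B: "B \<subseteq> \<F> p \<and> (\<exists>M. \<forall>f\<in>B. \<N> p f \<le> M)"
  then have "T ` B \<subseteq> {\<lambda>z. 0}" using assms by auto
  then have sub: "fock_topology \<psi> q closure_of (T ` B) \<subseteq> {\<lambda>z. 0}"
    by (rule closure_of_minimal[OF _ closedin_fock_zero[OF q]])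
  then have "finite (fock_topology \<psi> q closure_of (T ` B))" by (rule finite_subset) simp
  then show "compactin (fock_topology \<psi> q) (fock_topology \<psi> q closure_of (T ` B))"
    by (intro finite_imp_compactin closure_of_subset_topspace)
qed

text \<open>
  If no point of the space were an accumulation point of the sequence, its tails would be closed sets
  with empty intersection.
\<close>

lemma compact_operator_accumulation:
  assumes T: "compact_operator \<psi> p q T" and q: "0 < q"
    and f: "\<And>m::nat. f m \<in> \<F> p" and fM: "\<And>m. \<N> p (f m) \<le> M"
  obtains h where "h \<in> \<F> q"
    "\<forall>e>0. \<forall>N. \<exists>m\<ge>N. \<N> q (\<lambda>z. T (f m) z - h z) < e"
proof (rule ccontr)
  assume neg: "\<not> thesis"
  note accumulation = that
  have far: "\<exists>e>0. \<exists>N. \<forall>m\<ge>N. e \<le> \<N> q (\<lambda>z. T (f m) z - h z)"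
    if "h \<in> \<F> q" for h
  proof (rule ccontr)
    assume "\<not> ?thesis"
    then have "\<forall>e>0. \<forall>N. \<exists>m\<ge>N. \<N> q (\<lambda>z. T (f m) z - h z) < e"
      by (meson not_le)
    then show False using neg accumulation that by blast
  qed
  have Tf: "T (f m) \<in> \<F> q" for m
    using T f unfolding compact_operator_def by blast
  define D where "D N = {T (f m) | m. m \<ge> N}" for N :: nat
  have D_open: "openin (fock_topology \<psi> q) (\<F> q - D N)" for N
    unfolding openin_fock_topology fock_open_def
  proof (intro conjI ballI)
    fix h assume h: "h \<in> \<F> q - D N"
    then obtain e N' where e: "e > 0" "\<And>m. m \<ge> N' \<Longrightarrow> e \<le> \<N> q (\<lambda>z. T (f m) z - h z)"
      using far[of h] by blast
    \<comment> \<open>Only finitely many terms of the tail precede \<open>N'\<close>; each differs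
      from \<open>h\<close> and so has a positive distance of its own. Indices below
      \<open>N\<close> do not index the tail, and 1 is a placeholder for them.\<close>
    define \<delta> where "\<delta> m = (if m < N then 1 else \<N> q (\<lambda>z. T (f m) z - h z))" for m
    have \<delta>: "\<delta> m > 0" for m
    proof (cases "m < N")
      case False
      have d: "(\<lambda>z. T (f m) z - h z) \<in> \<F> q" using fock_space_diff[OF q Tf] h by simp
      have "T (f m) \<in> D N" using False by (auto simp: D_def)
      then have "T (f m) \<noteq> h" using h by auto
      then have "(\<lambda>z. T (f m) z - h z) \<noteq> (\<lambda>z. 0)" by (metis eq_iff_diff_eq_0 ext)
      then have "\<N> q (\<lambda>z. T (f m) z - h z) \<noteq> 0" using fock_norm_eq_0_imp[OF q d] by blast
      then show ?thesis using fock_norm_nonneg[OF d] False by (simp add: \<delta>_def)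
    qed (simp add: \<delta>_def)
    define e' where "e' = Min (insert e (\<delta> ` {..<N'}))"
    have e'_pos: "e' > 0" using e \<delta> by (simp add: e'_def)
    have e'_le: "e' \<le> \<N> q (\<lambda>z. T (f m) z - h z)" if "m \<ge> N" for m
    proof (cases "m < N'")
      case True
      then have "e' \<le> \<delta> m" by (auto simp: e'_def intro!: Min_le)
      then show ?thesis using that by (simp add: \<delta>_def)
    next
      case False
      have "e' \<le> e" by (auto simp: e'_def)
      then show ?thesis using e(2)[of m] False by simp
    qed
    show "\<exists>e>0. \<forall>k\<in>\<F> q. \<N> q (\<lambda>z. k z - h z) < e \<longrightarrow> k \<in> \<F> q - D N"
    proof (intro exI[of _ e'] conjI ballI impI DiffI e'_pos)
      fix k assume lt: "\<N> q (\<lambda>z. k z - h z) < e'"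
      show "k \<notin> D N"
      proof
        assume "k \<in> D N"
        then obtain m where "m \<ge> N" "k = T (f m)" by (auto simp: D_def)
        then show False using lt e'_le[of m] by simp
      qed
    qed
  qed (rule Diff_subset)
  define K where "K = fock_topology \<psi> q closure_of (T ` range f)"
  have "range f \<subseteq> \<F> p \<and> (\<exists>M. \<forall>h\<in>range f. \<N> p h \<le> M)"
    using f fM by auto
  then have "compactin (fock_topology \<psi> q) K"
    using T[unfolded compact_operator_def, THEN conjunct2, rule_format, of "range f"]
    unfolding K_def by simp
  moreover have "K \<subseteq> \<Union>(range (\<lambda>N. \<F> q - D N))"
  proof
    fix h assume "h \<in> K"
    then have h: "h \<in> \<F> q"
      unfolding K_def using closure_of_subset_topspace[of "fock_topology \<psi> q"]
      by (auto simp: topspace_fock_topology)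
    then obtain e N where e: "e > 0" "\<And>m. m \<ge> N \<Longrightarrow> e \<le> \<N> q (\<lambda>z. T (f m) z - h z)"
      using far[of h] by blast
    have "h \<notin> D N"
    proof
      assume "h \<in> D N"
      then obtain m where "m \<ge> N" "h = T (f m)" by (auto simp: D_def)
      then show False using e(2)[of m] e(1) by simp
    qed
    then show "h \<in> \<Union>(range (\<lambda>N. \<F> q - D N))" using h by blast
  qed
  ultimately have "\<exists>\<C>. finite \<C> \<and> \<C> \<subseteq> range (\<lambda>N. \<F> q - D N) \<and> K \<subseteq> \<Union>\<C>"
    using D_open by (intro compactinD) auto
  then obtain \<C> where F: "finite \<C>" "\<C> \<subseteq> range (\<lambda>N. \<F> q - D N)" "K \<subseteq> \<Union>\<C>"
    by blast
  then obtain I where I: "finite I" "\<C> = (\<lambda>N. \<F> q - D N) ` I"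
    using finite_subset_image[OF F(1,2)] by auto
  \<comment> \<open>An index beyond all of \<open>I\<close>: its image lies in every tail concerned,
    hence outside every member of the finite cover. The 0 keeps the maximum defined when
    \<open>I\<close> is empty.\<close>
  define m where "m = Max (insert 0 I)"
  have "T (f m) \<in> D N" if "N \<in> I" for N
    using that I(1) by (auto simp: D_def m_def intro!: exI[of _ m])
  then have "T (f m) \<notin> \<Union>\<C>" using I(2) by auto
  moreover have "T ` range f \<subseteq> K"
    unfolding K_def by (rule closure_of_subset) (use Tf in \<open>auto simp: topspace_fock_topology\<close>)
  ultimately show False using F(3) by blast
qed

text \<open>An accumulation point \<open>h\<close> of the images inherits \<open>h 0 = 0\<close> and
  a vanishing derivative, because evaluating a function or its derivative is continuous in the norm;
  so \<open>h\<close> is zero. Derivatives enter because they are what is explicit for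
  \<open>I_g\<close>.\<close>

lemma compact_operator_small_image:
  assumes T: "compact_operator \<psi> p q T" and q: "0 < q"
    and f: "\<And>m::nat. f m \<in> \<F> p" and fM: "\<And>m. \<N> p (f m) \<le> M"
    and lim0: "(\<lambda>m. T (f m) 0) \<longlonglongrightarrow> 0"
    and lim: "\<And>z. (\<lambda>m. deriv (T (f m)) z) \<longlonglongrightarrow> 0"
    and e: "e > 0"
  shows "\<exists>m. \<N> q (T (f m)) < e"
proof -
  obtain h where h: "h \<in> \<F> q"
    and acc: "\<forall>e>0. \<forall>N. \<exists>m\<ge>N. \<N> q (\<lambda>z. T (f m) z - h z) < e"
    using compact_operator_accumulation[where f = f, OF T q f fM] by blast
  have Tf: "T (f m) \<in> \<F> q" for m
    using T f unfolding compact_operator_def by blast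
  have d: "(\<lambda>z. T (f m) z - h z) \<in> \<F> q" for m using fock_space_diff[OF q Tf h] .
  have holh: "h holomorphic_on UNIV" using fock_space_holomorphic[OF h] .
  \<comment> \<open>Images arbitrarily late in the sequence come arbitrarily close to
    \<open>h\<close>, so a quantity controlled by the norm takes at \<open>h\<close> its limit along
    the sequence.\<close>
  have zero: "c = 0" if L: "(\<lambda>m. l m) \<longlonglongrightarrow> 0" and D: "D > 0"
    and b: "\<And>m. cmod (l m - c) \<le> D * \<N> q (\<lambda>z. T (f m) z - h z)" for l and c :: complex and D
  proof (rule ccontr)
    assume c: "c \<noteq> 0"
    then have "eventually (\<lambda>m. cmod (l m) < cmod c / 2) sequentially"
      using tendsto_norm_zero[OF L] by (intro order_tendstoD(2)) auto
    then obtain N where N: "\<And>m. m \<ge> N \<Longrightarrow> cmod (l m) < cmod c / 2"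
      by (auto simp: eventually_sequentially)
    obtain m where m: "m \<ge> N" "\<N> q (\<lambda>z. T (f m) z - h z) < cmod c / (2 * D)"
      using acc[rule_format, of "cmod c / (2 * D)" N] c D by auto
    have "D * \<N> q (\<lambda>z. T (f m) z - h z) < cmod c / 2" using m(2) D by (simp add: field_simps)
    then have "cmod (l m - c) < cmod c / 2" using b[of m] by linarith
    moreover have "cmod c \<le> cmod (l m) + cmod (l m - c)" by (metis norm_minus_commute norm_triangle_sub)
    ultimately show False using N[OF m(1)] by linarith
  qed
  have h0: "h 0 = 0"
  proof -
    obtain D where "D > 0" "\<And>F. F \<in> \<F> q \<Longrightarrow> cmod (F 0) \<le> D * \<N> q F"
      using fock_evaluation_bounded[OF q] by metis
    then show ?thesis using zero[OF lim0, of D "h 0"] d by blast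
  qed
  have h': "deriv h z = 0" for z
  proof -
    obtain D where D: "D > 0" "\<And>F. F \<in> \<F> q \<Longrightarrow> cmod (deriv F z) \<le> D * \<N> q F"
      using fock_evaluation_bounded[OF q] by metis
    have "deriv (\<lambda>z. T (f m) z - h z) z = deriv (T (f m)) z - deriv h z" for m
      using fock_space_holomorphic[OF Tf] holh by (intro deriv_diff) (auto simp: holomorphic_on_def)
    then have "cmod (deriv (T (f m)) z - deriv h z) \<le> D * \<N> q (\<lambda>z. T (f m) z - h z)" for m
      using D(2)[OF d[of m]] by simp
    then show ?thesis using zero[OF lim D(1)] by blast
  qed
  have "(h has_field_derivative 0) (at z)" for z
    using holomorphic_derivI[OF holh open_UNIV, of z] h'[of z] by simp
  then obtain c where "\<And>z. h z = c" using has_field_derivative_zero_constant[of UNIV h] by auto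
  then have "h = (\<lambda>z. 0)" using h0 by auto
  then show ?thesis using acc[rule_format, OF e, of 0] by auto
qed

end

section \<open>Radial growth of the weight\<close>

lemma ln_norm_ge:
  assumes "exp X \<le> cmod a"
  shows "a \<noteq> 0" "X \<le> ln (cmod a)"
proof -
  have "cmod a > 0" using assms exp_gt_zero[of X] by linarith
  then show "a \<noteq> 0" "X \<le> ln (cmod a)" using assms by (auto simp: ln_ge_iff)
qed

text \<open>All is expressed in x = ln r, with r > 0. Since the second derivative in x of a radial
  function is r^2 times its Laplacian, the hypothesis on \<open>\<tau>\<close> says that
  \<open>v\<close> is comparable to \<open>1 / (\<omega> x)\<^sup>2\<close> for r \<ge> 1;
  \<open>\<omega>\<close> is the length \<open>\<tau>\<close> seen in the variable x.\<close>

locale fock_weight = continuous_weight \<psi> for \<psi> :: "real \<Rightarrow> real" +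
  fixes \<tau> \<omega> \<omega>' s v :: "real \<Rightarrow> real" and \<kappa> :: real
  assumes deriv_weight: "((\<lambda>x. \<psi> (exp x)) has_real_derivative s x) (at x)"
    and deriv_slope: "(s has_real_derivative v x) (at x)"
    and v_pos: "0 < v x"
    and slope_nonneg: "0 \<le> s x"
    and \<kappa>: "1 \<le> \<kappa>"
    and v_bounds: "0 \<le> x \<Longrightarrow> 1 / (\<kappa> * (\<omega> x)\<^sup>2) \<le> v x \<and> v x \<le> \<kappa> / (\<omega> x)\<^sup>2"
    and \<tau>_pos: "0 \<le> r \<Longrightarrow> 0 < \<tau> r"
    and continuous_\<tau>: "continuous_on UNIV (\<lambda>z::complex. \<tau> (cmod z))"
    and \<tau>_lim: "(\<tau> \<longlongrightarrow> 0) at_top"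
    and \<omega>_def: "\<omega> x = \<tau> (exp x) / exp x"
    and deriv_\<omega>: "(\<omega> has_real_derivative \<omega>' x) (at x)"
    and \<omega>'_lim: "(\<omega>' \<longlongrightarrow> 0) at_top"
begin

lemma \<omega>_pos [simp]: "0 < \<omega> x"
  by (simp add: \<omega>_def \<tau>_pos)

lemma \<omega>_nonneg [simp]: "0 \<le> \<omega> x"
  using \<omega>_pos[of x] by linarith

lemma \<omega>_nonzero [simp]: "\<omega> x \<noteq> 0"
  using \<omega>_pos[of x] by linarith

lemma \<tau>_eq: "\<tau> (exp x) = exp x * \<omega> x"
  by (simp add: \<omega>_def)

lemma eventually_\<omega>_le:
  assumes "e > 0"
  shows "eventually (\<lambda>x. \<omega> x \<le> e) at_top"
proof -
  have "(\<omega> \<longlongrightarrow> 0) at_top"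
    unfolding \<omega>_def [abs_def]
    by (intro real_tendsto_divide_at_top[OF filterlim_compose[OF \<tau>_lim exp_at_top]] exp_at_top)
  then have "eventually (\<lambda>x. \<omega> x < e) at_top" using assms by (rule order_tendstoD(2))
  then show ?thesis by (rule eventually_mono) simp
qed

text \<open>Over a distance at most \<open>k * \<omega> x0\<close>, a derivative below
  \<open>1 / (2 * k)\<close> changes \<open>\<omega>\<close> by at most
  \<open>\<omega> x0 / 2\<close>.\<close>

lemma slowly_varying:
  obtains X where "X \<ge> 0" "\<And>x. x \<ge> X \<Longrightarrow> \<omega> x \<le> 1"
    "\<And>x0 x. x0 \<ge> X \<Longrightarrow> \<bar>x - x0\<bar> \<le> K * \<omega> x0 \<Longrightarrow> 0 \<le> x \<and> \<omega> x0 / 2 \<le> \<omega> x \<and> \<omega> x \<le> 2 * \<omega> x0"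
proof -
  define k where "k = max K 1"
  have k: "k \<ge> 1" "K \<le> k" by (auto simp: k_def)
  have "eventually (\<lambda>x. \<bar>\<omega>' x\<bar> < 1 / (2 * k)) at_top"
    using tendsto_rabs_zero[OF \<omega>'_lim] k by (intro order_tendstoD(2)) auto
  moreover have "eventually (\<lambda>x. \<omega> x \<le> 1 / k) at_top" using k by (intro eventually_\<omega>_le) auto
  ultimately have "eventually (\<lambda>x. \<bar>\<omega>' x\<bar> < 1 / (2 * k) \<and> \<omega> x \<le> 1 / k) at_top" by eventually_elim simp
  then obtain Y where Y: "\<And>x. x \<ge> Y \<Longrightarrow> \<bar>\<omega>' x\<bar> < 1 / (2 * k)" "\<And>x. x \<ge> Y \<Longrightarrow> \<omega> x \<le> 1 / k"
    by (auto simp: eventually_at_top_linorder)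
  show ?thesis
  \<comment> \<open>Since \<open>k * \<omega> x0 \<le> 1\<close>, the additional 1 keeps the whole
    interval about \<open>x0\<close> where the bounds on \<open>\<omega>'\<close> hold.\<close>
  proof (rule that[of "max Y 0 + 1"])
    show "\<omega> x \<le> 1" if "x \<ge> max Y 0 + 1" for x
    proof -
      have "\<omega> x \<le> 1 / k" using that by (intro Y) auto
      also have "\<dots> \<le> 1" using k by simp
      finally show ?thesis .
    qed
    fix x0 x assume x0: "x0 \<ge> max Y 0 + 1" and x: "\<bar>x - x0\<bar> \<le> K * \<omega> x0"
    have x': "\<bar>x - x0\<bar> \<le> k * \<omega> x0"
      using x mult_right_mono[OF k(2) \<omega>_nonneg[of x0]] by linarith
    have "k * \<omega> x0 \<le> 1" using Y(2)[of x0] x0 k by (simp add: field_simps)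
    then have x1: "x \<ge> max Y 0" using x' x0 by linarith
    have "norm (\<omega> x - \<omega> x0) \<le> 1 / (2 * k) * norm (x - x0)"
    proof (rule field_differentiable_bound[of "{max Y 0..}"])
      fix y :: real assume "y \<in> {max Y 0..}"
      then show "(\<omega> has_field_derivative \<omega>' y) (at y within {max Y 0..})" "norm (\<omega>' y) \<le> 1 / (2 * k)"
        using deriv_\<omega>[of y] Y(1)[of y] by (auto intro: has_field_derivative_at_within)
    qed (use x0 x1 in auto)
    also have "\<dots> \<le> 1 / (2 * k) * (k * \<omega> x0)" using x' k by (intro mult_left_mono) auto
    also have "\<dots> = \<omega> x0 / 2" using k by simp
    finally have "\<bar>\<omega> x - \<omega> x0\<bar> \<le> \<omega> x0 / 2" by simp
    then show "0 \<le> x \<and> \<omega> x0 / 2 \<le> \<omega> x \<and> \<omega> x \<le> 2 * \<omega> x0"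
      using x1 \<omega>_pos[of x0] unfolding abs_le_iff by auto
  qed simp
qed

section \<open>Slope and convexity in the logarithmic variable\<close>

lemma slope_mono: "x \<le> y \<Longrightarrow> s x \<le> s y"
  using DERIV_nonneg_imp_nondecreasing[of x y s] deriv_slope v_pos less_imp_le by blast

text \<open>The mean value theorem for \<open>s\<close>: its derivative is
  \<open>1 / \<omega>\<^sup>2\<close> up to \<open>\<kappa>\<close>, and on the interval considered
  \<open>\<omega>\<^sup>2\<close> varies at most by a factor 4 from its value at
  \<open>x0\<close>.\<close>

lemma slope_increment:
  obtains X where "X \<ge> 0"
    "\<And>x0 x y. x0 \<ge> X \<Longrightarrow> \<bar>x - x0\<bar> \<le> K * \<omega> x0 \<Longrightarrow> \<bar>y - x0\<bar> \<le> K * \<omega> x0 \<Longrightarrow> x \<le> y \<Longrightarrow>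
       (y - x) / (4 * \<kappa> * (\<omega> x0)\<^sup>2) \<le> s y - s x \<and> s y - s x \<le> 4 * \<kappa> * (y - x) / (\<omega> x0)\<^sup>2"
proof -
  obtain X where X: "X \<ge> 0" "\<And>x. x \<ge> X \<Longrightarrow> \<omega> x \<le> 1"
    "\<And>x0 x. x0 \<ge> X \<Longrightarrow> \<bar>x - x0\<bar> \<le> K * \<omega> x0 \<Longrightarrow> 0 \<le> x \<and> \<omega> x0 / 2 \<le> \<omega> x \<and> \<omega> x \<le> 2 * \<omega> x0"
    using slowly_varying[of K] by blast
  show ?thesis
  proof (rule that[OF X(1)])
    fix x0 x y assume x0: "x0 \<ge> X" and x: "\<bar>x - x0\<bar> \<le> K * \<omega> x0" and y: "\<bar>y - x0\<bar> \<le> K * \<omega> x0" and "x \<le> y"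
    show "(y - x) / (4 * \<kappa> * (\<omega> x0)\<^sup>2) \<le> s y - s x \<and> s y - s x \<le> 4 * \<kappa> * (y - x) / (\<omega> x0)\<^sup>2"
    proof (cases "x = y")
      case False
      then have "x < y" using \<open>x \<le> y\<close> by simp
      then obtain \<xi> where \<xi>: "x < \<xi>" "\<xi> < y" "s y - s x = (y - x) * v \<xi>"
        using MVT2[of x y s v] deriv_slope by blast
      have "\<bar>\<xi> - x0\<bar> \<le> K * \<omega> x0" using \<xi> x y by linarith
      from X(3)[OF x0 this] have w: "0 \<le> \<xi>" "\<omega> x0 / 2 \<le> \<omega> \<xi>" "\<omega> \<xi> \<le> 2 * \<omega> x0" by auto
      have "1 / (4 * \<kappa> * (\<omega> x0)\<^sup>2) \<le> 1 / (\<kappa> * (\<omega> \<xi>)\<^sup>2)"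
        using power_mono[OF w(3), of 2] \<kappa> by (intro divide_left_mono) (auto simp: power_mult_distrib)
      then have lo: "1 / (4 * \<kappa> * (\<omega> x0)\<^sup>2) \<le> v \<xi>" using v_bounds[OF w(1)] by linarith
      have "\<kappa> / (\<omega> \<xi>)\<^sup>2 \<le> \<kappa> / (\<omega> x0 / 2)\<^sup>2"
        using power_mono[OF w(2), of 2] \<kappa> by (intro divide_left_mono) auto
      then have hi: "v \<xi> \<le> 4 * \<kappa> / (\<omega> x0)\<^sup>2"
        using v_bounds[OF w(1)] by (simp add: power_divide mult.commute)
      show ?thesis
        using mult_left_mono[OF lo, of "y - x"] mult_left_mono[OF hi, of "y - x"] \<open>x < y\<close>
        by (simp add: \<xi>(3) mult.commute)
    qed simp
  qed
qed

text \<open>The height of the convex function \<open>\<psi> (exp x)\<close> above its tangent at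
  \<open>x0\<close>, a Bregman divergence. \<open>exp (- G x0 x)\<close> is the weighted modulus of
  an ideal monomial of real degree \<open>s x0\<close>, normalised at \<open>x0\<close>.\<close>

definition convex_remainder :: "real \<Rightarrow> real \<Rightarrow> real" where
  "convex_remainder x0 x = \<psi> (exp x) - \<psi> (exp x0) - s x0 * (x - x0)"

abbreviation "G \<equiv> convex_remainder"

text \<open>The product condition places \<open>\<xi>\<close> between \<open>x0\<close> and
  \<open>x\<close> without fixing their order.\<close>

lemma remainder_eq: "\<exists>\<xi>. (\<xi> - x0) * (x - \<xi>) \<ge> 0 \<and> G x0 x = (s \<xi> - s x0) * (x - x0)"
proof (cases x x0 rule: linorder_cases)
  case less
  then obtain \<xi> where "x < \<xi>" "\<xi> < x0" "\<psi> (exp x0) - \<psi> (exp x) = (x0 - x) * s \<xi>"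
    using MVT2[of x x0 "\<lambda>x. \<psi> (exp x)" s] deriv_weight by blast
  then show ?thesis
    using mult_nonpos_nonpos[of "\<xi> - x0" "x - \<xi>"]
    by (intro exI[of _ \<xi>]) (simp add: convex_remainder_def algebra_simps)
next
  case equal then show ?thesis by (intro exI[of _ x0]) (simp add: convex_remainder_def)
next
  case greater
  then obtain \<xi> where "x0 < \<xi>" "\<xi> < x" "\<psi> (exp x) - \<psi> (exp x0) = (x - x0) * s \<xi>"
    using MVT2[of x0 x "\<lambda>x. \<psi> (exp x)" s] deriv_weight by blast
  then show ?thesis
    using mult_nonneg_nonneg[of "\<xi> - x0" "x - \<xi>"]
    by (intro exI[of _ \<xi>]) (simp add: convex_remainder_def algebra_simps)
qed

lemma remainder_nonneg: "0 \<le> G x0 x"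
proof -
  obtain \<xi> where \<xi>: "(\<xi> - x0) * (x - \<xi>) \<ge> 0" "G x0 x = (s \<xi> - s x0) * (x - x0)" using remainder_eq by blast
  show ?thesis
  proof (cases "x \<le> x0")
    case True
    then have "\<xi> \<le> x0" using \<xi>(1) by (smt (verit, best) mult_pos_neg zero_le_mult_iff)
    then show ?thesis using True slope_mono[of \<xi> x0] \<xi>(2) by (simp add: mult_nonpos_nonpos)
  next
    case False
    then have "x0 \<le> \<xi>" using \<xi>(1) by (smt (verit, best) mult_neg_pos zero_le_mult_iff)
    then show ?thesis using False slope_mono[of x0 \<xi>] \<xi>(2) by simp
  qed
qed

text \<open>The right-hand side is the sum of \<open>G x0 x\<close> and \<open>G x x0\<close>, and
  both are nonnegative.\<close>

lemma remainder_le: "G x0 x \<le> (s x - s x0) * (x - x0)"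
  using remainder_nonneg[of x x0] by (simp add: convex_remainder_def algebra_simps)

text \<open>The three-point identity of Bregman divergences. Splitting at \<open>y\<close> isolates
  a term linear in \<open>x\<close> whose rate is the slope excess already reached at
  \<open>y\<close>.\<close>

lemma remainder_shift: "G x0 x = G x0 y + G y x + (s y - s x0) * (x - y)"
  by (simp add: convex_remainder_def algebra_simps)

lemma remainder_shift_ge: "G x0 x \<ge> G x0 y + (s y - s x0) * (x - y)"
  using remainder_shift[of x0 x y] remainder_nonneg[of y x] by simp

text \<open>Over the distance \<open>K * \<omega> x0\<close> the slope moves by at most
  \<open>4 * \<kappa> * K / \<omega> x0\<close>; in the product the scale cancels.\<close>

lemma remainder_upper:
  obtains X where "X \<ge> 0"
    "\<And>x0 x. x0 \<ge> X \<Longrightarrow> \<bar>x - x0\<bar> \<le> K * \<omega> x0 \<Longrightarrow> G x0 x \<le> 4 * \<kappa> * K\<^sup>2"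
proof -
  obtain X where X: "X \<ge> 0"
    "\<And>x0 x y. x0 \<ge> X \<Longrightarrow> \<bar>x - x0\<bar> \<le> K * \<omega> x0 \<Longrightarrow> \<bar>y - x0\<bar> \<le> K * \<omega> x0 \<Longrightarrow> x \<le> y \<Longrightarrow>
       (y - x) / (4 * \<kappa> * (\<omega> x0)\<^sup>2) \<le> s y - s x \<and> s y - s x \<le> 4 * \<kappa> * (y - x) / (\<omega> x0)\<^sup>2"
    using slope_increment[of K] by blast
  show ?thesis
  proof (rule that[OF X(1)])
    fix x0 x assume x0: "x0 \<ge> X" and x: "\<bar>x - x0\<bar> \<le> K * \<omega> x0"
    then have K0: "\<bar>x0 - x0\<bar> \<le> K * \<omega> x0" by linarith
    have "(s x - s x0) * (x - x0) = \<bar>s x - s x0\<bar> * \<bar>x - x0\<bar>"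
    proof (cases "x \<le> x0")
      case True then show ?thesis using slope_mono[OF True] by (simp add: abs_if algebra_simps)
    next
      case False then show ?thesis using slope_mono[of x0 x] by simp
    qed
    also have "\<dots> \<le> 4 * \<kappa> * \<bar>x - x0\<bar> / (\<omega> x0)\<^sup>2 * \<bar>x - x0\<bar>"
    proof (rule mult_right_mono)
      show "\<bar>s x - s x0\<bar> \<le> 4 * \<kappa> * \<bar>x - x0\<bar> / (\<omega> x0)\<^sup>2"
      proof (cases "x \<le> x0")
        case True
        then show ?thesis using X(2)[OF x0 x K0 True] slope_mono[OF True] by (simp add: abs_if)
      next
        case False
        then show ?thesis using X(2)[OF x0 K0 x] slope_mono[of x0 x] by (simp add: abs_if)
      qed
    qed simp
    also have "\<dots> = 4 * \<kappa> * (\<bar>x - x0\<bar> / \<omega> x0)\<^sup>2" by (simp add: power_divide power2_eq_square)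
    also have "\<dots> \<le> 4 * \<kappa> * K\<^sup>2"
      using x \<kappa> by (intro mult_left_mono power_mono) (auto simp: field_simps)
    finally show "G x0 x \<le> 4 * \<kappa> * K\<^sup>2" using remainder_le[of x0 x] by linarith
  qed
qed

text \<open>Any linear rate \<open>A\<close> per unit of \<open>\<omega>\<close> can be had at the
  price of a constant: after \<open>K\<close> units the slope has moved by
  \<open>A / \<omega> x0\<close>, and convexity keeps it at least that far off from there
  on.\<close>

lemma remainder_lower:
  assumes A: "A \<ge> 0"
  obtains B X where "B \<ge> 0" "X \<ge> 0" "\<And>x0 x. x0 \<ge> X \<Longrightarrow> G x0 x \<ge> A * (\<bar>x - x0\<bar> / \<omega> x0) - B"
proof -
  \<comment> \<open>Chosen so that the lower bound for the slope increment over
    \<open>K * \<omega> x0\<close> is exactly \<open>A / \<omega> x0\<close>.\<close>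
  define K where "K = 4 * \<kappa> * A"
  have K: "K \<ge> 0" using A \<kappa> by (simp add: K_def)
  obtain X where X: "X \<ge> 0"
    "\<And>x0 x y. x0 \<ge> X \<Longrightarrow> \<bar>x - x0\<bar> \<le> K * \<omega> x0 \<Longrightarrow> \<bar>y - x0\<bar> \<le> K * \<omega> x0 \<Longrightarrow> x \<le> y \<Longrightarrow>
       (y - x) / (4 * \<kappa> * (\<omega> x0)\<^sup>2) \<le> s y - s x \<and> s y - s x \<le> 4 * \<kappa> * (y - x) / (\<omega> x0)\<^sup>2"
    using slope_increment[of K] by blast
  show ?thesis
  proof (rule that[of "A * K" X])
    fix x0 x assume x0: "x0 \<ge> X"
    have Kw: "K * \<omega> x0 \<ge> 0" using K by simp
    have eq: "K * \<omega> x0 / (4 * \<kappa> * (\<omega> x0)\<^sup>2) = A / \<omega> x0"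
      using \<kappa> by (simp add: K_def power2_eq_square field_simps)
    consider "\<bar>x - x0\<bar> < K * \<omega> x0" | "x \<ge> x0 + K * \<omega> x0" | "x \<le> x0 - K * \<omega> x0" by linarith
    then show "G x0 x \<ge> A * (\<bar>x - x0\<bar> / \<omega> x0) - A * K"
    proof cases
      case 1
      then have "\<bar>x - x0\<bar> / \<omega> x0 \<le> K" by (simp add: field_simps)
      from mult_left_mono[OF this A] show ?thesis using remainder_nonneg[of x0 x] by linarith
    next
      case 2
      let ?y = "x0 + K * \<omega> x0"
      have "A / \<omega> x0 \<le> s ?y - s x0" using X(2)[OF x0, of x0 ?y] Kw eq by simp
      then have "A / \<omega> x0 * (x - ?y) \<le> (s ?y - s x0) * (x - ?y)" using 2 by (intro mult_right_mono) auto
      moreover have "A / \<omega> x0 * (x - ?y) = A * (\<bar>x - x0\<bar> / \<omega> x0) - A * K"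
        using 2 Kw by (simp add: abs_if field_simps)
      ultimately show ?thesis
        using remainder_shift_ge[of x0 ?y x] remainder_nonneg[of x0 ?y] by linarith
    next
      case 3
      let ?y = "x0 - K * \<omega> x0"
      have "A / \<omega> x0 \<le> s x0 - s ?y" using X(2)[OF x0, of ?y x0] Kw eq by simp
      then have "A / \<omega> x0 * (?y - x) \<le> (s x0 - s ?y) * (?y - x)" using 3 by (intro mult_right_mono) auto
      moreover have "A / \<omega> x0 * (?y - x) = A * (\<bar>x - x0\<bar> / \<omega> x0) - A * K"
        using 3 Kw by (simp add: abs_if field_simps)
      moreover have "(s x0 - s ?y) * (?y - x) = (s ?y - s x0) * (x - ?y)" by (simp add: algebra_simps)
      ultimately show ?thesis
        using remainder_shift_ge[of x0 ?y x] remainder_nonneg[of x0 ?y] by linarith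
    qed
  qed (use A K X in auto)
qed

text \<open>On the interval of length \<open>K * \<omega> x\<close> to the left of \<open>x\<close>
  the slope rises by at least \<open>max A 0 / \<omega> x\<close>, starting from a nonnegative
  value.\<close>

lemma slope_large:
  obtains X where "X \<ge> 0" "\<And>x. x \<ge> X \<Longrightarrow> A / \<omega> x \<le> s x"
proof -
  define K where "K = 4 * \<kappa> * max A 0"
  have K: "K \<ge> 0" using \<kappa> by (simp add: K_def)
  obtain X where X: "X \<ge> 0"
    "\<And>x0 x y. x0 \<ge> X \<Longrightarrow> \<bar>x - x0\<bar> \<le> K * \<omega> x0 \<Longrightarrow> \<bar>y - x0\<bar> \<le> K * \<omega> x0 \<Longrightarrow> x \<le> y \<Longrightarrow>
       (y - x) / (4 * \<kappa> * (\<omega> x0)\<^sup>2) \<le> s y - s x \<and> s y - s x \<le> 4 * \<kappa> * (y - x) / (\<omega> x0)\<^sup>2"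
    using slope_increment[of K] by blast
  show ?thesis
  proof (rule that[OF X(1)])
    fix x assume x: "x \<ge> X"
    have Kw: "K * \<omega> x \<ge> 0" using K by simp
    have eq: "K * \<omega> x / (4 * \<kappa> * (\<omega> x)\<^sup>2) = max A 0 / \<omega> x"
      using \<kappa> by (simp add: K_def power2_eq_square field_simps)
    have "max A 0 / \<omega> x \<le> s x - s (x - K * \<omega> x)"
      using X(2)[OF x, of "x - K * \<omega> x" x] Kw eq by simp
    then have "max A 0 / \<omega> x \<le> s x" using slope_nonneg[of "x - K * \<omega> x"] by linarith
    moreover have "A / \<omega> x \<le> max A 0 / \<omega> x" by (intro divide_right_mono) auto
    ultimately show "A / \<omega> x \<le> s x" by linarith
  qed
qed

section \<open>Monomials adapted to the weight\<close>

definition peak_degree :: "real \<Rightarrow> nat" where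
  "peak_degree x = nat \<lfloor>s x\<rfloor>"

lemma peak_degree: "real (peak_degree x) \<le> s x" "s x < real (peak_degree x) + 1"
  using slope_nonneg[of x] unfolding peak_degree_def by linarith+

text \<open>The price of an integer degree in the exponent; it is at most
  \<open>\<bar>x - x0\<bar> / \<omega> x0\<close> as soon as
  \<open>\<omega> x0 \<le> 1\<close>.\<close>

lemma peak_degree_error: "\<bar>(s x0 - peak_degree x0) * (x - x0)\<bar> \<le> \<bar>x - x0\<bar>"
  unfolding abs_mult using peak_degree[of x0] by (intro mult_left_le_one_le) auto

definition peak_monomial :: "complex \<Rightarrow> complex \<Rightarrow> complex" where
  "peak_monomial a z = of_real (exp (\<psi> (cmod a))) * (z / a) ^ peak_degree (ln (cmod a))"

lemma peak_monomial_holomorphic [holomorphic_intros]: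
  "peak_monomial a holomorphic_on A"
  unfolding peak_monomial_def [abs_def] by (cases "a = 0") (auto intro!: holomorphic_intros)

lemma norm_peak_monomial:
  assumes a: "a \<noteq> 0" and z: "z \<noteq> 0"
  shows "cmod (peak_monomial a z) =
    exp (\<psi> (cmod a) + real (peak_degree (ln (cmod a))) * (ln (cmod z) - ln (cmod a)))"
proof -
  have "cmod (z / a) = exp (ln (cmod z) - ln (cmod a))"
    using a z by (simp add: exp_diff norm_divide)
  then show ?thesis
    by (simp add: peak_monomial_def norm_mult norm_power exp_add flip: exp_of_nat_mult)
qed

lemma weighted_peak_monomial:
  assumes a: "a \<noteq> 0" and z: "z \<noteq> 0" and x0: "x0 = ln (cmod a)" and x: "x = ln (cmod z)"
  shows "W (peak_monomial a) z = exp (- G x0 x - (s x0 - peak_degree x0) * (x - x0))"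
proof -
  have e: "exp x0 = cmod a" "exp x = cmod z" using a z x0 x by auto
  show ?thesis
    unfolding weighted_abs_def norm_peak_monomial[OF a z] convex_remainder_def e
      exp_add[symmetric] x0[symmetric] x[symmetric]
    by (simp add: algebra_simps)
qed

text \<open>The remainder is spent in two halves. One stays as \<open>G / 2\<close>, to be counted
  later in grid steps; the other gives linear decay at the rate \<open>A + 1\<close>, of which one
  unit absorbs the rounding of the degree.\<close>

lemma weighted_peak_monomial_upper:
  assumes A: "A \<ge> 0"
  obtains B X where "X \<ge> 0"
    "\<And>a z. cmod a \<ge> exp X \<Longrightarrow> z \<noteq> 0 \<Longrightarrow> W (peak_monomial a) z \<le>
       exp (B - G (ln (cmod a)) (ln (cmod z)) / 2 - A * (\<bar>ln (cmod z) - ln (cmod a)\<bar> / \<omega> (ln (cmod a))))"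
proof -
  obtain B X1 where B: "B \<ge> 0" "X1 \<ge> 0"
     "\<And>x0 x. x0 \<ge> X1 \<Longrightarrow> G x0 x \<ge> (2 * (A + 1)) * (\<bar>x - x0\<bar> / \<omega> x0) - B"
    using remainder_lower[of "2 * (A + 1)"] A by auto
  obtain X2 where X2: "X2 \<ge> 0" "\<And>x. x \<ge> X2 \<Longrightarrow> \<omega> x \<le> 1"
    using slowly_varying by metis
  show ?thesis
  proof (rule that[of "max X1 X2" "B / 2"])
    fix a z :: complex assume a: "cmod a \<ge> exp (max X1 X2)" and z: "z \<noteq> 0"
    define x0 where "x0 = ln (cmod a)"
    define x where "x = ln (cmod z)"
    have a0: "cmod a > 0" and x0: "x0 \<ge> max X1 X2" using ln_norm_ge[OF a] by (auto simp: x0_def)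
    have "(s x0 - peak_degree x0) * (x - x0) \<ge> - \<bar>x - x0\<bar>"
      using peak_degree_error[of x0 x] by (metis abs_le_iff minus_le_iff)
    moreover have "\<bar>x - x0\<bar> \<le> \<bar>x - x0\<bar> / \<omega> x0"
      using X2(2)[of x0] x0 by (simp add: field_simps mult_left_le_one_le)
    moreover have "G x0 x \<ge> (2 * (A + 1)) * (\<bar>x - x0\<bar> / \<omega> x0) - B" using x0 by (intro B) auto
    ultimately have "- G x0 x - (s x0 - peak_degree x0) * (x - x0) \<le> B / 2 - G x0 x / 2 - A * (\<bar>x - x0\<bar> / \<omega> x0)"
      by (simp add: algebra_simps)
    then show "W (peak_monomial a) z \<le>
       exp (B / 2 - G (ln (cmod a)) (ln (cmod z)) / 2 - A * (\<bar>ln (cmod z) - ln (cmod a)\<bar> / \<omega> (ln (cmod a))))"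
      using weighted_peak_monomial[OF _ z x0_def x_def] a0 by (simp add: x0_def x_def)
  qed (use B X2 in auto)
qed

text \<open>On a ring of boundedly many scales the remainder and the rounding error are both
  bounded, so the monomial cancels the weight up to a constant.\<close>

lemma weighted_peak_monomial_local:
  obtains c X where "c > 0" "c \<le> 1" "X \<ge> 0"
    "\<And>a z. cmod a \<ge> exp X \<Longrightarrow> z \<noteq> 0 \<Longrightarrow> \<bar>ln (cmod z) - ln (cmod a)\<bar> \<le> K * \<omega> (ln (cmod a)) \<Longrightarrow>
       c \<le> W (peak_monomial a) z \<and> W (peak_monomial a) z \<le> 1 / c"
proof -
  obtain X1 where X1: "X1 \<ge> 0"
    "\<And>x0 x. x0 \<ge> X1 \<Longrightarrow> \<bar>x - x0\<bar> \<le> K * \<omega> x0 \<Longrightarrow> G x0 x \<le> 4 * \<kappa> * K\<^sup>2" using remainder_upper[of K] by blast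
  obtain X2 where X2: "X2 \<ge> 0" "\<And>x. x \<ge> X2 \<Longrightarrow> \<omega> x \<le> 1"
    using slowly_varying by metis
  define c where "c = exp (- (4 * \<kappa> * K\<^sup>2 + \<bar>K\<bar>))"
  show ?thesis
  proof (rule that[of c "max X1 X2"])
    have "0 \<le> 4 * \<kappa> * K\<^sup>2" using \<kappa> by simp
    then show "c \<le> 1" unfolding c_def exp_le_one_iff by linarith
    fix a z :: complex
    assume a: "cmod a \<ge> exp (max X1 X2)" and z: "z \<noteq> 0"
      and d: "\<bar>ln (cmod z) - ln (cmod a)\<bar> \<le> K * \<omega> (ln (cmod a))"
    define x0 where "x0 = ln (cmod a)"
    define x where "x = ln (cmod z)"
    have d': "\<bar>x - x0\<bar> \<le> K * \<omega> x0" using d by (simp add: x_def x0_def)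
    have a0: "cmod a > 0" and x0: "x0 \<ge> max X1 X2" using ln_norm_ge[OF a] by (auto simp: x0_def)
    have "K * \<omega> x0 \<le> \<bar>K\<bar>"
      using X2(2)[of x0] x0 mult_mono[of K "\<bar>K\<bar>" "\<omega> x0" 1] by simp
    have "\<bar>(s x0 - peak_degree x0) * (x - x0)\<bar> \<le> \<bar>K\<bar>"
      using peak_degree_error[of x0 x] d' \<open>K * \<omega> x0 \<le> \<bar>K\<bar>\<close> by (blast intro: order_trans)
    moreover have "G x0 x \<le> 4 * \<kappa> * K\<^sup>2" using x0 d' by (intro X1) auto
    moreover have "0 \<le> 4 * \<kappa> * K\<^sup>2" using \<kappa> by simp
    ultimately have "- (4 * \<kappa> * K\<^sup>2 + \<bar>K\<bar>) \<le> - G x0 x - (s x0 - peak_degree x0) * (x - x0)"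
      "- G x0 x - (s x0 - peak_degree x0) * (x - x0) \<le> 4 * \<kappa> * K\<^sup>2 + \<bar>K\<bar>"
      using remainder_nonneg[of x0 x] unfolding abs_le_iff by linarith+
    moreover have "1 / c = exp (4 * \<kappa> * K\<^sup>2 + \<bar>K\<bar>)" by (simp only: c_def exp_minus inverse_eq_divide div_by_1 divide_divide_eq_right mult_1)
    ultimately show "c \<le> W (peak_monomial a) z \<and> W (peak_monomial a) z \<le> 1 / c"
      using weighted_peak_monomial[OF _ z x0_def x_def] a0 by (simp add: c_def)
  qed (use X1 X2 in \<open>auto simp: c_def\<close>)
qed

end

section \<open>Local estimates in the weighted spaces\<close>

text \<open>Puts the disc of radius \<open>\<tau> / 2\<close> into the ring of logarithmic
  half-width \<open>\<omega>\<close>. The factor 1 / 2 keeps the quotient \<open>t\<close> above 1 /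
  2, where \<open>- ln t \<le> (1 - t) / t\<close> loses at most a factor 2.\<close>

lemma abs_ln_norm_diff_le:
  fixes a z :: complex
  assumes a: "a \<noteq> 0" and w: "0 < w" "w \<le> 1" and z: "dist a z < cmod a * w / 2"
  shows "z \<noteq> 0" "\<bar>ln (cmod z) - ln (cmod a)\<bar> \<le> w"
proof -
  define t where "t = cmod z / cmod a"
  have d: "\<bar>cmod z - cmod a\<bar> < cmod a * w / 2"
    using z norm_triangle_ineq3[of z a] by (simp add: dist_norm norm_minus_commute)
  have "t - 1 = (cmod z - cmod a) / cmod a" using a by (simp add: t_def field_simps)
  then have "\<bar>t - 1\<bar> = \<bar>cmod z - cmod a\<bar> / cmod a" by simp
  also have "\<dots> < (cmod a * w / 2) / cmod a" using d a by (intro divide_strict_right_mono) auto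
  finally have t: "\<bar>t - 1\<bar> < w / 2" using a by simp
  then have t0: "t > 1 / 2" using w by linarith
  then show z0: "z \<noteq> 0" by (auto simp: t_def)
  have "ln t \<le> w" using ln_le_minus_one[of t] t t0 w by linarith
  moreover have "- ln t \<le> w"
  proof -
    have "- ln t \<le> 1 / t - 1" using ln_le_minus_one[of "1 / t"] t0 by (simp add: ln_div)
    also have "\<dots> = (1 - t) / t" using t0 by (simp add: field_simps)
    also have "1 - t \<le> w / 2" using t by linarith
    then have "(1 - t) / t \<le> (w / 2) / (1 / 2)" using t0 w by (intro frac_le) auto
    finally show ?thesis by simp
  qed
  moreover have "ln t = ln (cmod z) - ln (cmod a)" using z0 a by (simp add: t_def ln_div)
  ultimately show "\<bar>ln (cmod z) - ln (cmod a)\<bar> \<le> w" by linarith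
qed

lemma powr_le_powrD: "a powr q \<le> b powr q \<Longrightarrow> 0 < q \<Longrightarrow> 0 \<le> b \<Longrightarrow> a \<le> (b::real)"
  by (meson not_le powr_less_mono2)

context fock_weight
begin

text \<open>Applying z d/dz multiplies a monomial by its degree. For the monomial that peaks at
  \<open>a\<close> this quotient is therefore about 1 once the slope is large, on the same footing
  as \<open>W F a\<close>.\<close>

definition weighted_deriv :: "(complex \<Rightarrow> complex) \<Rightarrow> complex \<Rightarrow> real" where
  "weighted_deriv F a = W (\<lambda>z. z * deriv F z) a / s (ln (cmod a))"

definition weighted_jet :: "(complex \<Rightarrow> complex) \<Rightarrow> complex \<Rightarrow> real" where
  "weighted_jet F a = max (W F a) (weighted_deriv F a)"

lemma weighted_jet_nonneg: "0 \<le> weighted_jet F a"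
  by (simp add: weighted_jet_def le_max_iff_disj)

lemma weighted_peak_monomial_center: "a \<noteq> 0 \<Longrightarrow> W (peak_monomial a) a = 1"
  by (simp add: weighted_peak_monomial[OF _ _ refl refl] convex_remainder_def)

lemma peak_monomial_deriv:
  assumes a: "a \<noteq> 0"
  shows "(peak_monomial a has_field_derivative
           of_nat (peak_degree (ln (cmod a))) * peak_monomial a a / a) (at a)"
proof -
  have "((\<lambda>z. z / a) has_field_derivative 1 / a) (at a)"
    by (intro DERIV_cdivide DERIV_ident)
  from DERIV_cmult[OF DERIV_power[OF this, of "peak_degree (ln (cmod a))"], of "of_real (exp (\<psi> (cmod a)))"]
  show ?thesis unfolding peak_monomial_def [abs_def] using a by (simp add: mult.commute)
qed

text \<open>
  Dividing by the monomial that peaks at \<open>a\<close> turns the weight into a bounded factor on a ball of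
  radius comparable to \<open>\<tau>\<close>.
\<close>

lemma local_factorization:
  obtains c X where "c > 0" "X \<ge> 0"
    "\<And>F a. F holomorphic_on UNIV \<Longrightarrow> cmod a \<ge> exp X \<Longrightarrow>
       \<exists>H. H holomorphic_on ball a (\<tau> (cmod a) / 2) \<and>
           (\<forall>z\<in>ball a (\<tau> (cmod a) / 2). c * cmod (H z) \<le> W F z) \<and>
           weighted_jet F a \<le> 2 * (\<tau> (cmod a) / 2 * cmod (deriv H a)) + cmod (H a)"
proof -
  obtain c X1 where c: "c > 0" "X1 \<ge> 0" and
    loc: "\<And>a z. cmod a \<ge> exp X1 \<Longrightarrow> z \<noteq> 0 \<Longrightarrow> \<bar>ln (cmod z) - ln (cmod a)\<bar> \<le> 1 * \<omega> (ln (cmod a)) \<Longrightarrow>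
       c \<le> W (peak_monomial a) z \<and> W (peak_monomial a) z \<le> 1 / c"
    using weighted_peak_monomial_local[of 1] by metis
  obtain X2 where X2: "X2 \<ge> 0" "\<And>x. x \<ge> X2 \<Longrightarrow> \<omega> x \<le> 1" using slowly_varying by metis
  obtain X3 where X3: "X3 \<ge> 0" "\<And>x. x \<ge> X3 \<Longrightarrow> 1 / \<omega> x \<le> s x" using slope_large by metis
  show ?thesis
  proof (rule that[of c "max X1 (max X2 X3)"])
    fix F :: "complex \<Rightarrow> complex" and a
    assume F: "F holomorphic_on UNIV" and a: "cmod a \<ge> exp (max X1 (max X2 X3))"
    define x0 where "x0 = ln (cmod a)"
    define r where "r = \<tau> (cmod a) / 2"
    have a0: "a \<noteq> 0" and x0: "x0 \<ge> X1" "x0 \<ge> X2" "x0 \<ge> X3" using ln_norm_ge[OF a] by (auto simp: x0_def)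
    have a1: "cmod a \<ge> exp X1" using a by (rule order_trans[rotated]) simp
    have \<tau>a: "\<tau> (cmod a) = cmod a * \<omega> x0" using \<tau>_eq[of x0] a0 by (simp add: x0_def)
    have r: "r > 0" using a0 by (simp add: r_def \<tau>a)
    have w1: "\<omega> x0 \<le> 1" using X2 x0 by blast
    define m where "m = peak_monomial a"
    have ball: "z \<noteq> 0 \<and> \<bar>ln (cmod z) - ln (cmod a)\<bar> \<le> 1 * \<omega> x0" if "z \<in> ball a r" for z
      using abs_ln_norm_diff_le[OF a0 \<omega>_pos w1, of z] that by (simp add: r_def \<tau>a)
    have m_loc: "c \<le> W m z" "W m z \<le> 1 / c" if "z \<in> ball a r" for z
      using loc[OF a1, of z] ball[OF that] by (auto simp: m_def x0_def)
    have m0: "m z \<noteq> 0" if "z \<in> ball a r" for z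
      using m_loc(1)[OF that] c(1) by (auto simp: weighted_abs_def)
    define H where "H = (\<lambda>z. F z / m z)"
    have holH: "H holomorphic_on ball a r"
      unfolding H_def m_def using m0[unfolded m_def] holomorphic_on_subset[OF F]
      by (intro holomorphic_intros) auto
    have WF: "W F z = cmod (H z) * W m z" if "z \<in> ball a r" for z
      using m0[OF that] by (simp add: H_def weighted_abs_def norm_divide)
    have Wma: "W m a = 1" unfolding m_def by (rule weighted_peak_monomial_center[OF a0])
    have a_ball: "a \<in> ball a r" using r by simp
    have WFa: "W F a = cmod (H a)" using WF[OF a_ball] Wma by simp
    define n where "n = peak_degree x0"
    have m': "(m has_field_derivative of_nat n * m a / a) (at a)"
      unfolding m_def n_def x0_def by (rule peak_monomial_deriv[OF a0])
    have H': "(H has_field_derivative deriv H a) (at a)"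
      using holomorphic_derivI[OF holH open_ball a_ball] .
    have "((\<lambda>z. H z * m z) has_field_derivative deriv H a * m a + (of_nat n * m a / a) * H a) (at a)"
      by (rule DERIV_mult[OF H' m'])
    moreover have "eventually (\<lambda>z. H z * m z = F z) (nhds a)"
    proof (rule eventually_nhds_in_open[OF open_ball a_ball, THEN eventually_mono])
      fix z assume "z \<in> ball a r" then show "H z * m z = F z" using m0 by (simp add: H_def)
    qed
    ultimately have "(F has_field_derivative deriv H a * m a + (of_nat n * m a / a) * H a) (at a)"
      by (subst (asm) DERIV_cong_ev[OF refl _ refl]) auto
    then have F': "deriv F a = deriv H a * m a + (of_nat n * m a / a) * H a" by (rule DERIV_imp_deriv)
    \<comment> \<open>The product rule for \<open>F = H * m\<close>. Division by \<open>s x0\<close>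
      will leave bounded coefficients: \<open>n\<close> is at most \<open>s x0\<close>, and
      \<open>cmod a\<close> equals \<open>2 * r / \<omega> x0\<close>, at most
      \<open>2 * r * s x0\<close> by the choice of \<open>X3\<close>.\<close>
    have "a * deriv F a = m a * (a * deriv H a + of_nat n * H a)"
      using a0 by (simp add: F' field_simps)
    then have "W (\<lambda>z. z * deriv F z) a = W m a * cmod (a * deriv H a + of_nat n * H a)"
      by (simp add: weighted_abs_def norm_mult)
    also have "\<dots> \<le> cmod a * cmod (deriv H a) + real n * cmod (H a)"
      using norm_triangle_ineq[of "a * deriv H a" "of_nat n * H a"] by (simp add: Wma norm_mult)
    also have "\<dots> \<le> s x0 * (2 * (r * cmod (deriv H a))) + s x0 * cmod (H a)"
    proof (intro add_mono mult_right_mono)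
      have "cmod a * cmod (deriv H a) = 1 / \<omega> x0 * (2 * (r * cmod (deriv H a)))"
        by (simp add: r_def \<tau>a)
      also have "\<dots> \<le> s x0 * (2 * (r * cmod (deriv H a)))"
        using X3(2)[of x0] x0 r by (intro mult_right_mono) auto
      finally show "cmod a * cmod (deriv H a) \<le> s x0 * (2 * (r * cmod (deriv H a)))" .
      show "real n \<le> s x0" unfolding n_def by (rule peak_degree)
    qed simp
    finally have "W (\<lambda>z. z * deriv F z) a \<le> s x0 * (2 * (r * cmod (deriv H a)) + cmod (H a))"
      by (simp add: distrib_left)
    moreover have "s x0 > 0" using X3(2)[of x0] x0 \<omega>_pos[of x0] by (smt (verit) zero_less_divide_1_iff)
    ultimately have "weighted_deriv F a \<le> 2 * (r * cmod (deriv H a)) + cmod (H a)"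
      by (simp add: weighted_deriv_def x0_def field_simps)
    then have "weighted_jet F a \<le> 2 * (r * cmod (deriv H a)) + cmod (H a)"
      using r by (simp add: weighted_jet_def WFa)
    moreover have "c * cmod (H z) \<le> W F z" if "z \<in> ball a r" for z
      using WF[OF that] mult_right_mono[OF m_loc(1)[OF that], of "cmod (H z)"] by (simp add: mult.commute)
    ultimately show "\<exists>H. H holomorphic_on ball a (\<tau> (cmod a) / 2) \<and>
           (\<forall>z\<in>ball a (\<tau> (cmod a) / 2). c * cmod (H z) \<le> W F z) \<and>
           weighted_jet F a \<le> 2 * (\<tau> (cmod a) / 2 * cmod (deriv H a)) + cmod (H a)"
      using holH by (auto simp: r_def)
  qed (use c X2 X3 in auto)
qed

text \<open>The unweighted jet estimate applied to the quotient \<open>H\<close>, whose modulus is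
  at most \<open>W F z / c\<close> on the disc.\<close>

lemma weighted_jet_powr_le_integral:
  assumes q: "(q::real) > 0"
  obtains C X where "C > 0" "X \<ge> 0"
    "\<And>F a. F holomorphic_on UNIV \<Longrightarrow> cmod a \<ge> exp X \<Longrightarrow>
       ennreal ((\<tau> (cmod a))\<^sup>2 * weighted_jet F a powr q) \<le>
       ennreal C * (\<integral>\<^sup>+z\<in>ball a (\<tau> (cmod a) / 2). ennreal (W F z powr q) \<partial>lborel)"
proof -
  obtain c X where c: "c > 0" "X \<ge> 0" and
    fac: "\<And>F a. F holomorphic_on UNIV \<Longrightarrow> cmod a \<ge> exp X \<Longrightarrow>
       \<exists>H. H holomorphic_on ball a (\<tau> (cmod a) / 2) \<and>
           (\<forall>z\<in>ball a (\<tau> (cmod a) / 2). c * cmod (H z) \<le> W F z) \<and>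
           weighted_jet F a \<le> 2 * (\<tau> (cmod a) / 2 * cmod (deriv H a)) + cmod (H a)"
    using local_factorization by blast
  obtain C1 where C1: "C1 > 0" "\<And>F a r. r > 0 \<Longrightarrow> F holomorphic_on ball a r \<Longrightarrow>
       ennreal (r\<^sup>2 * max (cmod (F a)) (r * cmod (deriv F a)) powr q) \<le>
       ennreal C1 * (\<integral>\<^sup>+z\<in>ball a r. ennreal (cmod (F z) powr q) \<partial>lborel)"
    using holomorphic_jet_powr_le_integral[OF q] by blast
  \<comment> \<open>The 4 comes from \<open>\<tau> (cmod a) = 2 * r\<close>, \<open>3 powr q\<close>
    from \<open>2 * u + u\<close>, and the last factor from the return from \<open>H\<close> to
    \<open>W F\<close>.\<close>
  define D where "D = 4 * 3 powr q * C1 * (1 / c) powr q"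
  show ?thesis
  proof (rule that[of D X])
    show "D > 0" using C1 c by (simp add: D_def)
    fix F :: "complex \<Rightarrow> complex" and a
    assume F: "F holomorphic_on UNIV" and a: "cmod a \<ge> exp X"
    define r where "r = \<tau> (cmod a) / 2"
    have r: "r > 0" using \<tau>_pos by (simp add: r_def)
    obtain H where H: "H holomorphic_on ball a r" "\<And>z. z \<in> ball a r \<Longrightarrow> c * cmod (H z) \<le> W F z"
      "weighted_jet F a \<le> 2 * (r * cmod (deriv H a)) + cmod (H a)"
      using fac[OF F a] unfolding r_def by blast
    define u where "u = max (cmod (H a)) (r * cmod (deriv H a))"
    have u: "u \<ge> 0" by (simp add: u_def le_max_iff_disj)
    define I where "I = (\<integral>\<^sup>+z\<in>ball a r. ennreal (cmod (H z) powr q) \<partial>lborel)"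
    define J where "J = (\<integral>\<^sup>+z\<in>ball a r. ennreal (W F z powr q) \<partial>lborel)"
    have "weighted_jet F a \<le> 3 * u" using H(3) by (simp add: u_def)
    then have "weighted_jet F a powr q \<le> (3 * u) powr q"
      using q weighted_jet_nonneg by (intro powr_mono2) auto
    also have "\<dots> = 3 powr q * u powr q" using u by (simp add: powr_mult)
    finally have "(\<tau> (cmod a))\<^sup>2 * weighted_jet F a powr q \<le> (2 * r)\<^sup>2 * (3 powr q * u powr q)"
      by (simp add: r_def mult_left_mono)
    also have "\<dots> = 4 * 3 powr q * (r\<^sup>2 * u powr q)"
      by (simp add: power_mult_distrib)
    finally have "ennreal ((\<tau> (cmod a))\<^sup>2 * weighted_jet F a powr q)
        \<le> ennreal (4 * 3 powr q) * ennreal (r\<^sup>2 * u powr q)"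
      by (simp add: ennreal_leI flip: ennreal_mult)
    also have "\<dots> \<le> ennreal (4 * 3 powr q) * (ennreal C1 * I)"
      unfolding I_def u_def by (intro mult_left_mono C1 r H(1)) auto
    also have "\<dots> = ennreal (4 * 3 powr q * C1) * I"
      using C1 by (simp add: ennreal_mult' mult.assoc)
    also have "\<dots> \<le> ennreal (4 * 3 powr q * C1) * (ennreal ((1 / c) powr q) * J)"
    proof (rule mult_left_mono)
      have [measurable]: "W F \<in> borel_measurable borel" "ball a r \<in> sets borel"
        using measurable_weighted_abs[OF F] by simp_all
      have "I \<le> (\<integral>\<^sup>+z. ennreal ((1 / c) powr q) * (ennreal (W F z powr q) * indicator (ball a r) z) \<partial>lborel)"
        unfolding I_def
      proof (rule nn_integral_mono)
        fix z
        show "ennreal (cmod (H z) powr q) * indicator (ball a r) z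
          \<le> ennreal ((1 / c) powr q) * (ennreal (W F z powr q) * indicator (ball a r) z)"
        proof (cases "z \<in> ball a r")
          case True
          have "cmod (H z) \<le> 1 / c * W F z" using H(2)[OF True] c by (simp add: field_simps)
          then have "cmod (H z) powr q \<le> (1 / c * W F z) powr q" using q by (intro powr_mono2) auto
          also have "\<dots> = (1 / c) powr q * W F z powr q" using c by (intro powr_mult) 
          finally show ?thesis using True by (simp flip: ennreal_mult)
        qed simp
      qed
      also have "\<dots> = ennreal ((1 / c) powr q) * J"
        unfolding J_def by (intro nn_integral_cmult) measurable
      finally show "I \<le> ennreal ((1 / c) powr q) * J" .
    qed simp
    also have "\<dots> = ennreal D * J"
    proof -
      have "ennreal D = ennreal (4 * 3 powr q * C1) * ennreal ((1 / c) powr q)"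
        unfolding D_def using C1 by (intro ennreal_mult) auto
      then show ?thesis by (simp only: mult.assoc)
    qed
    finally show "ennreal ((\<tau> (cmod a))\<^sup>2 * weighted_jet F a powr q) \<le>
       ennreal D * (\<integral>\<^sup>+z\<in>ball a (\<tau> (cmod a) / 2). ennreal (W F z powr q) \<partial>lborel)"
      by (simp add: J_def r_def)
  qed (use c in auto)
qed

text \<open>The integral over the disc is at most that over the plane, and the factor
  \<open>\<tau>\<^sup>2\<close> becomes the power \<open>2 / q\<close> after taking roots. For
  \<open>q = \<infinity>\<close> that power of \<open>\<tau>\<close> is 1 and Cauchy's estimate
  replaces the integral.\<close>

lemma weighted_jet_le_fock_norm:
  assumes q: "0 < q"
  obtains C X where "C > 0" "X \<ge> 0"
    "\<And>F a. F \<in> \<F> q \<Longrightarrow> cmod a \<ge> exp X \<Longrightarrow>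
       weighted_jet F a * \<tau> (cmod a) powr (2 / enn2real q) \<le> C * \<N> q F"
proof (cases "q = \<infinity>")
  case True
  obtain c X where c: "c > 0" "X \<ge> 0" and
    fac: "\<And>F a. F holomorphic_on UNIV \<Longrightarrow> cmod a \<ge> exp X \<Longrightarrow>
       \<exists>H. H holomorphic_on ball a (\<tau> (cmod a) / 2) \<and>
           (\<forall>z\<in>ball a (\<tau> (cmod a) / 2). c * cmod (H z) \<le> W F z) \<and>
           weighted_jet F a \<le> 2 * (\<tau> (cmod a) / 2 * cmod (deriv H a)) + cmod (H a)"
    using local_factorization by blast
  show ?thesis
  \<comment> \<open>Cauchy's estimate on radius \<open>r / 2\<close> gives \<open>2 * N\<close> for
    \<open>r * cmod (deriv H a)\<close>, and 2 * 2 + 1 = 5.\<close>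
  proof (rule that[of "5 / c" X])
    fix F a assume F: "F \<in> \<F> q" and a: "cmod a \<ge> exp X"
    define r where "r = \<tau> (cmod a) / 2"
    have r: "r > 0" using \<tau>_pos by (simp add: r_def)
    obtain H where H: "H holomorphic_on ball a r" "\<And>z. z \<in> ball a r \<Longrightarrow> c * cmod (H z) \<le> W F z"
      "weighted_jet F a \<le> 2 * (r * cmod (deriv H a)) + cmod (H a)"
      using fac[OF fock_space_holomorphic[OF F] a] unfolding r_def by blast
    define N where "N = \<N> q F / c"
    have HN: "cmod (H z) \<le> N" if "z \<in> ball a r" for z
    proof -
      have "c * cmod (H z) \<le> \<N> q F"
        using H(2)[OF that] weighted_abs_le_fock_norm[of F z] F True by simp
      then show ?thesis using c by (simp add: N_def field_simps)
    qed
    have "cmod (deriv H a) \<le> N / (r / 2)"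
      by (rule norm_deriv_le_of_cball[OF H(1)]) (use r in \<open>auto intro!: HN\<close>)
    then have "r * cmod (deriv H a) \<le> 2 * N" using r by (simp add: field_simps)
    then have "weighted_jet F a \<le> 5 * N" using H(3) HN[of a] r by simp
    then show "weighted_jet F a * \<tau> (cmod a) powr (2 / enn2real q) \<le> 5 / c * \<N> q F"
      using True \<tau>_pos[of "cmod a"] by (simp add: N_def)
  qed (use c in auto)
next
  case False
  define q' where "q' = enn2real q"
  have q': "q' > 0" using q False by (simp add: q'_def enn2real_pos)
  obtain C X where C: "C > 0" "X \<ge> 0" and
    jet: "\<And>F a. F holomorphic_on UNIV \<Longrightarrow> cmod a \<ge> exp X \<Longrightarrow>
       ennreal ((\<tau> (cmod a))\<^sup>2 * weighted_jet F a powr q') \<le>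
       ennreal C * (\<integral>\<^sup>+z\<in>ball a (\<tau> (cmod a) / 2). ennreal (W F z powr q') \<partial>lborel)"
    using weighted_jet_powr_le_integral[OF q'] by blast
  show ?thesis
  proof (rule that[of "C powr (1 / q')" X])
    fix F a assume F: "F \<in> \<F> q" and a: "cmod a \<ge> exp X"
    have N: "\<N> q F \<ge> 0" using fock_norm_nonneg[OF F] .
    have t: "\<tau> (cmod a) > 0" using \<tau>_pos by simp
    have "ennreal ((\<tau> (cmod a))\<^sup>2 * weighted_jet F a powr q') \<le>
        ennreal C * (\<integral>\<^sup>+z\<in>ball a (\<tau> (cmod a) / 2). ennreal (W F z powr q') \<partial>lborel)"
      by (rule jet[OF fock_space_holomorphic[OF F] a])
    also have "\<dots> \<le> ennreal C * (\<integral>\<^sup>+z. ennreal (W F z powr q') \<partial>lborel)"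
      by (intro mult_left_mono nn_integral_mono) (auto simp: indicator_def)
    also have "\<dots> = ennreal (C * \<N> q F powr q')"
      using C by (simp add: fock_norm_powr[OF False q F, folded q'_def] ennreal_mult)
    finally have "(\<tau> (cmod a))\<^sup>2 * weighted_jet F a powr q' \<le> C * \<N> q F powr q'"
      using C by (subst (asm) ennreal_le_iff) auto
    also have "(\<tau> (cmod a))\<^sup>2 * weighted_jet F a powr q' = (weighted_jet F a * \<tau> (cmod a) powr (2 / q')) powr q'"
      using q' t weighted_jet_nonneg[of F a] by (simp add: powr_mult powr_powr)
    also have "C * \<N> q F powr q' = (C powr (1 / q') * \<N> q F) powr q'"
      using q' C N by (simp add: powr_mult powr_powr)
    finally show "weighted_jet F a * \<tau> (cmod a) powr (2 / enn2real q) \<le> C powr (1 / q') * \<N> q F"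
      unfolding q'_def[symmetric] by (rule powr_le_powrD) (use q' N in auto)
  qed (use C in auto)
qed

section \<open>The common estimate for the two operators\<close>

definition symbol_operator :: "(complex \<Rightarrow> complex) \<Rightarrow> ((complex \<Rightarrow> complex) \<Rightarrow> complex \<Rightarrow> complex) \<Rightarrow> bool" where
  "symbol_operator g T \<longleftrightarrow> T = mult_op g \<or> T = integral_op g"

text \<open>\<open>mult_op\<close> carries \<open>g a\<close> in the value of the image,
  \<open>integral_op\<close> in its derivative; a lower bound \<open>c\<close> on both the value and
  the derivative of \<open>f\<close> covers either case.\<close>

lemma symbol_operator_jet:
  assumes T: "symbol_operator g T" and g: "g holomorphic_on UNIV" and f: "f holomorphic_on UNIV"
    and c: "c \<le> W f a" "c \<le> weighted_deriv f a"
  shows "c * cmod (g a) \<le> weighted_jet (T f) a"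
  using T unfolding symbol_operator_def
proof
  assume "T = mult_op g"
  then have "W (T f) a = W f a * cmod (g a)" by (simp add: mult_op_def weighted_abs_def norm_mult)
  then show ?thesis using mult_right_mono[OF c(1), of "cmod (g a)"] by (simp add: weighted_jet_def)
next
  assume T: "T = integral_op g"
  have "weighted_deriv (T f) a = weighted_deriv f a * cmod (g a)"
    by (simp add: T weighted_deriv_def integral_op_holomorphic(2)[OF f g] weighted_abs_def norm_mult)
  then show ?thesis using mult_right_mono[OF c(2), of "cmod (g a)"] by (simp add: weighted_jet_def)
qed

end

section \<open>Concentrated test functions\<close>

text \<open>Off \<open>w = 1\<close> this is \<open>(1 - w ^ L) / (of_nat L * (1 - w))\<close>, on
  the unit circle a Dirichlet kernel up to a unimodular factor: it is 1 at \<open>w = 1\<close> and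
  at most \<open>2 / (L * cmod (1 - w))\<close> elsewhere. The sum shows that it is a
  polynomial.\<close>

definition averaged_powers :: "nat \<Rightarrow> complex \<Rightarrow> complex" where
  "averaged_powers L w = (\<Sum>j<L. w ^ j) / of_nat L"

lemma averaged_powers_holomorphic [holomorphic_intros]:
  "f holomorphic_on A \<Longrightarrow> (\<lambda>z. averaged_powers L (f z)) holomorphic_on A"
  unfolding averaged_powers_def by (cases "L = 0") (auto intro!: holomorphic_intros)

lemma norm_power_le_exp_ln:
  assumes "w \<noteq> 0" "j \<le> L"
  shows "cmod (w ^ j) \<le> exp (real L * \<bar>ln (cmod w)\<bar>)"
proof -
  have "cmod (w ^ j) = exp (real j * ln (cmod w))"
    using assms by (simp add: norm_power exp_of_nat_mult)
  also have "\<dots> \<le> exp (real L * \<bar>ln (cmod w)\<bar>)"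
  proof -
    have "real j * ln (cmod w) \<le> real j * \<bar>ln (cmod w)\<bar>" by (intro mult_left_mono) auto
    also have "\<dots> \<le> real L * \<bar>ln (cmod w)\<bar>" using assms by (intro mult_right_mono) auto
    finally show ?thesis by simp
  qed
  finally show ?thesis .
qed

text \<open>Off the unit circle the powers may grow; the exponential records by how much, for
  comparison with the radial decay of the monomial.\<close>

lemma averaged_powers_bounds:
  assumes L: "L > 0" and w: "w \<noteq> 0"
  shows "cmod (averaged_powers L w) \<le> exp (real L * \<bar>ln (cmod w)\<bar>)"
    and "real L * cmod (1 - w) * cmod (averaged_powers L w) \<le> 2 * exp (real L * \<bar>ln (cmod w)\<bar>)"
proof -
  let ?E = "exp (real L * \<bar>ln (cmod w)\<bar>)"
  have "cmod (\<Sum>j<L. w ^ j) \<le> (\<Sum>j<L. ?E)"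
    by (rule sum_norm_le) (use norm_power_le_exp_ln[OF w] in auto)
  then show "cmod (averaged_powers L w) \<le> ?E"
    using L by (simp add: averaged_powers_def norm_divide field_simps)
  have "(1 - w) * (\<Sum>j<L. w ^ j) = 1 - w ^ L" by (rule one_diff_power_eq[symmetric])
  then have "of_nat L * (1 - w) * averaged_powers L w = 1 - w ^ L"
    using L by (simp add: averaged_powers_def)
  then have "real L * cmod (1 - w) * cmod (averaged_powers L w) = cmod (1 - w ^ L)"
    by (metis norm_mult norm_of_nat)
  also have "\<dots> \<le> 1 + cmod (w ^ L)" using norm_triangle_ineq4[of 1 "w ^ L"] by simp
  also have "\<dots> \<le> ?E + ?E" by (intro add_mono norm_power_le_exp_ln w) auto
  finally show "real L * cmod (1 - w) * cmod (averaged_powers L w) \<le> 2 * ?E" by simp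
qed

lemma averaged_powers_one: "L > 0 \<Longrightarrow> averaged_powers L 1 = 1"
  by (simp add: averaged_powers_def)

text \<open>Being real and nonnegative at the peak, this derivative adds to the degree of the
  monomial instead of cancelling it.\<close>

lemma averaged_powers_deriv:
  "\<exists>d\<ge>0. (averaged_powers L has_field_derivative complex_of_real d) (at 1)"
proof (intro exI conjI)
  have "((\<lambda>w. \<Sum>j<L. w ^ j) has_field_derivative (\<Sum>j<L. of_nat j * 1 ^ (j - Suc 0))) (at (1::complex))"
    by (intro DERIV_sum DERIV_power[OF DERIV_ident, THEN DERIV_cong]) auto
  then show "(averaged_powers L has_field_derivative complex_of_real ((\<Sum>j<L. real j) / real L)) (at 1)"
    unfolding averaged_powers_def [abs_def] using DERIV_cdivide by fastforce
qed (simp add: sum_nonneg)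

lemma exp_max: "exp (max x y) = max (exp x) (exp (y::real))"
  by (simp add: max_def)

context fock_weight
begin

text \<open>Radially the monomial confines the function to a ring of width about
  \<open>\<tau> (cmod a)\<close>. The kernel with \<open>L\<close> about \<open>1 / \<omega>\<close>
  confines the argument to an arc of length about \<open>cmod a * \<omega>\<close>, which is the
  same \<open>\<tau> (cmod a)\<close>. Its power \<open>k\<close> gives decay of order
  \<open>k\<close>.\<close>

lemma concentrated_test_functions:
  "\<exists>f M X. 0 < M \<and> 0 \<le> X \<and> (\<forall>a. cmod a \<ge> exp X \<longrightarrow>
     decay_bound (f a) a (\<tau> (cmod a)) M k \<and> W (f a) a = 1 \<and> weighted_deriv (f a) a \<ge> 1 / 2)"
proof -
  \<comment> \<open>Each kernel factor may grow like \<open>exp (2 * u)\<close>, with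
    \<open>u\<close> the logarithmic distance in units of \<open>\<omega>\<close>; the rate
    \<open>2 * real k\<close> cancels \<open>k\<close> such factors.\<close>
  obtain B X1 where X1: "X1 \<ge> 0" and
    up: "\<And>a z. cmod a \<ge> exp X1 \<Longrightarrow> z \<noteq> 0 \<Longrightarrow> W (peak_monomial a) z \<le>
       exp (B - G (ln (cmod a)) (ln (cmod z)) / 2 - (2 * real k) * (\<bar>ln (cmod z) - ln (cmod a)\<bar> / \<omega> (ln (cmod a))))"
    using weighted_peak_monomial_upper[of "2 * real k"] by (metis mult_nonneg_nonneg of_nat_0_le_iff zero_le_numeral)
  obtain X2 where X2: "X2 \<ge> 0" "\<And>x. x \<ge> X2 \<Longrightarrow> \<omega> x \<le> 1" using slowly_varying by metis
  \<comment> \<open>With \<open>\<omega> \<le> 1\<close> this gives a slope of at least 2, so the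
    degree after rounding down is at least half the slope.\<close>
  obtain X3 where X3: "X3 \<ge> 0" "\<And>x. x \<ge> X3 \<Longrightarrow> 2 / \<omega> x \<le> s x" using slope_large by metis
  define L where "L a = nat \<lceil>1 / \<omega> (ln (cmod a))\<rceil>" for a :: complex
  define f where "f a z = peak_monomial a z * averaged_powers (L a) (z / a) ^ k" for a z
  \<comment> \<open>\<open>exp B\<close> comes from the monomial, and each kernel factor contributes
    a 2 through its decay bound.\<close>
  define M where "M = exp B * 2 ^ k"
  define X where "X = max X1 (max X2 X3)"
  have Xs: "cmod a \<ge> exp X1" "a \<noteq> 0" "\<omega> (ln (cmod a)) \<le> 1" "2 / \<omega> (ln (cmod a)) \<le> s (ln (cmod a))"
    "s (ln (cmod a)) \<ge> 2" if "cmod a \<ge> exp X" for a :: complex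
  proof -
    have l: "a \<noteq> 0" "X \<le> ln (cmod a)" using ln_norm_ge[OF that] by auto
    show "cmod a \<ge> exp X1" using that by (rule order_trans[rotated]) (simp add: X_def)
    show "a \<noteq> 0" by fact
    show w: "\<omega> (ln (cmod a)) \<le> 1" "2 / \<omega> (ln (cmod a)) \<le> s (ln (cmod a))"
      using X2(2)[of "ln (cmod a)"] X3(2)[of "ln (cmod a)"] l by (auto simp: X_def)
    have "2 \<le> 2 / \<omega> (ln (cmod a))" using w(1) by (simp add: field_simps)
    then show "s (ln (cmod a)) \<ge> 2" using w(2) by linarith
  qed
  have L: "L a > 0" "1 / \<omega> (ln (cmod a)) \<le> real (L a)" "real (L a) \<le> 2 / \<omega> (ln (cmod a))"
    if "cmod a \<ge> exp X" for a
  proof -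
    have w: "\<omega> (ln (cmod a)) \<le> 1" by (rule Xs[OF that])
    have "1 \<le> 1 / \<omega> (ln (cmod a))" using w by (simp add: field_simps)
    moreover have "2 / \<omega> (ln (cmod a)) = 1 / \<omega> (ln (cmod a)) + 1 / \<omega> (ln (cmod a))" by simp
    ultimately show "L a > 0" "1 / \<omega> (ln (cmod a)) \<le> real (L a)" "real (L a) \<le> 2 / \<omega> (ln (cmod a))"
      unfolding L_def by linarith+
  qed
  show ?thesis
  proof (rule exI[of _ f], rule exI[of _ M], rule exI[of _ X], intro conjI allI impI)
    show "M > 0" by (simp add: M_def)
    show "X \<ge> 0" using X1 by (simp add: X_def)
    fix a assume a: "cmod a \<ge> exp X"
    have hol: "f a holomorphic_on UNIV"
      unfolding f_def [abs_def] using Xs(2)[OF a] by (intro holomorphic_intros) auto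
    define x0 where "x0 = ln (cmod a)"
    note Xa = Xs[OF a, folded x0_def]
    have Wma: "W (peak_monomial a) a = 1" by (rule weighted_peak_monomial_center[OF Xa(2)])
    have Wfa: "W (f a) a = 1"
      using Wma Xa(2) averaged_powers_one[OF L(1)[OF a]] by (simp add: f_def weighted_abs_def)
    define n where "n = peak_degree x0"
    define m where "m = peak_monomial a"
    obtain d where d: "d \<ge> 0" "(averaged_powers (L a) has_field_derivative complex_of_real d) (at 1)"
      using averaged_powers_deriv by blast
    have da: "((\<lambda>z. z / a) has_field_derivative 1 / a) (at a)"
      by (intro DERIV_cdivide DERIV_ident)
    have m': "(m has_field_derivative of_nat n * m a / a) (at a)"
      unfolding m_def n_def x0_def by (rule peak_monomial_deriv[OF Xa(2)])
    have "((\<lambda>z. averaged_powers (L a) (z / a)) has_field_derivative complex_of_real d * (1 / a)) (at a)"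
      by (rule DERIV_chain'[OF da, of "averaged_powers (L a)"]) (use d(2) Xa(2) in simp)
    from DERIV_mult[OF m' DERIV_power[OF this, of k]]
    have "(f a has_field_derivative m a * (of_nat n + of_nat k * complex_of_real d) / a) (at a)"
      unfolding f_def [abs_def] m_def using Xa(2) averaged_powers_one[OF L(1)[OF a]]
      by (simp add: field_simps)
    then have "deriv (f a) a = m a * (of_nat n + of_nat k * complex_of_real d) / a" by (rule DERIV_imp_deriv)
    then have "a * deriv (f a) a = m a * complex_of_real (real n + real k * d)" using Xa(2) by simp
    then have "W (\<lambda>z. z * deriv (f a) z) a = W m a * (real n + real k * d)"
      using d(1) by (simp add: weighted_abs_def norm_mult del: of_real_add of_real_mult)
    then have "W (\<lambda>z. z * deriv (f a) z) a \<ge> real n" using Wma d(1) by (simp add: m_def)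
    moreover have "real n \<ge> s x0 / 2" using peak_degree(2)[of x0] Xa(5) by (simp add: n_def)
    ultimately have "W (\<lambda>z. z * deriv (f a) z) a \<ge> s x0 / 2" by linarith
    then have "weighted_deriv (f a) a \<ge> 1 / 2"
      using Xa(5) unfolding weighted_deriv_def x0_def[symmetric] by (simp add: field_simps)
    then show "W (f a) a = 1" "weighted_deriv (f a) a \<ge> 1 / 2" using Wfa by auto
    note La = L[OF a, folded x0_def]
    have "W (f a) z \<le> M \<and> cmod (z - a) ^ k * W (f a) z \<le> M * \<tau> (cmod a) ^ k" for z
    proof (cases "z = 0")
      case True
      have "real (peak_degree x0) > 0" using peak_degree(2)[of x0] Xa(5) by linarith
      then have "W (f a) z = 0"
        using True by (simp add: f_def weighted_abs_def peak_monomial_def x0_def)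
      then show ?thesis using \<tau>_pos[of "cmod a"] by (simp add: M_def)
    next
      case False
      define x where "x = ln (cmod z)"
      define u where "u = \<bar>x - x0\<bar> / \<omega> x0"
      define Q where "Q = cmod (averaged_powers (L a) (z / a))"
      have za: "z / a \<noteq> 0" using False Xa(2) by simp
      have "ln (cmod (z / a)) = x - x0" using False Xa(2) by (simp add: norm_divide ln_div x_def x0_def)
      moreover have "real (L a) * \<bar>x - x0\<bar> \<le> 2 * u"
        using mult_right_mono[OF La(3), of "\<bar>x - x0\<bar>"] by (simp add: u_def)
      ultimately have E: "exp (real (L a) * \<bar>ln (cmod (z / a))\<bar>) \<le> exp (2 * u)" by simp
      have Q1: "Q \<le> exp (2 * u)"
        using averaged_powers_bounds(1)[OF La(1) za] E unfolding Q_def by (rule order_trans)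
      have Q2: "cmod (z - a) * Q \<le> 2 * \<tau> (cmod a) * exp (2 * u)"
      proof -
        have "cmod (z - a) = cmod a * cmod (1 - z / a)"
          using Xa(2) by (simp add: norm_minus_commute flip: norm_mult) (simp add: algebra_simps)
        moreover have "cmod a \<le> \<tau> (cmod a) * real (L a)"
        proof -
          have "cmod a * 1 \<le> cmod a * (\<omega> x0 * real (L a))"
            using La(2) by (intro mult_left_mono) (auto simp: field_simps)
          then show ?thesis using \<tau>_eq[of x0] Xa(2) by (simp add: x0_def mult.assoc)
        qed
        ultimately have "cmod (z - a) * Q \<le> (\<tau> (cmod a) * real (L a)) * cmod (1 - z / a) * Q"
          by (auto intro!: mult_right_mono simp: Q_def)
        also have "\<dots> = \<tau> (cmod a) * (real (L a) * cmod (1 - z / a) * Q)" by (simp add: mult_ac)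
        also have "\<dots> \<le> \<tau> (cmod a) * (2 * exp (2 * u))"
        proof (rule mult_left_mono)
          show "real (L a) * cmod (1 - z / a) * Q \<le> 2 * exp (2 * u)"
            using averaged_powers_bounds(2)[OF La(1) za] E unfolding Q_def by linarith
        qed (simp add: less_imp_le \<tau>_pos)
        finally show ?thesis by (simp add: mult_ac)
      qed
      have Wm: "W (peak_monomial a) z \<le> exp B * inverse (exp (2 * u)) ^ k"
      proof -
        have "W (peak_monomial a) z \<le> exp (B - G x0 x / 2 - (2 * real k) * u)"
          using up[OF Xa(1) False] by (simp add: x_def x0_def u_def)
        also have "\<dots> \<le> exp (B - real k * (2 * u))" using remainder_nonneg[of x0 x] by simp
        also have "\<dots> = exp B * inverse (exp (2 * u)) ^ k"
          by (simp add: exp_diff exp_of_nat_mult divide_inverse power_inverse)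
        finally show ?thesis .
      qed
      have Wf: "W (f a) z = W (peak_monomial a) z * Q ^ k"
        by (simp add: f_def weighted_abs_def norm_mult norm_power Q_def)
      have Q0: "Q \<ge> 0" by (simp add: Q_def)
      have "W (f a) z \<le> exp B * inverse (exp (2 * u)) ^ k * exp (2 * u) ^ k"
        unfolding Wf using Wm Q1 Q0 by (intro mult_mono power_mono) auto
      also have "\<dots> = exp B" by (simp add: mult.assoc flip: power_mult_distrib)
      also have "\<dots> \<le> M" by (simp add: M_def)
      finally have 1: "W (f a) z \<le> M" .
      have "cmod (z - a) ^ k * W (f a) z = W (peak_monomial a) z * (cmod (z - a) * Q) ^ k"
        unfolding Wf by (simp add: power_mult_distrib mult_ac)
      also have "\<dots> \<le> exp B * inverse (exp (2 * u)) ^ k * (2 * \<tau> (cmod a) * exp (2 * u)) ^ k"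
        by (rule mult_mono[OF Wm power_mono[OF Q2]]) (use Q0 in auto)
      also have "\<dots> = M * \<tau> (cmod a) ^ k"
        by (simp add: M_def power_mult_distrib mult_ac power_inverse)
      finally show ?thesis using 1 by simp
    qed
    then show "decay_bound (f a) a (\<tau> (cmod a)) M k" using hol by (simp add: decay_bound_def)
  qed
qed

section \<open>Necessary conditions when p \<le> q\<close>

lemma \<tau>_at_infinity: "((\<lambda>a::complex. \<tau> (cmod a)) \<longlongrightarrow> 0) at_infinity"
  by (rule filterlim_compose[OF \<tau>_lim filterlim_norm_at_top])

lemma symbol_bound:
  assumes p: "0 < p" and q: "0 < q" and T: "symbol_operator g T" and g: "g holomorphic_on UNIV"
    and bd: "bounded_operator \<psi> p q T"
  obtains C X where "C > 0" "\<And>a. cmod a \<ge> exp X \<Longrightarrow>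
    cmod (g a) \<le> C * \<tau> (cmod a) powr (2 / enn2real p - 2 / enn2real q)"
proof -
  \<comment> \<open>Decay of order 3 after taking \<open>p\<close>-th powers is integrable over the
    plane.\<close>
  define k where "k = nat \<lceil>3 / enn2real p\<rceil>"
  have k: "3 / enn2real p \<le> real k" unfolding k_def by linarith
  obtain f :: "complex \<Rightarrow> complex \<Rightarrow> complex" and M X1 where M: "M > 0" and X1: "X1 \<ge> 0"
    and test: "\<forall>a. cmod a \<ge> exp X1 \<longrightarrow>
     decay_bound (f a) a (\<tau> (cmod a)) M k \<and> W (f a) a = 1 \<and> weighted_deriv (f a) a \<ge> 1 / 2"
    using concentrated_test_functions[of k] by blast
  obtain C1 where C1: "C1 > 0" and
    nrm: "\<And>f a t M k. decay_bound f a t M k \<Longrightarrow> t > 0 \<Longrightarrow> 3 / enn2real p \<le> real k \<Longrightarrow>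
       f \<in> \<F> p \<and> \<N> p f \<le> C1 * M * t powr (2 / enn2real p)"
    using fock_norm_le_of_decay[OF p] by blast
  obtain C2 X2 where C2: "C2 > 0" "X2 \<ge> 0" and
    jet: "\<And>F a. F \<in> \<F> q \<Longrightarrow> cmod a \<ge> exp X2 \<Longrightarrow>
       weighted_jet F a * \<tau> (cmod a) powr (2 / enn2real q) \<le> C2 * \<N> q F"
    using weighted_jet_le_fock_norm[OF q] by blast
  obtain C3 where C3: "\<forall>f\<in>\<F> p. T f \<in> \<F> q \<and> \<N> q (T f) \<le> C3 * \<N> p f"
    using bd unfolding bounded_operator_def by blast
  \<comment> \<open>\<open>C3\<close> need not be positive; the maximum with 1 makes
    \<open>C\<close> so.\<close>
  define C where "C = 2 * C2 * max C3 1 * (C1 * M)"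
  show ?thesis
  proof (rule that[of C "max X1 X2"])
    show "C > 0" using C1 C2 M by (simp add: C_def)
    fix a :: complex assume a: "cmod a \<ge> exp (max X1 X2)"
    have a1: "cmod a \<ge> exp X1" and a2: "cmod a \<ge> exp X2" using a by (simp_all add: exp_max)
    have t: "\<tau> (cmod a) > 0" using \<tau>_pos by simp
    have fa: "f a \<in> \<F> p" "\<N> p (f a) \<le> C1 * M * \<tau> (cmod a) powr (2 / enn2real p)"
      using nrm[OF _ t k, of "f a" a M] test a1 by auto
    have hol: "f a holomorphic_on UNIV" using fock_space_holomorphic[OF fa(1)] .
    have "1 / 2 * cmod (g a) \<le> weighted_jet (T (f a)) a"
      using test a1 by (intro symbol_operator_jet[OF T g hol]) auto
    then have "cmod (g a) * \<tau> (cmod a) powr (2 / enn2real q)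
        \<le> 2 * (weighted_jet (T (f a)) a * \<tau> (cmod a) powr (2 / enn2real q))"
      using mult_right_mono[of "cmod (g a)" "2 * weighted_jet (T (f a)) a" "\<tau> (cmod a) powr (2 / enn2real q)"] by simp
    also have "\<dots> \<le> 2 * (C2 * \<N> q (T (f a)))"
      using jet[OF _ a2, of "T (f a)"] C3 fa(1) by simp
    also have "\<dots> \<le> 2 * (C2 * (max C3 1 * (C1 * M * \<tau> (cmod a) powr (2 / enn2real p))))"
    proof -
      have "\<N> q (T (f a)) \<le> C3 * \<N> p (f a)" using C3 fa(1) by blast
      also have "\<dots> \<le> max C3 1 * (C1 * M * \<tau> (cmod a) powr (2 / enn2real p))"
        using fa(2) fock_norm_nonneg[OF fa(1)] by (intro mult_mono) auto
      finally show ?thesis using C2 by simp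
    qed
    also have "\<dots> = C * \<tau> (cmod a) powr (2 / enn2real p)" by (simp add: C_def mult_ac)
    finally show "cmod (g a) \<le> C * \<tau> (cmod a) powr (2 / enn2real p - 2 / enn2real q)"
      using t by (simp add: powr_diff field_simps)
  qed
qed

lemma bounded_symbol_constant:
  assumes p: "0 < p" and T: "symbol_operator g T" and g: "g holomorphic_on UNIV"
    and bd: "bounded_operator \<psi> p p T"
  shows "g constant_on UNIV"
proof -
  obtain C X where C: "C > 0" "\<And>a. cmod a \<ge> exp X \<Longrightarrow>
    cmod (g a) \<le> C * \<tau> (cmod a) powr (2 / enn2real p - 2 / enn2real p)"
    using symbol_bound[OF p p T g bd] by blast
  have "compact (g ` cball 0 (exp X))"
    using g holomorphic_on_imp_continuous_on holomorphic_on_subset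
    by (intro compact_continuous_image) auto
  then obtain D where D: "\<And>z. z \<in> cball 0 (exp X) \<Longrightarrow> cmod (g z) \<le> D"
    using compact_imp_bounded bounded_iff by (metis imageI)
  have "cmod (g z) \<le> max C D" for z
  proof (cases "cmod z \<ge> exp X")
    case True
    then show ?thesis using C(2)[OF True] \<tau>_pos[of "cmod z"] by simp
  next
    case False
    then show ?thesis using D[of z] by simp
  qed
  then have "bounded (range g)" by (auto simp: bounded_iff)
  then show ?thesis by (rule Liouville_theorem[OF g])
qed

lemma bounded_symbol_zero_less:
  assumes p: "0 < p" and pq: "p < q" and T: "symbol_operator g T" and g: "g holomorphic_on UNIV"
    and bd: "bounded_operator \<psi> p q T"
  shows "g = (\<lambda>z. 0)"
proof -
  have q: "0 < q" using p pq by simp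
  define e where "e = 2 / enn2real p - 2 / enn2real q"
  have pfin: "p \<noteq> \<infinity>" using pq by auto
  have p': "enn2real p > 0" using p pfin by (simp add: enn2real_pos)
  have e: "e > 0"
  proof (cases "q = \<infinity>")
    case True then show ?thesis using p' by (simp add: e_def)
  next
    case False
    then have "enn2real p < enn2real q" using pq by (simp add: enn2real_less_iff less_top)
    then show ?thesis using p' by (simp add: e_def frac_less2)
  qed
  obtain C X where C: "C > 0" "\<And>a. cmod a \<ge> exp X \<Longrightarrow> cmod (g a) \<le> C * \<tau> (cmod a) powr e"
    using symbol_bound[OF p q T g bd] unfolding e_def by blast
  have ev: "eventually (\<lambda>a. cmod (g a) \<le> C * \<tau> (cmod a) powr e) at_infinity"
    unfolding eventually_at_infinity using C(2) by blast
  have "((\<lambda>a::complex. \<tau> (cmod a) powr e) \<longlongrightarrow> 0) at_infinity"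
    by (rule tendsto_zero_powrI[OF \<tau>_at_infinity tendsto_const _ e]) (simp add: less_imp_le \<tau>_pos)
  then have "((\<lambda>a::complex. C * \<tau> (cmod a) powr e) \<longlongrightarrow> 0) at_infinity"
    by (rule tendsto_mult_right_zero)
  then have "(g \<longlongrightarrow> 0) at_infinity"
    by (rule Lim_null_comparison[OF ev])
  then show ?thesis using Liouville_weak_0[OF g] by blast
qed

lemma compact_symbol_zero:
  assumes p: "0 < p" and T: "symbol_operator g T" and g: "g holomorphic_on UNIV"
    and cpt: "compact_operator \<psi> p p T"
  shows "g = (\<lambda>z. 0)"
proof (rule ccontr)
  assume "g \<noteq> (\<lambda>z. 0)"
  then have "\<not> (g \<longlongrightarrow> 0) at_infinity" using Liouville_weak_0[OF g] by blast
  then obtain \<eta> where \<eta>: "\<eta> > 0" "\<And>R. \<exists>a. cmod a \<ge> R \<and> cmod (g a) \<ge> \<eta>"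
    unfolding tendsto_iff eventually_at_infinity by (auto simp: not_less)
  define e where "e = 2 / enn2real p"
  \<comment> \<open>The additional 1 makes \<open>k\<close> exceed \<open>e\<close> strictly even
    for \<open>p = \<infinity>\<close>, where both quotients are 0; the power
    \<open>real k - e\<close> of \<open>t m\<close> then tends to 0.\<close>
  define k where "k = nat \<lceil>3 / enn2real p + 1\<rceil>"
  have e0: "e \<ge> 0" by (simp add: e_def)
  have k_ge: "3 / enn2real p + 1 \<le> real k" unfolding k_def by linarith
  moreover have "3 / enn2real p \<ge> e" by (simp add: e_def divide_right_mono)
  ultimately have ke: "real k > e" and k: "3 / enn2real p \<le> real k" by linarith+
  obtain f :: "complex \<Rightarrow> complex \<Rightarrow> complex" and M X1 where M: "M > 0" and X1: "X1 \<ge> 0"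
    and test: "\<forall>a. cmod a \<ge> exp X1 \<longrightarrow>
     decay_bound (f a) a (\<tau> (cmod a)) M k \<and> W (f a) a = 1 \<and> weighted_deriv (f a) a \<ge> 1 / 2"
    using concentrated_test_functions[of k] by blast
  obtain C1 where C1: "C1 > 0" and
    nrm: "\<And>f a t M k. decay_bound f a t M k \<Longrightarrow> t > 0 \<Longrightarrow> 3 / enn2real p \<le> real k \<Longrightarrow>
       f \<in> \<F> p \<and> \<N> p f \<le> C1 * M * t powr (2 / enn2real p)"
    using fock_norm_le_of_decay[OF p] by blast
  obtain C2 X2 where C2: "C2 > 0" "X2 \<ge> 0" and
    jet: "\<And>F a. F \<in> \<F> p \<Longrightarrow> cmod a \<ge> exp X2 \<Longrightarrow>
       weighted_jet F a * \<tau> (cmod a) powr (2 / enn2real p) \<le> C2 * \<N> p F"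
    using weighted_jet_le_fock_norm[OF p] by blast
  have "\<forall>m. \<exists>a. cmod a \<ge> max (real m) (exp (max X1 X2)) \<and> cmod (g a) \<ge> \<eta>" using \<eta>(2) by blast
  then obtain a where a: "\<And>m. cmod (a m) \<ge> max (real m) (exp (max X1 X2))" "\<And>m. cmod (g (a m)) \<ge> \<eta>"
    by metis
  have a1: "cmod (a m) \<ge> exp X1" and a2: "cmod (a m) \<ge> exp X2" and am: "cmod (a m) \<ge> real m" for m
    using a(1)[of m] by (simp_all add: exp_max)
  define t where "t m = \<tau> (cmod (a m))" for m
  have t: "t m > 0" for m using \<tau>_pos by (simp add: t_def)
  \<comment> \<open>Division by \<open>t m powr e\<close>, the order of the norm of the test
    function, makes the norms bounded.\<close>
  define F where "F m z = complex_of_real (t m powr (- e)) * f (a m) z" for m z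
  have peak: "decay_bound (f (a m)) (a m) (t m) M k" "W (f (a m)) (a m) = 1"
    "weighted_deriv (f (a m)) (a m) \<ge> 1 / 2" for m
    using test a1[of m] by (auto simp: t_def)
  have hol: "f (a m) holomorphic_on UNIV" for m using peak(1) by (simp add: decay_bound_def)
  have holF: "F m holomorphic_on UNIV" for m
    unfolding F_def [abs_def] by (intro holomorphic_intros hol)
  have WF: "W (F m) z = t m powr (- e) * W (f (a m)) z" for m z
    by (simp add: F_def weighted_abs_def norm_mult)
  have tt: "t m powr (- e) * t m powr e = 1" for m using t[of m] by (simp flip: powr_add)
  have decF: "decay_bound (F m) (a m) (t m) (t m powr (- e) * M) k" for m
    unfolding decay_bound_def
  proof (intro conjI allI holF)
    fix z
    have "W (f (a m)) z \<le> M" "cmod (z - a m) ^ k * W (f (a m)) z \<le> M * t m ^ k"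
      using peak(1)[of m] by (auto simp: decay_bound_def)
    from this[THEN mult_left_mono, of "t m powr (- e)"]
    show "W (F m) z \<le> t m powr (- e) * M" "cmod (z - a m) ^ k * W (F m) z \<le> t m powr (- e) * M * t m ^ k"
      by (simp_all add: WF mult_ac)
  qed
  have Fp: "F m \<in> \<F> p \<and> \<N> p (F m) \<le> C1 * M" for m
  proof -
    have "C1 * (t m powr (- e) * M) * t m powr (2 / enn2real p) = C1 * M * (t m powr (- e) * t m powr e)"
      unfolding e_def by (simp only: mult_ac)
    also have "\<dots> = C1 * M" unfolding tt by simp
    finally show ?thesis using nrm[OF decF t k, of m] by metis
  qed
  have tlim: "t \<longlonglongrightarrow> 0"
  proof -
    have "filterlim a at_infinity sequentially"
      unfolding filterlim_at_infinity[OF order_refl]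
    proof (intro allI impI)
      fix r :: real
      show "eventually (\<lambda>m. r \<le> cmod (a m)) sequentially"
        using eventually_ge_at_top[of "nat \<lceil>r\<rceil>"]
      proof eventually_elim
        case (elim m)
        then have "r \<le> real m" by linarith
        then show ?case using am[of m] by linarith
      qed
    qed
    from filterlim_compose[OF \<tau>_at_infinity this] show ?thesis by (simp add: t_def [abs_def])
  qed
  \<comment> \<open>From a fixed disc the point \<open>a m\<close> is eventually at distance at
    least 1, and there the decay of order \<open>k\<close> outweighs the normalising factor
    \<open>t m powr (- e)\<close>.\<close>
  have small: "\<exists>\<epsilon>. \<epsilon> \<longlonglongrightarrow> 0 \<and> eventually (\<lambda>m. \<forall>z. cmod z \<le> R \<longrightarrow> cmod (F m z) \<le> \<epsilon> m) sequentially" for R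
  proof -
    obtain S where S: "S \<ge> 0" "\<And>z. cmod z \<le> R \<Longrightarrow> \<psi> (cmod z) \<le> S" using radial_weight_bounded by blast
    define \<epsilon> where "\<epsilon> m = exp S * M * t m powr (real k - e)" for m
    have "(\<lambda>m. t m powr (real k - e)) \<longlonglongrightarrow> 0"
      by (rule tendsto_zero_powrI[OF tlim tendsto_const]) (use ke t in \<open>auto simp: less_imp_le\<close>)
    then have "\<epsilon> \<longlonglongrightarrow> 0"
      unfolding \<epsilon>_def [abs_def] by (rule tendsto_mult_right_zero)
    moreover have "eventually (\<lambda>m. \<forall>z. cmod z \<le> R \<longrightarrow> cmod (F m z) \<le> \<epsilon> m) sequentially"
      using eventually_ge_at_top[of "nat \<lceil>R + 1\<rceil>"]
    proof eventually_elim
      case (elim m)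
      have mR: "R + 1 \<le> real m" using elim by linarith
      show ?case
      proof (intro allI impI)
        fix z assume z: "cmod z \<le> R"
        have "1 \<le> cmod (z - a m)"
          using norm_triangle_ineq2[of "a m" z] am[of m] mR z by (simp add: norm_minus_commute)
        then have "1 * W (F m) z \<le> cmod (z - a m) ^ k * W (F m) z"
          by (intro mult_right_mono one_le_power) auto
        also have "\<dots> \<le> t m powr (- e) * M * t m ^ k" using decF[of m] by (simp add: decay_bound_def)
        also have "\<dots> = M * t m powr (real k - e)"
          using t[of m] by (simp add: powr_diff powr_minus powr_realpow field_simps)
        finally have W: "W (F m) z \<le> M * t m powr (real k - e)" by simp
        have "cmod (F m z) = exp (\<psi> (cmod z)) * W (F m) z"
          by (simp add: weighted_abs_def exp_minus)
        also have "\<dots> \<le> exp S * (M * t m powr (real k - e))"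
          using W S(2)[OF z] by (intro mult_mono) auto
        finally show "cmod (F m z) \<le> \<epsilon> m" by (simp add: \<epsilon>_def mult.assoc)
      qed
    qed
    ultimately show ?thesis by blast
  qed
  have lim0: "(\<lambda>m. F m z) \<longlonglongrightarrow> 0" for z
  proof -
    obtain \<epsilon> where \<epsilon>: "\<epsilon> \<longlonglongrightarrow> 0" "eventually (\<lambda>m. \<forall>w. cmod w \<le> cmod z \<longrightarrow> cmod (F m w) \<le> \<epsilon> m) sequentially"
      using small by blast
    have "eventually (\<lambda>m. norm (F m z) \<le> \<epsilon> m) sequentially" using \<epsilon>(2) by (rule eventually_mono) simp
    then show ?thesis using \<epsilon>(1) by (rule Lim_null_comparison)
  qed
  have lim1: "(\<lambda>m. deriv (F m) z) \<longlonglongrightarrow> 0" for z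
  proof -
    obtain \<epsilon> where \<epsilon>: "\<epsilon> \<longlonglongrightarrow> 0" "eventually (\<lambda>m. \<forall>w. cmod w \<le> cmod z + 1 \<longrightarrow> cmod (F m w) \<le> \<epsilon> m) sequentially"
      using small by blast
    have "eventually (\<lambda>m. norm (deriv (F m) z) \<le> \<epsilon> m) sequentially"
      using \<epsilon>(2)
    proof eventually_elim
      case (elim m)
      have "cmod (deriv (F m) z) \<le> \<epsilon> m / 1"
      proof (rule norm_deriv_le_of_cball[OF holF])
        fix x assume "x \<in> cball z 1"
        then show "cmod (F m x) \<le> \<epsilon> m"
          using elim norm_triangle_ineq2[of x z] by (simp add: dist_norm norm_minus_commute)
      qed auto
      then show ?case by simp
    qed
    then show ?thesis using \<epsilon>(1) by (rule Lim_null_comparison)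
  qed
  have T0: "(\<lambda>m. T (F m) 0) \<longlonglongrightarrow> 0"
    using T tendsto_mult_right_zero[OF lim0[of 0], of "g 0"] integral_op_holomorphic(3)[OF holF g]
    by (auto simp: symbol_operator_def mult_op_def [abs_def])
  have T1: "(\<lambda>m. deriv (T (F m)) z) \<longlonglongrightarrow> 0" for z
    using T unfolding symbol_operator_def
  proof
    assume T: "T = integral_op g"
    show ?thesis
      unfolding T integral_op_holomorphic(2)[OF holF g] by (rule tendsto_mult_left_zero[OF lim1])
  next
    assume T: "T = mult_op g"
    have "deriv (T (F m)) z = g z * deriv (F m) z + deriv g z * F m z" for m
      unfolding T mult_op_def [abs_def] using g holF by (intro deriv_mult) (auto simp: holomorphic_on_def)
    moreover have "(\<lambda>m. g z * deriv (F m) z + deriv g z * F m z) \<longlonglongrightarrow> 0"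
      using tendsto_add[OF tendsto_mult_right_zero[OF lim1] tendsto_mult_right_zero[OF lim0]] by simp
    ultimately show ?thesis by simp
  qed
  \<comment> \<open>Chosen so that an image of norm below \<open>\<delta>\<close> forces
    \<open>cmod (g (a m)) < \<eta>\<close>.\<close>
  define \<delta> where "\<delta> = \<eta> / (2 * C2)"
  have \<delta>: "\<delta> > 0" using \<eta> C2 by (simp add: \<delta>_def)
  obtain m where m: "\<N> p (T (F m)) < \<delta>"
    using compact_operator_small_image[where f = F and M = "C1 * M", OF cpt p _ _ T0 T1 \<delta>] Fp by blast
  have TF: "T (F m) \<in> \<F> p" using cpt Fp unfolding compact_operator_def by blast
  have "t m powr (- e) / 2 \<le> W (F m) (a m)" "t m powr (- e) / 2 \<le> weighted_deriv (F m) (a m)"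
  proof -
    show "t m powr (- e) / 2 \<le> W (F m) (a m)" using peak(2)[of m] by (simp add: WF)
    have "deriv (F m) = (\<lambda>z. complex_of_real (t m powr (- e)) * deriv (f (a m)) z)"
      unfolding F_def [abs_def] using hol by (intro ext deriv_cmult) (auto simp: holomorphic_on_def)
    then have "weighted_deriv (F m) (a m) = t m powr (- e) * weighted_deriv (f (a m)) (a m)"
      by (simp add: weighted_deriv_def weighted_abs_def norm_mult)
    then show "t m powr (- e) / 2 \<le> weighted_deriv (F m) (a m)"
      using mult_left_mono[OF peak(3)[of m], of "t m powr (- e)"] by simp
  qed
  from symbol_operator_jet[OF T g holF this]
  have "t m powr (- e) / 2 * cmod (g (a m)) * t m powr e \<le> weighted_jet (T (F m)) (a m) * t m powr e"
    by (rule mult_right_mono) simp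
  also have "\<dots> \<le> C2 * \<N> p (T (F m))" using jet[OF TF a2, of m] by (simp add: t_def e_def)
  also have "\<dots> < C2 * \<delta>" using m C2 by simp
  also have "\<dots> = \<eta> / 2" using C2 by (simp add: \<delta>_def)
  also have "t m powr (- e) / 2 * cmod (g (a m)) * t m powr e = cmod (g (a m)) / 2 * (t m powr (- e) * t m powr e)"
    by simp
  finally show False using a(2)[of m] by (simp add: tt)
qed

end

section \<open>Test functions spread over rings\<close>

text \<open>On either side of \<open>i\<close> the terms are distinct powers of
  \<open>exp (- d)\<close>, so each side is at most the geometric series.\<close>

lemma sum_exp_neg_dist_le:
  assumes d: "d > 0" and S: "finite S"
  shows "(\<Sum>k\<in>S. exp (- d * \<bar>real k - real i\<bar>)) \<le> 2 / (1 - exp (- d))"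
proof -
  define r where "r = exp (- d)"
  have r: "0 < r" "r < 1" using d by (auto simp: r_def)
  have eq: "exp (- d * real m) = r ^ m" for m     unfolding r_def exp_of_nat_mult[symmetric] by (simp only: mult.commute)
  have geom: "(\<Sum>m\<in>A. r ^ m) \<le> 1 / (1 - r)" if "finite A" for A
  proof -
    have "(\<Sum>m\<in>A. r ^ m) \<le> (\<Sum>m. r ^ m)" using r that by (intro sum_le_suminf) auto
    then show ?thesis using r by (simp add: suminf_geometric)
  qed
  let ?A = "S \<inter> {i..}" and ?B = "S \<inter> {..<i}"
  have "(\<Sum>k\<in>?A. exp (- d * \<bar>real k - real i\<bar>)) = (\<Sum>k\<in>?A. r ^ (k - i))"
    by (intro sum.cong refl) (auto simp: of_nat_diff simp flip: eq)
  also have "\<dots> = (\<Sum>m\<in>(\<lambda>k. k - i) ` ?A. r ^ m)"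
    by (subst sum.reindex) (auto simp: inj_on_def)
  also have "\<dots> \<le> 1 / (1 - r)" using S by (intro geom) auto
  finally have A: "(\<Sum>k\<in>?A. exp (- d * \<bar>real k - real i\<bar>)) \<le> 1 / (1 - r)" .
  have "(\<Sum>k\<in>?B. exp (- d * \<bar>real k - real i\<bar>)) = (\<Sum>k\<in>?B. r ^ (i - k))"
    by (intro sum.cong refl) (auto simp: of_nat_diff simp flip: eq)
  also have "\<dots> = (\<Sum>m\<in>(\<lambda>k. i - k) ` ?B. r ^ m)"
    by (subst sum.reindex) (auto simp: inj_on_def)
  also have "\<dots> \<le> 1 / (1 - r)" using S by (intro geom) auto
  finally have B: "(\<Sum>k\<in>?B. exp (- d * \<bar>real k - real i\<bar>)) \<le> 1 / (1 - r)" .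
  have "S = ?A \<union> ?B" by auto
  then have "(\<Sum>k\<in>S. exp (- d * \<bar>real k - real i\<bar>)) =
      (\<Sum>k\<in>?A. exp (- d * \<bar>real k - real i\<bar>)) + (\<Sum>k\<in>?B. exp (- d * \<bar>real k - real i\<bar>))"
    using S by (subst sum.union_disjoint[symmetric]) auto
  also have "\<dots> \<le> 1 / (1 - r) + 1 / (1 - r)" using A B by (rule add_mono)
  finally show ?thesis by (simp add: r_def)
qed

text \<open>The grid will have steps equal to the local scale; the hypotheses are what one step
  satisfies far out. The factor in \<open>slope_step\<close> is a budget: its exponent is a quarter
  of the rate at which the monomials will be shown to decay per step.\<close>

locale weight_grid = fock_weight +
  fixes X A B c0 :: real
  assumes scale_le_one: "X \<le> x \<Longrightarrow> \<omega> x \<le> 1"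
    and scale_step: "X \<le> x \<Longrightarrow> \<omega> (x + \<omega> x) \<le> 2 * \<omega> x \<and> \<omega> x \<le> 2 * \<omega> (x + \<omega> x)"
    and slope_step: "X \<le> x \<Longrightarrow> 1 / (4 * \<kappa> * \<omega> x) \<le> s (x + \<omega> x) - s x \<and>
                       s (x + \<omega> x) \<le> exp (1 / (64 * \<kappa>)) * s x"
    and slope_ge_2: "X \<le> x \<Longrightarrow> 2 \<le> s x"
    and A_nonneg: "0 \<le> A"
    and c0_pos: "0 < c0"
    and monomial_upper: "exp X \<le> cmod a \<Longrightarrow> z \<noteq> 0 \<Longrightarrow> W (peak_monomial a) z \<le>
       exp (B - G (ln (cmod a)) (ln (cmod z)) / 2 - A * (\<bar>ln (cmod z) - ln (cmod a)\<bar> / \<omega> (ln (cmod a))))"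
    and monomial_lower: "exp X \<le> cmod a \<Longrightarrow> z \<noteq> 0 \<Longrightarrow>
       \<bar>ln (cmod z) - ln (cmod a)\<bar> \<le> \<omega> (ln (cmod a)) \<Longrightarrow> c0 \<le> W (peak_monomial a) z"
begin

abbreviation "\<delta> \<equiv> 1 / (64 * \<kappa>)"

abbreviation gap :: "nat \<Rightarrow> nat \<Rightarrow> real" where
  "gap k i \<equiv> \<bar>real k - real i\<bar>"

primrec grid :: "nat \<Rightarrow> real" where
  "grid 0 = X"
| "grid (Suc i) = grid i + \<omega> (grid i)"

lemma grid_strict_mono: "i < j \<Longrightarrow> grid i < grid j"
  by (rule lift_Suc_mono_less) auto

lemma grid_mono: "i \<le> j \<Longrightarrow> grid i \<le> grid j"
  using grid_strict_mono[of i j] by (cases "i = j") auto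

lemma grid_ge: "X \<le> grid i"
  using grid_mono[of 0 i] by simp

text \<open>A bounded grid would have steps bounded below by the positive minimum of
  \<open>\<omega>\<close> on a compact interval.\<close>

lemma grid_at_top: "filterlim grid at_top sequentially"
proof -
  have unbounded: "\<exists>i. b \<le> grid i" for b
  proof (rule ccontr)
    assume "\<not> ?thesis"
    then have b: "grid i < b" for i by (auto simp: not_le)
    have "continuous_on {X..b} \<omega>"
      using deriv_\<omega> by (meson DERIV_isCont continuous_at_imp_continuous_on)
    moreover have "{X..b} \<noteq> {}" using b[of 0] by simp
    ultimately obtain m where m: "\<And>x. x \<in> {X..b} \<Longrightarrow> \<omega> m \<le> \<omega> x"
      using continuous_attains_inf[OF compact_Icc, of X b \<omega>] by blast
    have "X + real i * \<omega> m \<le> grid i" for i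
    proof (induction i)
      case (Suc i)
      have "\<omega> m \<le> \<omega> (grid i)" using grid_ge[of i] b[of i] by (intro m) auto
      then show ?case using Suc by (simp add: algebra_simps)
    qed simp
    moreover obtain n where "(b - X) / \<omega> m < real n" using reals_Archimedean2 by blast
    ultimately have "b < grid n"
      using \<omega>_pos[of m] by (smt (verit) pos_divide_less_eq)
    then show False using b[of n] by simp
  qed
  show ?thesis
    unfolding filterlim_at_top eventually_sequentially
    using unbounded grid_mono by (meson order_trans)
qed

lemma slope_grid_mono: "i \<le> j \<Longrightarrow> s (grid i) \<le> s (grid j)"
  by (intro slope_mono grid_mono)

text \<open>To the right each step multiplies the slope by at most \<open>exp \<delta>\<close>; to
  the left monotonicity is enough.\<close>

lemma slope_grid_growth: "s (grid k) \<le> exp (\<delta> * gap k i) * s (grid i)"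
proof (cases "k \<le> i")
  case True
  have "1 * s (grid i) \<le> exp (\<delta> * gap k i) * s (grid i)"
    using \<kappa> slope_nonneg by (intro mult_right_mono) auto
  then show ?thesis using slope_grid_mono[OF True] by linarith
next
  case False
  then have "i \<le> k" by simp
  then show ?thesis
  proof (induction k rule: dec_induct)
    case (step n)
    have "s (grid (Suc n)) \<le> exp \<delta> * s (grid n)" using slope_step[OF grid_ge[of n]] by simp
    also have "\<dots> \<le> exp \<delta> * (exp (\<delta> * gap n i) * s (grid i))"
      using step.IH by (intro mult_left_mono) auto
    also have "\<dots> = exp (\<delta> + \<delta> * gap n i) * s (grid i)"
      by (simp only: exp_add mult.assoc)
    also have "\<delta> + \<delta> * gap n i = \<delta> * gap (Suc n) i"
    proof -
      have "gap (Suc n) i = 1 + gap n i" using step.hyps by simp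
      then show ?thesis by (simp add: distrib_left add_divide_distrib)
    qed
    finally show ?case .
  qed simp
qed

text \<open>The slope increment over a step is at least
  \<open>1 / (4 * \<kappa> * \<omega>)\<close>, and a neighbouring step has length at least
  \<open>\<omega> / 2\<close>. The product is the scale-free cost of crossing a ring.\<close>

lemma slope_scale_step: "1 / (8 * \<kappa>) \<le> (s (grid (Suc i)) - s (grid i)) * \<omega> (grid (Suc i))"
  "1 / (8 * \<kappa>) \<le> (s (grid (Suc (Suc i))) - s (grid (Suc i))) * \<omega> (grid i)"
proof -
  have "1 / (8 * \<kappa>) = 1 / (4 * \<kappa> * \<omega> (grid i)) * (\<omega> (grid i) / 2)" by simp
  also have "\<dots> \<le> (s (grid (Suc i)) - s (grid i)) * \<omega> (grid (Suc i))"
    using slope_step[OF grid_ge[of i]] scale_step[OF grid_ge[of i]] slope_mono[of "grid i" "grid (Suc i)"] \<kappa>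
    by (intro mult_mono) auto
  finally show "1 / (8 * \<kappa>) \<le> (s (grid (Suc i)) - s (grid i)) * \<omega> (grid (Suc i))" .
  have "1 / (8 * \<kappa>) = 1 / (4 * \<kappa> * \<omega> (grid (Suc i))) * (\<omega> (grid (Suc i)) / 2)" by (simp del: grid.simps)
  also have "\<dots> \<le> (s (grid (Suc (Suc i))) - s (grid (Suc i))) * \<omega> (grid i)"
    using slope_step[OF grid_ge[of "Suc i"]] scale_step[OF grid_ge[of i]]
      slope_mono[of "grid (Suc i)" "grid (Suc (Suc i))"] \<kappa>
    by (intro mult_mono) (simp_all add: less_imp_le)
  finally show "1 / (8 * \<kappa>) \<le> (s (grid (Suc (Suc i))) - s (grid (Suc i))) * \<omega> (grid i)" .
qed

text \<open>Every step adds slope excess times step length to the remainder, at least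
  \<open>1 / (8 * \<kappa>)\<close>. On the first step the excess is still 0, hence the
  \<open>- 1\<close>.\<close>

lemma remainder_grid_right:
  assumes "k \<le> j"
  shows "(real j - real k - 1) / (8 * \<kappa>) \<le> G (grid k) (grid j)"
  using assms
proof (induction j rule: dec_induct)
  case base
  have "(real k - real k - 1) / (8 * \<kappa>) \<le> 0" using \<kappa> by (simp add: divide_le_0_iff)
  then show ?case using remainder_nonneg[of "grid k" "grid k"] by linarith
next
  case (step j)
  show ?case
  proof (cases "j = k")
    case True
    then show ?thesis using remainder_nonneg[of "grid k" "grid (Suc j)"] by simp
  next
    case False
    then obtain i where i: "j = Suc i" "k \<le> i" using step.hyps by (cases j) auto
    have "1 / (8 * \<kappa>) \<le> (s (grid j) - s (grid i)) * \<omega> (grid j)" using slope_scale_step(1)[of i] i by simp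
    also have "\<dots> \<le> (s (grid j) - s (grid k)) * (grid (Suc j) - grid j)"
      using slope_grid_mono[OF i(2)] by (auto intro!: mult_right_mono)
    finally have "1 / (8 * \<kappa>) \<le> (s (grid j) - s (grid k)) * (grid (Suc j) - grid j)" .
    moreover have "(real (Suc j) - real k - 1) / (8 * \<kappa>) = (real j - real k - 1) / (8 * \<kappa>) + 1 / (8 * \<kappa>)"
      by (simp add: add_divide_distrib[symmetric])
    ultimately show ?thesis
      using step.IH remainder_shift_ge[of "grid k" "grid j" "grid (Suc j)"] by linarith
  qed
qed

text \<open>Going left, the slope excess stems from the step to the right of the one being crossed;
  the second bound of \<open>slope_scale_step\<close> pairs that increment with the length on its
  left.\<close>

lemma remainder_grid_left:
  assumes "j \<le> k"
  shows "(real k - real j - 1) / (8 * \<kappa>) \<le> G (grid k) (grid j)"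
  using assms
proof (induction j rule: inc_induct)
  case base
  have "(real k - real k - 1) / (8 * \<kappa>) \<le> 0" using \<kappa> by (simp add: divide_le_0_iff)
  then show ?case using remainder_nonneg[of "grid k" "grid k"] by linarith
next
  case (step j)
  show ?case
  proof (cases "Suc j = k")
    case True
    then have "real k - real j - 1 = 0" by auto
    then show ?thesis using remainder_nonneg[of "grid k" "grid j"] by simp
  next
    case False
    then have k: "Suc (Suc j) \<le> k" using step.hyps by simp
    have "1 / (8 * \<kappa>) \<le> (s (grid (Suc (Suc j))) - s (grid (Suc j))) * \<omega> (grid j)" by (rule slope_scale_step)
    also have "\<dots> \<le> (s (grid k) - s (grid (Suc j))) * \<omega> (grid j)"
      using slope_grid_mono[OF k] by (intro mult_right_mono) auto
    also have "\<dots> = (s (grid (Suc j)) - s (grid k)) * (grid j - grid (Suc j))" by (simp add: algebra_simps)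
    finally have "1 / (8 * \<kappa>) \<le> (s (grid (Suc j)) - s (grid k)) * (grid j - grid (Suc j))" .
    moreover have "(real k - real j - 1) / (8 * \<kappa>) = (real k - real (Suc j) - 1) / (8 * \<kappa>) + 1 / (8 * \<kappa>)"
      by (simp add: add_divide_distrib[symmetric])
    ultimately show ?thesis
      using step.IH remainder_shift_ge[of "grid k" "grid (Suc j)" "grid j"] by linarith
  qed
qed

text \<open>Cell 0 has no left end, so the cells cover the whole line, including what lies below the
  start of the grid.\<close>

definition grid_cell :: "nat \<Rightarrow> real \<Rightarrow> bool" where
  "grid_cell i x \<longleftrightarrow> (i = 0 \<or> grid i \<le> x) \<and> x < grid (Suc i)"

lemma grid_cell_exists: "\<exists>i. grid_cell i x"
proof -
  have ex: "\<exists>i. x < grid (Suc i)"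
  proof -
    have "eventually (\<lambda>i. x + 1 \<le> grid i) sequentially"
      using grid_at_top by (simp add: filterlim_at_top)
    then obtain N where N: "x + 1 \<le> grid N" by (auto simp: eventually_sequentially)
    then have "x < grid (Suc N)" using grid_mono[of N "Suc N"] by linarith
    then show ?thesis by blast
  qed
  define i where "i = (LEAST i. x < grid (Suc i))"
  have "x < grid (Suc i)" unfolding i_def using ex by (rule LeastI_ex)
  moreover have "i = 0 \<or> grid i \<le> x"
  proof (cases i)
    case (Suc j)
    then have "\<not> x < grid (Suc j)" unfolding i_def by (intro not_less_Least) simp
    then show ?thesis using Suc by simp
  qed simp
  ultimately show ?thesis by (auto simp: grid_cell_def)
qed

text \<open>The remainder at \<open>x\<close> is at least that at the cell end facing
  \<open>grid k\<close>, which may be one step closer; together with the idle first step this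
  accounts for the 2.\<close>

lemma remainder_cell:
  assumes "grid_cell i x"
  shows "(gap k i - 2) / (8 * \<kappa>) \<le> G (grid k) x"
proof -
  have x: "i = 0 \<or> grid i \<le> x" "x < grid (Suc i)" using assms by (auto simp: grid_cell_def)
  consider "k \<le> i" "grid i \<le> x" | "k = 0" "i = 0" | "i < k" using x by fastforce
  then show ?thesis
  proof cases
    case 1
    have "0 \<le> (s (grid i) - s (grid k)) * (x - grid i)"
      using slope_grid_mono[OF 1(1)] 1(2) by simp
    then have "(real i - real k - 1) / (8 * \<kappa>) \<le> G (grid k) x"
      using remainder_grid_right[OF 1(1)] remainder_shift_ge[of "grid k" "grid i" x] by linarith
    moreover have "(gap k i - 2) / (8 * \<kappa>) \<le> (real i - real k - 1) / (8 * \<kappa>)"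
      using 1 \<kappa> by (intro divide_right_mono) auto
    ultimately show ?thesis by linarith
  next
    case 2
    have "(gap k i - 2) / (8 * \<kappa>) \<le> 0" using 2 \<kappa> by (simp add: divide_le_0_iff)
    then show ?thesis using remainder_nonneg[of "grid k" x] by linarith
  next
    case 3
    have "0 \<le> (s (grid (Suc i)) - s (grid k)) * (x - grid (Suc i))"
      using slope_grid_mono[of "Suc i" k] 3 x(2) by (intro mult_nonpos_nonpos) auto
    then have "(real k - real (Suc i) - 1) / (8 * \<kappa>) \<le> G (grid k) x"
      using remainder_grid_left[of "Suc i" k] 3 remainder_shift_ge[of "grid k" "grid (Suc i)" x] by linarith
    moreover have "gap k i - 2 = real k - real (Suc i) - 1" using 3 by simp
    ultimately show ?thesis by simp
  qed
qed

section \<open>Sums of monomials over the rings\<close>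

definition ring_monomial :: "nat \<Rightarrow> complex \<Rightarrow> complex" where
  "ring_monomial k = peak_monomial (of_real (exp (grid k)))"

definition ring_degree :: "nat \<Rightarrow> nat" where
  "ring_degree k = peak_degree (grid k)"

lemma ring_monomial_holomorphic [holomorphic_intros]: "ring_monomial k holomorphic_on S"
  unfolding ring_monomial_def by (rule peak_monomial_holomorphic)

lemma ring_degree_bounds: "s (grid k) / 2 \<le> real (ring_degree k)" "real (ring_degree k) \<le> s (grid k)"
  using peak_degree[of "grid k"] slope_ge_2[OF grid_ge[of k]] by (auto simp: ring_degree_def)

lemma ring_degree_pos: "0 < ring_degree k"
  using ring_degree_bounds(1)[of k] slope_ge_2[OF grid_ge[of k]] by linarith

text \<open>Through z d/dz the derivative of a sum over rings becomes the same sum weighted by the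
  degrees.\<close>

lemma ring_monomial_deriv: "z * deriv (ring_monomial k) z = of_nat (ring_degree k) * ring_monomial k z"
proof -
  define a where "a = complex_of_real (exp (grid k))"
  have "((\<lambda>z. z / a) has_field_derivative 1 / a) (at z)"
    by (intro DERIV_cdivide DERIV_ident)
  from DERIV_cmult[OF DERIV_power[OF this, of "ring_degree k"], of "of_real (exp (\<psi> (cmod a)))"]
  have "(ring_monomial k has_field_derivative
    of_real (exp (\<psi> (cmod a))) * (of_nat (ring_degree k) * (1 / a * (z / a) ^ (ring_degree k - Suc 0)))) (at z)"
    unfolding ring_monomial_def peak_monomial_def [abs_def] ring_degree_def a_def by simp
  then have "deriv (ring_monomial k) z =
    of_real (exp (\<psi> (cmod a))) * (of_nat (ring_degree k) * (1 / a * (z / a) ^ (ring_degree k - Suc 0)))"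
    by (rule DERIV_imp_deriv)
  moreover have "(z / a) ^ ring_degree k = (z / a) * (z / a) ^ (ring_degree k - Suc 0)"
    using ring_degree_pos[of k] by (metis One_nat_def power_minus_mult mult.commute)
  ultimately show ?thesis
    by (simp add: ring_monomial_def peak_monomial_def ring_degree_def a_def)
qed

lemma weighted_ring_monomial_zero: "W (ring_monomial k) 0 = 0"
  using ring_degree_pos[of k] by (simp add: weighted_abs_def ring_monomial_def peak_monomial_def ring_degree_def)

text \<open>Half the remainder turns into decay in grid steps:
  \<open>(gap k i - 2) / (8 * \<kappa>) / 2\<close> is \<open>4 * \<delta> * gap k i\<close> minus a
  constant at most 1, hence \<open>B + 1\<close>. The rate \<open>A\<close>, weakened by
  \<open>\<omega> \<le> 1\<close>, survives as decay in the logarithmic distance.\<close>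

lemma weighted_ring_monomial_upper:
  assumes z: "z \<noteq> 0" and i: "grid_cell i (ln (cmod z))"
  shows "W (ring_monomial k) z \<le>
    exp (B + 1) * exp (- (4 * \<delta>) * gap k i) * exp (- A * \<bar>ln (cmod z) - grid k\<bar>)"
proof -
  let ?x = "ln (cmod z)"
  have "W (ring_monomial k) z \<le> exp (B - G (grid k) ?x / 2 - A * (\<bar>?x - grid k\<bar> / \<omega> (grid k)))"
    using monomial_upper[of "of_real (exp (grid k))" z] z grid_ge[of k] by (simp add: ring_monomial_def)
  also have "\<dots> \<le> exp (B + 1 - (4 * \<delta>) * gap k i - A * \<bar>?x - grid k\<bar>)"
  proof -
    have "\<bar>?x - grid k\<bar> \<le> \<bar>?x - grid k\<bar> / \<omega> (grid k)"
      using scale_le_one[OF grid_ge[of k]] by (simp add: field_simps mult_left_le_one_le)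
    then have "A * \<bar>?x - grid k\<bar> \<le> A * (\<bar>?x - grid k\<bar> / \<omega> (grid k))" using A_nonneg by (rule mult_left_mono)
    moreover have "(4 * \<delta>) * gap k i - 1 \<le> G (grid k) ?x / 2"
    proof -
      have "(4 * \<delta>) * gap k i - 1 \<le> (gap k i - 2) / (8 * \<kappa>) / 2"
        using \<kappa> by (simp add: field_simps)
      also have "\<dots> \<le> G (grid k) ?x / 2" using remainder_cell[OF i, of k] by (intro divide_right_mono) auto
      finally show ?thesis .
    qed
    ultimately show ?thesis by simp
  qed
  also have "\<dots> = exp (B + 1) * exp (- (4 * \<delta>) * gap k i) * exp (- A * \<bar>?x - grid k\<bar>)"
    by (simp flip: exp_add)
  finally show ?thesis .
qed

definition ring_sum :: "nat set \<Rightarrow> complex \<Rightarrow> complex" where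
  "ring_sum S z = (\<Sum>k\<in>S. ring_monomial k z)"

lemma ring_sum_holomorphic: "ring_sum S holomorphic_on UNIV"
  unfolding ring_sum_def [abs_def] by (intro holomorphic_intros)

lemma weighted_sum_le: "W (\<lambda>z. \<Sum>k\<in>S. h k z) z \<le> (\<Sum>k\<in>S. W (h k) z)"
  unfolding weighted_abs_def sum_distrib_right[symmetric] by (intro mult_right_mono norm_sum) auto

definition ring_bound :: real where
  "ring_bound = exp (B + 1) * (2 / (1 - exp (- (4 * \<delta>))))"

lemma ring_bound_pos: "0 < ring_bound"
  using \<kappa> by (simp add: ring_bound_def)

text \<open>The decay in grid steps sums to a geometric series uniformly in \<open>S\<close>; the
  decay beyond the last ring is common to all terms and factors out.\<close>

lemma weighted_ring_sum_upper:
  assumes S: "S \<subseteq> {..N}" and z: "z \<noteq> 0"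
  shows "W (ring_sum S) z \<le> ring_bound * exp (- A * max 0 (ln (cmod z) - grid N))"
proof -
  obtain i where i: "grid_cell i (ln (cmod z))" using grid_cell_exists by blast
  have S': "finite S" using S finite_subset by blast
  let ?e = "exp (- A * max 0 (ln (cmod z) - grid N))"
  have "W (ring_sum S) z \<le> (\<Sum>k\<in>S. W (ring_monomial k) z)"
    unfolding ring_sum_def [abs_def] by (rule weighted_sum_le)
  also have "\<dots> \<le> (\<Sum>k\<in>S. exp (B + 1) * ?e * exp (- (4 * \<delta>) * gap k i))"
  proof (rule sum_mono)
    fix k assume "k \<in> S"
    then have "grid k \<le> grid N" using S by (intro grid_mono) auto
    then have "max 0 (ln (cmod z) - grid N) \<le> \<bar>ln (cmod z) - grid k\<bar>" by linarith
    then have "exp (- A * \<bar>ln (cmod z) - grid k\<bar>) \<le> ?e" using A_nonneg by (simp add: mult_left_mono)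
    then have "exp (B + 1) * exp (- (4 * \<delta>) * gap k i) * exp (- A * \<bar>ln (cmod z) - grid k\<bar>)
       \<le> exp (B + 1) * exp (- (4 * \<delta>) * gap k i) * ?e"
      by (intro mult_left_mono) auto
    then show "W (ring_monomial k) z \<le> exp (B + 1) * ?e * exp (- (4 * \<delta>) * gap k i)"
      using weighted_ring_monomial_upper[OF z i, of k] by (simp only: mult_ac)
  qed
  also have "\<dots> = exp (B + 1) * ?e * (\<Sum>k\<in>S. exp (- (4 * \<delta>) * gap k i))"
    by (rule sum_distrib_left[symmetric])
  also have "\<dots> \<le> exp (B + 1) * ?e * (2 / (1 - exp (- (4 * \<delta>))))"
    using \<kappa> by (intro mult_left_mono sum_exp_neg_dist_le S') auto
  finally show ?thesis by (simp add: ring_bound_def mult_ac)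
qed

text \<open>On ring \<open>i\<close> the term \<open>i\<close> is at least \<open>w i * c0\<close>,
  and the remaining ones add up to at most half of that when their gaps are at least
  \<open>J\<close>. The weights allow for two uses: 1 for the sum itself, the degrees for its
  derivative.\<close>

lemma weighted_ring_sum_lower:
  assumes J: "exp (B + 1) * 2 * exp (- \<delta> * real J) * (2 / (1 - exp (- \<delta>))) \<le> c0 / 2"
    and S: "finite S" "i \<in> S" "\<And>k. k \<in> S \<Longrightarrow> k \<noteq> i \<Longrightarrow> real J \<le> gap k i"
    and z: "z \<noteq> 0" and i: "grid i \<le> ln (cmod z)" "ln (cmod z) < grid (Suc i)"
    and w: "\<And>k. 0 \<le> w k" "\<And>k. w k \<le> 2 * w i * exp (\<delta> * gap k i)"
  shows "w i * c0 / 2 \<le> W (\<lambda>z. \<Sum>k\<in>S. of_real (w k) * ring_monomial k z) z"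
proof -
  have \<delta>: "\<delta> > 0" using \<kappa> by simp
  have cell: "grid_cell i (ln (cmod z))" using i by (simp add: grid_cell_def)
  have main: "c0 \<le> W (ring_monomial i) z"
    using monomial_lower[of "of_real (exp (grid i))" z] z i grid_ge[of i] by (simp add: ring_monomial_def)
  have term_le: "w k * W (ring_monomial k) z \<le>
      exp (B + 1) * 2 * exp (- \<delta> * real J) * w i * exp (- \<delta> * gap k i)" if k: "k \<in> S - {i}" for k
  proof -
    let ?d = "gap k i"
    have "W (ring_monomial k) z \<le> exp (B + 1) * exp (- (4 * \<delta>) * ?d) * exp (- A * \<bar>ln (cmod z) - grid k\<bar>)"
      using weighted_ring_monomial_upper[OF z cell, of k] by simp
    also have "\<dots> \<le> exp (B + 1) * exp (- (4 * \<delta>) * ?d) * 1"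
      using A_nonneg by (intro mult_left_mono) auto
    finally have "w k * W (ring_monomial k) z \<le> (2 * w i * exp (\<delta> * ?d)) * (exp (B + 1) * exp (- (4 * \<delta>) * ?d))"
      using w(1)[of k] w(2)[of k] w(1)[of i] by (intro mult_mono) auto
    \<comment> \<open>Decay \<open>4 * \<delta>\<close> against growth \<open>\<delta>\<close> of
      the weights leaves \<open>3 * \<delta>\<close>; one \<open>\<delta>\<close> becomes the gain
      \<open>exp (- \<delta> * real J)\<close>, another makes the series converge.\<close>
    also have "\<dots> = (exp (B + 1) * 2 * w i) * exp (- (3 * \<delta>) * ?d)"
      by (simp add: algebra_simps flip: exp_add)
    also have "\<dots> \<le> (exp (B + 1) * 2 * w i) * exp (- \<delta> * real J + - \<delta> * ?d)"
    proof (rule mult_left_mono)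
      have "\<delta> * real J \<le> \<delta> * ?d" using S(3)[of k] k \<delta> by (intro mult_left_mono) auto
      moreover have "0 \<le> \<delta> * ?d" using \<delta> by simp
      ultimately show "exp (- (3 * \<delta>) * ?d) \<le> exp (- \<delta> * real J + - \<delta> * ?d)" by simp
    qed (use w(1) in simp)
    also have "\<dots> = exp (B + 1) * 2 * exp (- \<delta> * real J) * w i * exp (- \<delta> * ?d)"
      unfolding exp_add by (simp only: mult_ac)
    finally show ?thesis .
  qed
  have "(\<Sum>k\<in>S - {i}. w k * W (ring_monomial k) z)
      \<le> (\<Sum>k\<in>S - {i}. exp (B + 1) * 2 * exp (- \<delta> * real J) * w i * exp (- \<delta> * gap k i))"
    using term_le by (rule sum_mono)
  also have "\<dots> = exp (B + 1) * 2 * exp (- \<delta> * real J) * w i * (\<Sum>k\<in>S - {i}. exp (- \<delta> * gap k i))"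
    by (rule sum_distrib_left[symmetric])
  also have "\<dots> \<le> exp (B + 1) * 2 * exp (- \<delta> * real J) * w i * (2 / (1 - exp (- \<delta>)))"
    using S(1) w(1) \<delta> by (intro mult_left_mono sum_exp_neg_dist_le) auto
  also have "\<dots> = w i * (exp (B + 1) * 2 * exp (- \<delta> * real J) * (2 / (1 - exp (- \<delta>))))" by simp
  also have "\<dots> \<le> w i * (c0 / 2)" using J w(1) by (intro mult_left_mono) auto
  finally have rest: "(\<Sum>k\<in>S - {i}. w k * W (ring_monomial k) z) \<le> w i * (c0 / 2)" .
  define P where "P = (\<Sum>k\<in>S. of_real (w k) * ring_monomial k z)"
  define R where "R = (\<Sum>k\<in>S - {i}. of_real (w k) * ring_monomial k z)"
  have PR: "P = of_real (w i) * ring_monomial i z + R"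
    unfolding P_def R_def using S by (simp add: sum.remove)
  let ?E = "exp (- \<psi> (cmod z))"
  have "cmod R * ?E \<le> (\<Sum>k\<in>S - {i}. cmod (of_real (w k) * ring_monomial k z)) * ?E"
    unfolding R_def by (intro mult_right_mono norm_sum) auto
  also have "\<dots> = (\<Sum>k\<in>S - {i}. w k * W (ring_monomial k) z)"
    unfolding sum_distrib_right using w(1) by (simp add: norm_mult weighted_abs_def mult.assoc)
  finally have "cmod R * ?E \<le> w i * (c0 / 2)" using rest by linarith
  moreover have "w i * c0 \<le> cmod (of_real (w i) * ring_monomial i z) * ?E"
    using main w(1)[of i] by (simp add: norm_mult weighted_abs_def mult_left_mono mult.assoc)
  moreover have "cmod (of_real (w i) * ring_monomial i z) * ?E \<le> (cmod P + cmod R) * ?E"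
    using norm_triangle_ineq4[of P R] by (intro mult_right_mono) (auto simp: PR)
  ultimately have "w i * c0 / 2 \<le> cmod P * ?E" by (simp add: distrib_right)
  then show ?thesis by (simp add: weighted_abs_def P_def)
qed

text \<open>A point of the annulus lies in some ring \<open>i\<close>, and the sum over the class of
  \<open>i\<close> modulo \<open>J\<close> is large there because its other rings are at least
  \<open>J\<close> steps away. The number \<open>J\<close> of functions does not depend on
  \<open>N\<close>.\<close>

lemma ring_functions:
  assumes "A = real m"
  shows "\<exists>f x M c. \<exists>J::nat. 0 < M \<and> 0 < c \<and> filterlim x at_top sequentially \<and>
     (\<forall>N j. decay_bound (f N j) 0 (exp (x N)) M m) \<and>
     (\<forall>N z. exp (x 0) \<le> cmod z \<and> cmod z < exp (x N) \<longrightarrow>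
        (\<exists>j<J. c \<le> W (f N j) z \<and> c \<le> weighted_deriv (f N j) z))"
proof -
  have \<delta>: "\<delta> > 0" using \<kappa> by simp
  have "((\<lambda>J. exp (B + 1) * 2 * exp (- \<delta> * real J) * (2 / (1 - exp (- \<delta>)))) \<longlonglongrightarrow> exp (B + 1) * 2 * 0 * (2 / (1 - exp (- \<delta>))))"
  proof (intro tendsto_intros)
    have "filterlim (\<lambda>J. - \<delta> * real J) at_bot sequentially"
      using \<delta> by (intro filterlim_tendsto_neg_mult_at_bot[OF tendsto_const] filterlim_real_sequentially) auto
    then show "(\<lambda>J. exp (- \<delta> * real J)) \<longlonglongrightarrow> 0" by (rule filterlim_compose[OF exp_at_bot])
  qed
  then have "eventually (\<lambda>J. exp (B + 1) * 2 * exp (- \<delta> * real J) * (2 / (1 - exp (- \<delta>))) < c0 / 2) sequentially"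
    using c0_pos by (intro order_tendstoD(2)) auto
  with eventually_ge_at_top[of 1]
  have "eventually (\<lambda>J. 1 \<le> J \<and> exp (B + 1) * 2 * exp (- \<delta> * real J) * (2 / (1 - exp (- \<delta>))) < c0 / 2) sequentially"
    by (rule eventually_conj)
  then obtain J :: nat where J: "J \<ge> 1"
    "exp (B + 1) * 2 * exp (- \<delta> * real J) * (2 / (1 - exp (- \<delta>))) < c0 / 2"
    by (auto simp: eventually_sequentially)
  define S where "S N j = {k. k \<le> N \<and> k mod J = j}" for N j
  \<comment> \<open>Dictated by the derivative: the lower bound \<open>w i * c0 / 2\<close> is
    divided by the slope, which on ring \<open>i\<close> is at most
    \<open>exp \<delta> * (2 * w i)\<close>.\<close>
  define c where "c = c0 / (4 * exp \<delta>)"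
  have "1 \<le> exp \<delta>" using \<delta> by simp
  then have "2 \<le> 4 * exp \<delta>" by linarith
  then have c_le: "c \<le> c0 / 2" unfolding c_def using c0_pos by (intro divide_left_mono) auto
  show ?thesis
  proof (rule exI[of _ "\<lambda>N j. ring_sum (S N j)"], rule exI[of _ grid], rule exI[of _ ring_bound],
      rule exI[of _ c], rule exI[of _ J], intro conjI allI impI)
    show "0 < ring_bound" by (rule ring_bound_pos)
    show "0 < c" using c0_pos by (simp add: c_def)
    show "filterlim grid at_top sequentially" by (rule grid_at_top)
  next
    fix N j
    have SN: "S N j \<subseteq> {..N}" by (auto simp: S_def)
    have "W (ring_sum (S N j)) z \<le> ring_bound \<and> cmod z ^ m * W (ring_sum (S N j)) z \<le> ring_bound * exp (grid N) ^ m" for z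
    proof (cases "z = 0")
      case True
      have "W (ring_sum (S N j)) z \<le> (\<Sum>k\<in>S N j. W (ring_monomial k) z)"
        unfolding ring_sum_def [abs_def] by (rule weighted_sum_le)
      then have "W (ring_sum (S N j)) z \<le> 0" by (simp add: True weighted_ring_monomial_zero)
      then have "W (ring_sum (S N j)) z = 0" using weighted_abs_nonneg[of \<psi> "ring_sum (S N j)" z] by linarith
      then show ?thesis using ring_bound_pos by simp
    next
      case False
      define y where "y = ln (cmod z)"
      have zy: "cmod z = exp y" using False by (simp add: y_def)
      have up: "W (ring_sum (S N j)) z \<le> ring_bound * exp (- A * max 0 (y - grid N))"
        using weighted_ring_sum_upper[OF SN False] by (simp add: y_def)
      have "ring_bound * exp (- A * max 0 (y - grid N)) \<le> ring_bound * 1"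
        using ring_bound_pos A_nonneg by (intro mult_left_mono) auto
      then have 1: "W (ring_sum (S N j)) z \<le> ring_bound" using up by linarith
      have "cmod z ^ m * W (ring_sum (S N j)) z \<le> exp (real m * y) * (ring_bound * exp (- A * max 0 (y - grid N)))"
        using up by (simp add: zy exp_of_nat_mult)
      \<comment> \<open>With \<open>A = real m\<close> the decay beyond the last ring compensates
        \<open>cmod z ^ m\<close>: the difference \<open>y - max 0 (y - grid N)\<close> is the
        minimum of \<open>y\<close> and \<open>grid N\<close>.\<close>
      also have "\<dots> = ring_bound * exp (real m * (y - max 0 (y - grid N)))"
        by (simp add: assms algebra_simps flip: exp_add)
      also have "\<dots> \<le> ring_bound * exp (real m * grid N)"
        using ring_bound_pos by (intro mult_left_mono) (auto intro!: mult_left_mono)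
      finally have "cmod z ^ m * W (ring_sum (S N j)) z \<le> ring_bound * exp (grid N) ^ m"
        by (simp add: exp_of_nat_mult)
      with 1 show ?thesis by simp
    qed
    then show "decay_bound (ring_sum (S N j)) 0 (exp (grid N)) ring_bound m"
      by (simp add: decay_bound_def ring_sum_holomorphic)
  next
    fix N z assume z: "exp (grid 0) \<le> cmod z \<and> cmod z < exp (grid N)"
    define y where "y = ln (cmod z)"
    have z0: "z \<noteq> 0" and y0: "grid 0 \<le> y" using ln_norm_ge[of "grid 0" z] z by (auto simp: y_def)
    have "exp y < exp (grid N)" using z z0 by (simp add: y_def)
    then have yN: "y < grid N" by simp
    obtain i where i: "grid_cell i y" using grid_cell_exists by blast
    then have yi: "grid i \<le> y" "y < grid (Suc i)" using y0 by (auto simp: grid_cell_def)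
    have iN: "i < N" using yi(1) yN grid_mono[of N i] by (cases "i < N") auto
    define j where "j = i mod J"
    have jJ: "j < J" using J by (simp add: j_def)
    have Sf: "finite (S N j)" by (simp add: S_def)
    have iS: "i \<in> S N j" using iN by (simp add: S_def j_def)
    have J_le: "real J \<le> gap k i" if k: "k \<in> S N j" "k \<noteq> i" for k
    proof -
      have "k mod J = i mod J" using k by (simp add: S_def j_def)
      then have "int J dvd int k - int i" by (metis mod_eq_dvd_iff zmod_int)
      then have "\<bar>int J\<bar> \<le> \<bar>int k - int i\<bar>" using k(2) by (intro dvd_imp_le_int) auto
      then have "int J \<le> \<bar>int k - int i\<bar>" by simp
      then have "real_of_int (int J) \<le> real_of_int \<bar>int k - int i\<bar>" by (simp only: of_int_le_iff)
      then show ?thesis by simp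
    qed
    have Jle: "exp (B + 1) * 2 * exp (- \<delta> * real J) * (2 / (1 - exp (- \<delta>))) \<le> c0 / 2"
      using J(2) by simp
    note low = weighted_ring_sum_lower[OF Jle Sf iS J_le z0 yi[unfolded y_def]]
    have "1 * c0 / 2 \<le> W (\<lambda>z. \<Sum>k\<in>S N j. of_real 1 * ring_monomial k z) z"
    proof (rule low)
      fix k
      have "1 \<le> exp (\<delta> * gap k i)" using \<kappa> by simp
      then show "1 \<le> 2 * 1 * exp (\<delta> * gap k i)" by linarith
    qed auto
    then have "c0 / 2 \<le> W (ring_sum (S N j)) z" by (simp add: ring_sum_def [abs_def])
    moreover have "c \<le> weighted_deriv (ring_sum (S N j)) z"
    proof -
      define w where "w k = real (ring_degree k)" for k
      have "w i * c0 / 2 \<le> W (\<lambda>z. \<Sum>k\<in>S N j. of_real (w k) * ring_monomial k z) z"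
      proof (rule low)
        fix k
        have "w k \<le> exp (\<delta> * gap k i) * s (grid i)"
          using ring_degree_bounds(2)[of k] slope_grid_growth[of k i] by (simp add: w_def)
        also have "\<dots> \<le> exp (\<delta> * gap k i) * (2 * w i)"
          using ring_degree_bounds(1)[of i] by (intro mult_left_mono) (auto simp: w_def)
        finally show "w k \<le> 2 * w i * exp (\<delta> * gap k i)" by (simp add: mult_ac)
      qed (simp_all add: w_def)
      also have "W (\<lambda>z. \<Sum>k\<in>S N j. of_real (w k) * ring_monomial k z) z = W (\<lambda>z. z * deriv (ring_sum (S N j)) z) z"
      proof -
        have "deriv (ring_sum (S N j)) z = (\<Sum>k\<in>S N j. deriv (ring_monomial k) z)"
        proof (rule DERIV_imp_deriv)
          show "(ring_sum (S N j) has_field_derivative (\<Sum>k\<in>S N j. deriv (ring_monomial k) z)) (at z)"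
            unfolding ring_sum_def [abs_def]
            by (intro DERIV_sum holomorphic_derivI[OF ring_monomial_holomorphic open_UNIV]) auto
        qed
        then have "z * deriv (ring_sum (S N j)) z = (\<Sum>k\<in>S N j. of_nat (ring_degree k) * ring_monomial k z)"
          by (simp add: sum_distrib_left ring_monomial_deriv)
        then show ?thesis by (simp add: weighted_abs_def w_def)
      qed
      finally have lowd: "w i * c0 / 2 \<le> W (\<lambda>z. z * deriv (ring_sum (S N j)) z) z" .
      have "s y \<le> s (grid (Suc i))" using yi by (intro slope_mono) simp
      also have "\<dots> \<le> exp \<delta> * s (grid i)" using slope_step[OF grid_ge[of i]] by simp
      also have "\<dots> \<le> exp \<delta> * (2 * w i)" using ring_degree_bounds(1)[of i] by (simp add: w_def)
      finally have sy: "s y \<le> exp \<delta> * (2 * w i)" .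
      have s0: "s y > 0" using slope_ge_2[of y] y0 by simp
      have "c * s y \<le> c * (exp \<delta> * (2 * w i))" using sy c0_pos by (intro mult_left_mono) (auto simp: c_def)
      also have "\<dots> = w i * c0 / 2" by (simp add: c_def)
      finally have "c * s y \<le> W (\<lambda>z. z * deriv (ring_sum (S N j)) z) z" using lowd by linarith
      then show ?thesis using s0 by (simp add: weighted_deriv_def y_def field_simps)
    qed
    ultimately show "\<exists>j<J. c \<le> W (ring_sum (S N j)) z \<and> c \<le> weighted_deriv (ring_sum (S N j)) z"
      using jJ c_le by (intro exI[of _ j]) auto
  qed
qed

end

section \<open>Operators into a space with a smaller exponent\<close>

context fock_weight
begin

lemma ring_functions_exist:
  "\<exists>f x M c. \<exists>J::nat. 0 < M \<and> 0 < c \<and> filterlim x at_top sequentially \<and>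
     (\<forall>N j. decay_bound (f N j) 0 (exp (x N)) M m) \<and>
     (\<forall>N z. exp (x 0) \<le> cmod z \<and> cmod z < exp (x N) \<longrightarrow>
        (\<exists>j<J. c \<le> W (f N j) z \<and> c \<le> weighted_deriv (f N j) z))"
proof -
  obtain X1 where X1: "X1 \<ge> 0" "\<And>x. x \<ge> X1 \<Longrightarrow> \<omega> x \<le> 1"
    "\<And>x0 x. x0 \<ge> X1 \<Longrightarrow> \<bar>x - x0\<bar> \<le> 1 * \<omega> x0 \<Longrightarrow> 0 \<le> x \<and> \<omega> x0 / 2 \<le> \<omega> x \<and> \<omega> x \<le> 2 * \<omega> x0"
    using slowly_varying[of 1] by blast
  obtain X2 where X2: "X2 \<ge> 0"
    "\<And>x0 x y. x0 \<ge> X2 \<Longrightarrow> \<bar>x - x0\<bar> \<le> 1 * \<omega> x0 \<Longrightarrow> \<bar>y - x0\<bar> \<le> 1 * \<omega> x0 \<Longrightarrow> x \<le> y \<Longrightarrow>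
       (y - x) / (4 * \<kappa> * (\<omega> x0)\<^sup>2) \<le> s y - s x \<and> s y - s x \<le> 4 * \<kappa> * (y - x) / (\<omega> x0)\<^sup>2"
    using slope_increment[of 1] by blast
  \<comment> \<open>The relative growth of the slope allowed per step. A slope of at least
    \<open>4 * \<kappa> / \<delta> / \<omega> x\<close> makes the increment
    \<open>4 * \<kappa> / \<omega> x\<close> at most \<open>\<delta> * s x\<close>; the 2 in the
    maximum below yields a slope of at least 2.\<close>
  define \<delta> where "\<delta> = exp (1 / (64 * \<kappa>)) - 1"
  have \<delta>: "\<delta> > 0" using \<kappa> by (simp add: \<delta>_def)
  obtain X3 where X3: "X3 \<ge> 0" "\<And>x. x \<ge> X3 \<Longrightarrow> max 2 (4 * \<kappa> / \<delta>) / \<omega> x \<le> s x"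
    using slope_large by metis
  have m: "0 \<le> real m" by simp
  obtain X4 B where X4: "X4 \<ge> 0"
    "\<And>a z. cmod a \<ge> exp X4 \<Longrightarrow> z \<noteq> 0 \<Longrightarrow> W (peak_monomial a) z \<le>
       exp (B - G (ln (cmod a)) (ln (cmod z)) / 2 - real m * (\<bar>ln (cmod z) - ln (cmod a)\<bar> / \<omega> (ln (cmod a))))"
    using weighted_peak_monomial_upper[OF m] by metis
  obtain c X5 where X5: "c > 0" "X5 \<ge> 0"
    "\<And>a z. cmod a \<ge> exp X5 \<Longrightarrow> z \<noteq> 0 \<Longrightarrow> \<bar>ln (cmod z) - ln (cmod a)\<bar> \<le> 1 * \<omega> (ln (cmod a)) \<Longrightarrow>
       c \<le> W (peak_monomial a) z \<and> W (peak_monomial a) z \<le> 1 / c"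
    using weighted_peak_monomial_local[of 1] by metis
  define X where "X = max X1 (max X2 (max X3 (max X4 X5)))"
  interpret weight_grid \<psi> \<tau> \<omega> \<omega>' s v \<kappa> X "real m" B c
  proof unfold_locales
    fix x assume x: "X \<le> x"
    show w1: "\<omega> x \<le> 1" using x X1(2) by (simp add: X_def)
    show "\<omega> (x + \<omega> x) \<le> 2 * \<omega> x \<and> \<omega> x \<le> 2 * \<omega> (x + \<omega> x)"
      using X1(3)[of x "x + \<omega> x"] x by (simp add: X_def)
    have s1: "1 / (4 * \<kappa> * \<omega> x) \<le> s (x + \<omega> x) - s x" "s (x + \<omega> x) - s x \<le> 4 * \<kappa> / \<omega> x"
      using X2(2)[of x x "x + \<omega> x"] x by (simp_all add: X_def power2_eq_square)
    have s2: "max 2 (4 * \<kappa> / \<delta>) / \<omega> x \<le> s x" using X3(2) x by (simp add: X_def)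
    have "4 * \<kappa> / \<delta> / \<omega> x \<le> max 2 (4 * \<kappa> / \<delta>) / \<omega> x" by (intro divide_right_mono) auto
    then have "4 * \<kappa> / \<delta> / \<omega> x \<le> s x" using s2 by linarith
    then have "4 * \<kappa> / \<omega> x \<le> \<delta> * s x" using \<delta> by (simp add: field_simps)
    then have "s (x + \<omega> x) \<le> exp (1 / (64 * \<kappa>)) * s x" using s1(2) by (simp add: \<delta>_def algebra_simps)
    with s1 show "1 / (4 * \<kappa> * \<omega> x) \<le> s (x + \<omega> x) - s x \<and> s (x + \<omega> x) \<le> exp (1 / (64 * \<kappa>)) * s x" by simp
    have "2 / 1 \<le> max 2 (4 * \<kappa> / \<delta>) / \<omega> x" using w1 by (intro frac_le) auto
    then show "2 \<le> s x" using s2 by linarith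
  next
    fix a z :: complex assume a: "exp X \<le> cmod a" and z: "z \<noteq> 0"
    have a45: "exp X4 \<le> cmod a" "exp X5 \<le> cmod a" using a by (auto simp: X_def exp_max)
    show "W (peak_monomial a) z \<le>
       exp (B - G (ln (cmod a)) (ln (cmod z)) / 2 - real m * (\<bar>ln (cmod z) - ln (cmod a)\<bar> / \<omega> (ln (cmod a))))"
      by (rule X4(2)[OF a45(1) z])
    assume "\<bar>ln (cmod z) - ln (cmod a)\<bar> \<le> \<omega> (ln (cmod a))"
    then show "c \<le> W (peak_monomial a) z" using X5(3)[OF a45(2) z] by simp
  qed (use X5 in auto)
  show ?thesis by (rule ring_functions) simp
qed

text \<open>The slope exceeds every \<open>k\<close> far out and the weight lies above its tangents,
  so \<open>exp (- \<psi>)\<close> decays at least like the power \<open>- k\<close> of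
  \<open>cmod z\<close>.\<close>

lemma one_in_fock_space:
  assumes p: "0 < p"
  shows "(\<lambda>z. 1) \<in> \<F> p"
proof -
  define k where "k = nat \<lceil>3 / enn2real p\<rceil>"
  have k: "3 / enn2real p \<le> real k" unfolding k_def by linarith
  obtain X1 where X1: "X1 \<ge> 0" "\<And>x. x \<ge> X1 \<Longrightarrow> real k / \<omega> x \<le> s x" using slope_large by metis
  obtain X2 where X2: "X2 \<ge> 0" "\<And>x. x \<ge> X2 \<Longrightarrow> \<omega> x \<le> 1" using slowly_varying by metis
  define x0 where "x0 = max X1 X2"
  have x0: "x0 \<ge> 0" using X1 by (simp add: x0_def)
  have "real k / 1 \<le> real k / \<omega> x0" using X2(2)[of x0] by (intro divide_left_mono) (auto simp: x0_def)
  then have sk: "real k \<le> s x0" using X1(2)[of x0] by (simp add: x0_def)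
  have W1: "W (\<lambda>z. 1) z \<le> 1" for z using weight_nonneg[of "cmod z"] by (simp add: weighted_abs_def)
  have Wk: "cmod z ^ k * W (\<lambda>z. 1) z \<le> exp (real k * x0)" for z
  proof (cases "cmod z \<le> exp x0")
    case True
    then have "cmod z ^ k \<le> exp x0 ^ k" by (intro power_mono) auto
    then have "cmod z ^ k * W (\<lambda>z. 1) z \<le> exp x0 ^ k * 1" using W1[of z] by (intro mult_mono) auto
    then show ?thesis by (simp add: exp_of_nat_mult)
  next
    case False
    then have z: "z \<noteq> 0" by auto
    define x where "x = ln (cmod z)"
    have zx: "cmod z = exp x" using z by (simp add: x_def)
    then have xx: "x0 \<le> x" using False by simp
    have "real k * (x - x0) \<le> s x0 * (x - x0)" using sk xx by (intro mult_right_mono) auto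
    also have "\<dots> \<le> \<psi> (exp x)"
      using remainder_nonneg[of x0 x] weight_nonneg[of "exp x0"] by (simp add: convex_remainder_def)
    finally have "real k * x - \<psi> (exp x) \<le> real k * x0" by (simp add: algebra_simps)
    moreover have "cmod z ^ k * W (\<lambda>z. 1) z = exp (real k * x - \<psi> (exp x))"
      by (simp add: weighted_abs_def zx exp_diff exp_minus divide_inverse exp_of_nat_mult)
    ultimately show ?thesis by simp
  qed
  have "W (\<lambda>z. 1) z \<le> exp (real k * x0)" for z
    using W1[of z] x0 by (auto elim!: order_trans)
  then have decay: "decay_bound (\<lambda>z. 1) 0 1 (exp (real k * x0)) k"
    using Wk by (simp add: decay_bound_def)
  show ?thesis
    by (rule fock_norm_le_of_decay[OF p]) (use decay k in \<open>blast intro: zero_less_one\<close>)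
qed

section \<open>Averages over discs of the local scale\<close>

definition local_kernel :: "real \<Rightarrow> complex \<Rightarrow> complex \<Rightarrow> ennreal" where
  "local_kernel X z w =
     (if exp X \<le> cmod z \<and> dist z w < \<tau> (cmod z) / 2 then ennreal (1 / (\<tau> (cmod z))\<^sup>2) else 0)"

lemma measurable_\<tau> [measurable]: "(\<lambda>z::complex. \<tau> (cmod z)) \<in> borel_measurable borel"
  by (rule borel_measurable_continuous_onI[OF continuous_\<tau>])

lemma measurable_local_kernel [measurable]:
  "(\<lambda>(z, w). local_kernel X z w) \<in> borel_measurable (borel \<Otimes>\<^sub>M borel)"
  unfolding local_kernel_def by measurable

text \<open>If \<open>w\<close> lies in the small disc about \<open>z\<close>, the scales at the two
  points are comparable: \<open>z\<close> lies in the disc of radius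
  \<open>2 * \<tau> (cmod w)\<close> about \<open>w\<close>, and \<open>1 / \<tau>\<^sup>2\<close>
  at \<open>z\<close> is at most 9 times its value at \<open>w\<close>. The area brings in 4 *
  pi.\<close>

lemma local_kernel_integral:
  obtains X where "X \<ge> 0" "\<And>w. (\<integral>\<^sup>+z. local_kernel X z w \<partial>lborel) \<le> ennreal (36 * pi)"
proof -
  obtain X where X: "X \<ge> 0" "\<And>x. x \<ge> X \<Longrightarrow> \<omega> x \<le> 1"
    "\<And>x0 x. x0 \<ge> X \<Longrightarrow> \<bar>x - x0\<bar> \<le> 1 * \<omega> x0 \<Longrightarrow> 0 \<le> x \<and> \<omega> x0 / 2 \<le> \<omega> x \<and> \<omega> x \<le> 2 * \<omega> x0"
    using slowly_varying[of 1] by blast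
  have pw: "local_kernel X z w \<le> ennreal (9 / (\<tau> (cmod w))\<^sup>2) * indicator (ball w (2 * \<tau> (cmod w))) z" for z w
  proof (cases "exp X \<le> cmod z \<and> dist z w < \<tau> (cmod z) / 2")
    case True
    define x where "x = ln (cmod z)"
    define y where "y = ln (cmod w)"
    have z: "z \<noteq> 0" "X \<le> x" using ln_norm_ge[of X z] True by (auto simp: x_def)
    have \<tau>z: "\<tau> (cmod z) = cmod z * \<omega> x" using \<tau>_eq[of x] z by (simp add: x_def)
    have d: "dist z w < cmod z * \<omega> x / 2" using True \<tau>z by simp
    have w: "w \<noteq> 0" "\<bar>y - x\<bar> \<le> \<omega> x"
      using abs_ln_norm_diff_le[OF z(1) \<omega>_pos X(2)[OF z(2)] d] by (auto simp: x_def y_def)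
    have \<tau>w: "\<tau> (cmod w) = cmod w * \<omega> y" using \<tau>_eq[of y] w by (simp add: y_def)
    have \<omega>y: "\<omega> x / 2 \<le> \<omega> y" "\<omega> y \<le> 2 * \<omega> x" using X(3)[OF z(2), of y] w(2) by auto
    have "cmod z * \<omega> x / 2 \<le> cmod z / 2" using X(2)[OF z(2)] by (simp add: mult_left_le)
    then have "\<bar>cmod z - cmod w\<bar> \<le> cmod z / 2"
      using d norm_triangle_ineq3[of z w] by (simp add: dist_norm)
    then have cw: "cmod z / 2 \<le> cmod w" "cmod w \<le> 3 / 2 * cmod z" by linarith+
    have "cmod z / 2 * (\<omega> x / 2) \<le> cmod w * \<omega> y" using cw \<omega>y by (intro mult_mono) auto
    then have lo: "\<tau> (cmod z) / 2 \<le> 2 * \<tau> (cmod w)" by (simp add: \<tau>z \<tau>w)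
    have "cmod w * \<omega> y \<le> 3 / 2 * cmod z * (2 * \<omega> x)" using cw \<omega>y by (intro mult_mono) auto
    then have hi: "\<tau> (cmod w) \<le> 3 * \<tau> (cmod z)" by (simp add: \<tau>z \<tau>w)
    have "(\<tau> (cmod w))\<^sup>2 \<le> (3 * \<tau> (cmod z))\<^sup>2" using hi \<tau>_pos[of "cmod w"] by (intro power_mono) auto
    then have "1 / (\<tau> (cmod z))\<^sup>2 \<le> 9 / (\<tau> (cmod w))\<^sup>2"
      using \<tau>_pos[of "cmod w"] \<tau>_pos[of "cmod z"] by (simp add: power_mult_distrib field_simps)
    moreover have "z \<in> ball w (2 * \<tau> (cmod w))" using True lo by (simp add: dist_commute)
    ultimately show ?thesis using True by (simp add: local_kernel_def ennreal_leI)
  qed (auto simp: local_kernel_def)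
  show ?thesis
  proof (rule that[OF X(1)])
    fix w
    have t: "\<tau> (cmod w) > 0" using \<tau>_pos by simp
    have "(\<integral>\<^sup>+z. local_kernel X z w \<partial>lborel)
        \<le> (\<integral>\<^sup>+z. ennreal (9 / (\<tau> (cmod w))\<^sup>2) * indicator (ball w (2 * \<tau> (cmod w))) z \<partial>lborel)"
      using pw by (rule nn_integral_mono)
    also have "\<dots> = ennreal (9 / (\<tau> (cmod w))\<^sup>2) * ennreal (pi * (2 * \<tau> (cmod w))\<^sup>2)"
      using t by (simp add: nn_integral_cmult_indicator emeasure_lborel_complex_ball)
    also have "\<dots> = ennreal (9 / (\<tau> (cmod w))\<^sup>2 * (pi * (2 * \<tau> (cmod w))\<^sup>2))"
      by (simp flip: ennreal_mult)
    also have "9 / (\<tau> (cmod w))\<^sup>2 * (pi * (2 * \<tau> (cmod w))\<^sup>2) = 36 * pi"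
      using t by (simp add: power_mult_distrib)
    finally show "(\<integral>\<^sup>+z. local_kernel X z w \<partial>lborel) \<le> ennreal (36 * pi)" .
  qed
qed

definition local_average :: "real \<Rightarrow> (complex \<Rightarrow> ennreal) \<Rightarrow> complex \<Rightarrow> ennreal" where
  "local_average X h z = (\<integral>\<^sup>+w. local_kernel X z w * h w \<partial>lborel)"

lemma measurable_local_average:
  assumes [measurable]: "h \<in> borel_measurable borel"
  shows "local_average X h \<in> borel_measurable lborel"
  unfolding local_average_def [abs_def] by measurable

lemma local_average_eq:
  assumes [measurable]: "h \<in> borel_measurable borel" and z: "exp X \<le> cmod z"
  shows "local_average X h z = ennreal (1 / (\<tau> (cmod z))\<^sup>2) * (\<integral>\<^sup>+w\<in>ball z (\<tau> (cmod z) / 2). h w \<partial>lborel)"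
proof -
  have [measurable]: "ball z r \<in> sets borel" for r by simp
  have "local_average X h z = (\<integral>\<^sup>+w. ennreal (1 / (\<tau> (cmod z))\<^sup>2) * (h w * indicator (ball z (\<tau> (cmod z) / 2)) w) \<partial>lborel)"
    unfolding local_average_def using z by (intro nn_integral_cong) (auto simp: local_kernel_def indicator_def)
  also have "\<dots> = ennreal (1 / (\<tau> (cmod z))\<^sup>2) * (\<integral>\<^sup>+w\<in>ball z (\<tau> (cmod z) / 2). h w \<partial>lborel)"
    by (intro nn_integral_cmult) measurable
  finally show ?thesis .
qed

text \<open>Tonelli moves the integration over the centres onto the kernel. This plays the role of a
  covering by discs of radius \<open>\<tau>\<close> with bounded overlap.\<close>

lemma local_average_integral:
  assumes [measurable]: "h \<in> borel_measurable borel"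
    and K: "\<And>w. (\<integral>\<^sup>+z. local_kernel X z w \<partial>lborel) \<le> ennreal (36 * pi)"
  shows "(\<integral>\<^sup>+z. local_average X h z \<partial>lborel) \<le> ennreal (36 * pi) * (\<integral>\<^sup>+w. h w \<partial>lborel)"
proof -
  have "(\<integral>\<^sup>+z. local_average X h z \<partial>lborel) = (\<integral>\<^sup>+w. (\<integral>\<^sup>+z. local_kernel X z w * h w \<partial>lborel) \<partial>lborel)"
    unfolding local_average_def by (rule lborel_pair.Fubini'[symmetric]) measurable
  also have "\<dots> = (\<integral>\<^sup>+w. (\<integral>\<^sup>+z. local_kernel X z w \<partial>lborel) * h w \<partial>lborel)"
    by (intro nn_integral_cong nn_integral_multc) measurable
  also have "\<dots> \<le> (\<integral>\<^sup>+w. ennreal (36 * pi) * h w \<partial>lborel)"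
    by (intro nn_integral_mono mult_right_mono K) auto
  also have "\<dots> = ennreal (36 * pi) * (\<integral>\<^sup>+w. h w \<partial>lborel)"
    by (intro nn_integral_cmult) measurable
  finally show ?thesis .
qed

lemma symbol_integral_growth:
  assumes p: "0 < p" and q: "0 < q" "q \<noteq> \<infinity>" and T: "symbol_operator g T" and g: "g holomorphic_on UNIV"
    and bd: "bounded_operator \<psi> p q T"
  shows "\<exists>C R0. \<exists>R::nat \<Rightarrow> real. 0 \<le> C \<and> filterlim R at_top sequentially \<and>
    (\<forall>N. (\<integral>\<^sup>+z\<in>{z. R0 \<le> cmod z \<and> cmod z < R N}. ennreal (cmod (g z) powr enn2real q) \<partial>lborel)
          \<le> ennreal (C * R N powr (2 / enn2real p * enn2real q)))"
proof -
  define q' where "q' = enn2real q"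
  have q': "q' > 0" using q by (simp add: q'_def enn2real_pos)
  define k where "k = nat \<lceil>3 / enn2real p\<rceil>"
  have k: "3 / enn2real p \<le> real k" unfolding k_def by linarith
  obtain f and x :: "nat \<Rightarrow> real" and M c :: real and J :: nat where M: "0 < M" and c: "0 < c"
    and x: "filterlim x at_top sequentially"
    and decay: "\<forall>N j. decay_bound (f N j) 0 (exp (x N)) M k"
    and low: "\<forall>N z. exp (x 0) \<le> cmod z \<and> cmod z < exp (x N) \<longrightarrow>
        (\<exists>j<J. c \<le> W (f N j) z \<and> c \<le> weighted_deriv (f N j) z)"
    using ring_functions_exist[of k] by blast
  have hol: "f N j holomorphic_on UNIV" for N j using decay by (simp add: decay_bound_def)
  obtain C1 where C1: "C1 > 0" and
    nrm: "\<And>f a t M k. decay_bound f a t M k \<Longrightarrow> t > 0 \<Longrightarrow> 3 / enn2real p \<le> real k \<Longrightarrow>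
       f \<in> \<F> p \<and> \<N> p f \<le> C1 * M * t powr (2 / enn2real p)"
    using fock_norm_le_of_decay[OF p] by blast
  obtain C2 X2 where C2: "C2 > 0" "X2 \<ge> 0" and
    jet: "\<And>F a. F holomorphic_on UNIV \<Longrightarrow> cmod a \<ge> exp X2 \<Longrightarrow>
       ennreal ((\<tau> (cmod a))\<^sup>2 * weighted_jet F a powr q') \<le>
       ennreal C2 * (\<integral>\<^sup>+z\<in>ball a (\<tau> (cmod a) / 2). ennreal (W F z powr q') \<partial>lborel)"
    using weighted_jet_powr_le_integral[OF q'] by blast
  obtain X3 where X3: "X3 \<ge> 0" "\<And>w. (\<integral>\<^sup>+z. local_kernel X3 z w \<partial>lborel) \<le> ennreal (36 * pi)"
    using local_kernel_integral by blast
  obtain C3 where C3: "\<forall>f\<in>\<F> p. T f \<in> \<F> q \<and> \<N> q (T f) \<le> C3 * \<N> p f"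
    using bd unfolding bounded_operator_def by blast
  define R0 where "R0 = max (exp (x 0)) (max (exp X2) (exp X3))"
  define R where "R N = exp (x N)" for N
  define D where "D = (1 / c) powr q' * C2"
  define E where "E = max C3 0 * (C1 * M)"
  have fN: "f N j \<in> \<F> p \<and> \<N> p (f N j) \<le> C1 * M * R N powr (2 / enn2real p)" for N j
    using nrm[OF decay[rule_format] _ k, of N j] by (simp add: R_def)
  have TfN: "T (f N j) \<in> \<F> q" for N j using fN C3 by blast
  have Tnorm: "\<N> q (T (f N j)) \<le> E * R N powr (2 / enn2real p)" for N j
  proof -
    have "\<N> q (T (f N j)) \<le> C3 * \<N> p (f N j)" using fN C3 by blast
    also have "\<dots> \<le> max C3 0 * (C1 * M * R N powr (2 / enn2real p))"
      using fN[of N j] fock_norm_nonneg[of "f N j" p] by (intro mult_mono) auto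
    finally show ?thesis by (simp add: E_def mult.assoc)
  qed
  define h where "h N j w = ennreal (W (T (f N j)) w powr q')" for N j w
  have mW: "W (T (f N j)) \<in> borel_measurable borel" for N j
    using measurable_weighted_abs[OF fock_space_holomorphic[OF TfN]] by simp
  have mh [measurable]: "h N j \<in> borel_measurable borel" for N j
    unfolding h_def [abs_def] using mW[of N j] by measurable
  \<comment> \<open>The index \<open>j\<close> of a test function that is large at \<open>z\<close>
    varies with \<open>z\<close>; adding the averages for all \<open>j < J\<close> removes this
    dependence.\<close>
  have pw: "ennreal (cmod (g z) powr q') * indicator {z. R0 \<le> cmod z \<and> cmod z < R N} z
      \<le> ennreal D * (\<Sum>j<J. local_average X3 (h N j) z)" for N z
  proof (cases "R0 \<le> cmod z \<and> cmod z < R N")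
    case True
    then have z: "exp (x 0) \<le> cmod z" "exp X2 \<le> cmod z" "exp X3 \<le> cmod z" "cmod z < exp (x N)"
      by (auto simp: R0_def R_def)
    obtain j where j: "j < J" "c \<le> W (f N j) z" "c \<le> weighted_deriv (f N j) z"
      using low z by blast
    have t: "\<tau> (cmod z) > 0" using \<tau>_pos by simp
    have "c * cmod (g z) \<le> weighted_jet (T (f N j)) z"
      by (rule symbol_operator_jet[OF T g hol j(2,3)])
    then have "cmod (g z) \<le> 1 / c * weighted_jet (T (f N j)) z" using c by (simp add: field_simps)
    then have "cmod (g z) powr q' \<le> (1 / c * weighted_jet (T (f N j)) z) powr q'"
      using q' by (intro powr_mono2) auto
    also have "\<dots> = (1 / c) powr q' * (1 / (\<tau> (cmod z))\<^sup>2) * ((\<tau> (cmod z))\<^sup>2 * weighted_jet (T (f N j)) z powr q')"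
      using c t weighted_jet_nonneg[of "T (f N j)" z] by (subst powr_mult) auto
    finally have "ennreal (cmod (g z) powr q') \<le>
        ennreal ((1 / c) powr q' * (1 / (\<tau> (cmod z))\<^sup>2) * ((\<tau> (cmod z))\<^sup>2 * weighted_jet (T (f N j)) z powr q'))"
      by (rule ennreal_leI)
    also have "\<dots> = ennreal ((1 / c) powr q') * ennreal (1 / (\<tau> (cmod z))\<^sup>2) *
        ennreal ((\<tau> (cmod z))\<^sup>2 * weighted_jet (T (f N j)) z powr q')"
    proof -
      have mult3: "ennreal (a * b * d) = ennreal a * ennreal b * ennreal d" if "0 \<le> a" "0 \<le> b" "0 \<le> d" for a b d
        using that by (simp add: ennreal_mult)
      show ?thesis by (rule mult3) auto
    qed
    also have "\<dots> \<le> ennreal ((1 / c) powr q') * ennreal (1 / (\<tau> (cmod z))\<^sup>2) *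
        (ennreal C2 * (\<integral>\<^sup>+w\<in>ball z (\<tau> (cmod z) / 2). h N j w \<partial>lborel))"
      unfolding h_def by (intro mult_left_mono jet fock_space_holomorphic[OF TfN] z) auto
    also have "\<dots> = ennreal D * local_average X3 (h N j) z"
      using C2 by (simp add: local_average_eq[OF mh z(3)] D_def ennreal_mult mult_ac)
    also have "\<dots> \<le> ennreal D * (\<Sum>j<J. local_average X3 (h N j) z)"
      using j(1) by (intro mult_left_mono member_le_sum) auto
    finally show ?thesis using True by simp
  qed simp
  have main: "(\<integral>\<^sup>+z\<in>{z. R0 \<le> cmod z \<and> cmod z < R N}. ennreal (cmod (g z) powr q') \<partial>lborel)
      \<le> ennreal (D * real J * (36 * pi) * E powr q' * R N powr (2 / enn2real p * q'))" for N
  proof -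
    have [measurable]: "local_average X3 (h N j) \<in> borel_measurable lborel" for j
      by (rule measurable_local_average) measurable
    have "(\<integral>\<^sup>+z\<in>{z. R0 \<le> cmod z \<and> cmod z < R N}. ennreal (cmod (g z) powr q') \<partial>lborel)
        \<le> (\<integral>\<^sup>+z. ennreal D * (\<Sum>j<J. local_average X3 (h N j) z) \<partial>lborel)"
      using pw by (rule nn_integral_mono)
    also have "\<dots> = ennreal D * (\<Sum>j<J. \<integral>\<^sup>+z. local_average X3 (h N j) z \<partial>lborel)"
      by (subst nn_integral_cmult, measurable, subst nn_integral_sum) auto
    also have "\<dots> \<le> ennreal D * (\<Sum>j<J. ennreal (36 * pi * (E * R N powr (2 / enn2real p)) powr q'))"
    proof (intro mult_left_mono sum_mono)
      fix j
      have "(\<integral>\<^sup>+z. local_average X3 (h N j) z \<partial>lborel) \<le> ennreal (36 * pi) * (\<integral>\<^sup>+w. h N j w \<partial>lborel)"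
        by (rule local_average_integral[OF mh X3(2)])
      also have "(\<integral>\<^sup>+w. h N j w \<partial>lborel) = ennreal (\<N> q (T (f N j)) powr q')"
        unfolding h_def q'_def by (rule fock_norm_powr[OF q(2,1) TfN])
      also have "ennreal (36 * pi) * \<dots> = ennreal (36 * pi * \<N> q (T (f N j)) powr q')"
        by (simp add: ennreal_mult)
      also have "\<dots> \<le> ennreal (36 * pi * (E * R N powr (2 / enn2real p)) powr q')"
        using Tnorm[of N j] fock_norm_nonneg[OF TfN, of N j] q'
        by (intro ennreal_leI mult_left_mono powr_mono2) auto
      finally show "(\<integral>\<^sup>+z. local_average X3 (h N j) z \<partial>lborel) \<le> \<dots>" .
    qed simp
    also have "\<dots> = ennreal (D * (real J * (36 * pi * (E * R N powr (2 / enn2real p)) powr q')))"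
      using C2 by (simp add: ennreal_mult D_def ennreal_of_nat_eq_real_of_nat)
    also have "(E * R N powr (2 / enn2real p)) powr q' = E powr q' * R N powr (2 / enn2real p * q')"
      using C1 M by (simp add: powr_mult powr_powr E_def)
    finally show ?thesis by (simp add: mult_ac)
  qed
  have "filterlim R at_top sequentially"
    unfolding R_def [abs_def] by (rule filterlim_compose[OF exp_at_top x])
  moreover have "0 \<le> D * real J * (36 * pi) * E powr q'" using C2 by (simp add: D_def)
  ultimately show ?thesis using main unfolding q'_def by blast
qed

text \<open>The disc of radius \<open>R N / 2\<close> about \<open>b\<close> lies in the disc of
  radius \<open>R N\<close> about 0, so the local estimate bounds the \<open>q\<close>-th power of
  \<open>cmod (g b)\<close> by a multiple of \<open>R N powr (\<theta> - 2)\<close>, up to the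
  contribution of a fixed disc divided by \<open>(R N)\<^sup>2\<close>.\<close>

lemma bounded_symbol_zero_greater:
  assumes q: "0 < q" and qp: "q < p" and T: "symbol_operator g T" and g: "g holomorphic_on UNIV"
    and bd: "bounded_operator \<psi> p q T"
  shows "g = (\<lambda>z. 0)"
proof
  fix b
  have p: "0 < p" using q qp by simp
  have qfin: "q \<noteq> \<infinity>" using qp by auto
  define q' where "q' = enn2real q"
  have q': "q' > 0" using q qfin by (simp add: q'_def enn2real_pos)
  define \<theta> where "\<theta> = 2 / enn2real p * q'"
  have \<theta>: "\<theta> < 2"
  proof (cases "p = \<infinity>")
    case True then show ?thesis by (simp add: \<theta>_def)
  next
    case False
    then have "q' < enn2real p" using qp unfolding q'_def by (simp add: enn2real_less_iff less_top)
    then show ?thesis using q' by (simp add: \<theta>_def field_simps)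
  qed
  obtain C R0 and R :: "nat \<Rightarrow> real" where C: "0 \<le> C" and R: "filterlim R at_top sequentially"
    and growth: "\<forall>N. (\<integral>\<^sup>+z\<in>{z. R0 \<le> cmod z \<and> cmod z < R N}. ennreal (cmod (g z) powr q') \<partial>lborel)
          \<le> ennreal (C * R N powr \<theta>)"
    using symbol_integral_growth[OF p q qfin T g bd] unfolding q'_def \<theta>_def by blast
  obtain C1 where C1: "C1 > 0" and sub: "\<And>F a r. r > 0 \<Longrightarrow> F holomorphic_on ball a r \<Longrightarrow>
       ennreal (r\<^sup>2 * cmod (F a) powr q') \<le>
       ennreal C1 * (\<integral>\<^sup>+z\<in>ball a r. ennreal (cmod (F z) powr q') \<partial>lborel)"
    using holomorphic_powr_le_integral[OF q'] by blast
  \<comment> \<open>Nothing is known about the sign of \<open>R0\<close>; the absolute value gives a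
    nonnegative radius and still covers \<open>cmod z < R0\<close>.\<close>
  have "compact (g ` cball 0 \<bar>R0\<bar>)"
    using g holomorphic_on_imp_continuous_on holomorphic_on_subset
    by (intro compact_continuous_image) auto
  then obtain D where D: "\<forall>y\<in>g ` cball 0 \<bar>R0\<bar>. cmod y \<le> D"
    using compact_imp_bounded bounded_iff by metis
  define I0 where "I0 = D powr q' * (pi * R0\<^sup>2)"
  have inner: "(\<integral>\<^sup>+z\<in>ball 0 \<bar>R0\<bar>. ennreal (cmod (g z) powr q') \<partial>lborel) \<le> ennreal I0"
  proof -
    have "(\<integral>\<^sup>+z\<in>ball 0 \<bar>R0\<bar>. ennreal (cmod (g z) powr q') \<partial>lborel)
      \<le> (\<integral>\<^sup>+z. ennreal (D powr q') * indicator (ball (0::complex) \<bar>R0\<bar>) z \<partial>lborel)"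
      using D q' by (intro nn_integral_mono) (auto simp: indicator_def intro!: ennreal_leI powr_mono2)
    also have "\<dots> = ennreal I0"
      by (simp add: nn_integral_cmult_indicator emeasure_lborel_complex_ball I0_def ennreal_mult)
    finally show ?thesis .
  qed
  have I0: "I0 \<ge> 0" by (simp add: I0_def)
  have [measurable]: "g \<in> borel_measurable borel"
    using g by (intro borel_measurable_continuous_onI holomorphic_on_imp_continuous_on)
  have bound: "cmod (g b) powr q' \<le> 4 * C1 * (I0 * R N powr (- 2) + C * R N powr (\<theta> - 2))"
    if RN: "R N > 0" "2 * cmod b \<le> R N" for N
  proof -
    have [measurable]: "{z. R0 \<le> cmod z \<and> cmod z < R N} \<in> sets borel" "ball 0 \<bar>R0\<bar> \<in> sets (borel :: complex measure)"
      by measurable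
    have "ennreal ((R N / 2)\<^sup>2 * cmod (g b) powr q')
        \<le> ennreal C1 * (\<integral>\<^sup>+z\<in>ball b (R N / 2). ennreal (cmod (g z) powr q') \<partial>lborel)"
      using RN g holomorphic_on_subset by (intro sub) auto
    also have "(\<integral>\<^sup>+z\<in>ball b (R N / 2). ennreal (cmod (g z) powr q') \<partial>lborel)
        \<le> (\<integral>\<^sup>+z. ennreal (cmod (g z) powr q') * indicator (ball 0 \<bar>R0\<bar>) z
              + ennreal (cmod (g z) powr q') * indicator {z. R0 \<le> cmod z \<and> cmod z < R N} z \<partial>lborel)"
    proof (rule nn_integral_mono)
      fix z
      have "cmod z < R N" if "z \<in> ball b (R N / 2)"
        using that RN norm_triangle_ineq2[of z b] by (simp add: dist_norm norm_minus_commute)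
      then show "ennreal (cmod (g z) powr q') * indicator (ball b (R N / 2)) z
        \<le> ennreal (cmod (g z) powr q') * indicator (ball 0 \<bar>R0\<bar>) z
              + ennreal (cmod (g z) powr q') * indicator {z. R0 \<le> cmod z \<and> cmod z < R N} z"
        by (auto simp: indicator_def)
    qed
    also have "\<dots> = (\<integral>\<^sup>+z\<in>ball 0 \<bar>R0\<bar>. ennreal (cmod (g z) powr q') \<partial>lborel)
        + (\<integral>\<^sup>+z\<in>{z. R0 \<le> cmod z \<and> cmod z < R N}. ennreal (cmod (g z) powr q') \<partial>lborel)"
      by (intro nn_integral_add) measurable
    also have "\<dots> \<le> ennreal I0 + ennreal (C * R N powr \<theta>)"
      using inner growth by (intro add_mono) auto
    finally have "ennreal ((R N / 2)\<^sup>2 * cmod (g b) powr q') \<le> ennreal C1 * (ennreal I0 + ennreal (C * R N powr \<theta>))"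
      by (simp add: mult_left_mono)
    also have "\<dots> = ennreal (C1 * (I0 + C * R N powr \<theta>))"
      using C1 I0 C by (simp add: ennreal_mult)
    finally have "(R N / 2)\<^sup>2 * cmod (g b) powr q' \<le> C1 * (I0 + C * R N powr \<theta>)"
      using C1 I0 C by (subst (asm) ennreal_le_iff) auto
    moreover have "R N powr (- 2) = 1 / (R N)\<^sup>2" "R N powr (\<theta> - 2) = R N powr \<theta> / (R N)\<^sup>2"
      using RN by (simp_all add: powr_minus powr_diff powr_numeral divide_inverse)
    ultimately show ?thesis using RN(1) by (simp only:) (simp add: power_divide field_simps)
  qed
  have lim: "(\<lambda>N. 4 * C1 * (I0 * R N powr (- 2) + C * R N powr (\<theta> - 2))) \<longlonglongrightarrow> 4 * C1 * (I0 * 0 + C * 0)"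
    using \<theta> by (intro tendsto_intros tendsto_neg_powr R) auto
  have "eventually (\<lambda>N. cmod (g b) powr q' \<le> 4 * C1 * (I0 * R N powr (- 2) + C * R N powr (\<theta> - 2))) sequentially"
    using R[unfolded filterlim_at_top, rule_format, of "max 1 (2 * cmod b)"]
    by eventually_elim (rule bound, auto)
  then have "cmod (g b) powr q' \<le> 4 * C1 * (I0 * 0 + C * 0)"
    by (rule tendsto_lowerbound[OF lim]) simp
  then show "g b = 0" using powr_gt_zero[of "cmod (g b)" q'] by (cases "g b = 0") auto
qed

end

section \<open>From admissible weights to the theorem\<close>

text \<open>On the positive axis the two partial derivatives separate. The real direction is the
  radial one; in the imaginary direction the first derivative is
  \<open>f' (\<rho> y) * (y / \<rho> y)\<close>, whose second factor vanishes at 0 and leaves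
  \<open>f' r / r\<close>.\<close>

lemma laplacian_radial:
  assumes f': "\<And>r. r > 0 \<Longrightarrow> (f has_real_derivative f' r) (at r)"
    and f'': "(f' has_real_derivative f'') (at r)" and r: "r > 0"
  shows "laplacian (\<lambda>w. f (cmod w)) (complex_of_real r) = f'' + f' r / r"
proof -
  have "deriv (deriv (\<lambda>x. f (cmod (Complex x 0)))) r = f''"
  proof -
    have "deriv (\<lambda>x. f (cmod (Complex x 0))) x = f' x" if "x \<in> {0<..}" for x
    proof (rule DERIV_imp_deriv)
      have "eventually (\<lambda>y. y \<in> {0<..}) (nhds x)" using that by (intro eventually_nhds_in_open) auto
      then have "eventually (\<lambda>y. f y = f (cmod (Complex y 0))) (nhds x)"
        by eventually_elim (simp add: complex_norm)
      then show "((\<lambda>x. f (cmod (Complex x 0))) has_real_derivative f' x) (at x)"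
        using f'[of x] that DERIV_cong_ev[OF refl _ refl] by fastforce
    qed
    moreover have "eventually (\<lambda>x. x \<in> {0<..}) (nhds r)" using r by (intro eventually_nhds_in_open) auto
    ultimately have "eventually (\<lambda>x. deriv (\<lambda>x. f (cmod (Complex x 0))) x = f' x) (nhds r)"
      by (simp add: eventually_mono)
    then have "deriv (deriv (\<lambda>x. f (cmod (Complex x 0)))) r = deriv f' r" by (intro deriv_cong_ev) auto
    then show ?thesis using DERIV_imp_deriv[OF f''] by simp
  qed
  moreover have "deriv (deriv (\<lambda>y. f (cmod (Complex r y)))) 0 = f' r / r"
  proof -
    define \<rho> where "\<rho> y = sqrt (r\<^sup>2 + y\<^sup>2)" for y
    have pos: "r\<^sup>2 + y\<^sup>2 > 0" for y using r by (simp add: add_pos_nonneg)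
    have \<rho>_pos: "\<rho> y > 0" for y using pos by (simp add: \<rho>_def)
    have \<rho>': "(\<rho> has_real_derivative y / \<rho> y) (at y)" for y
      unfolding \<rho>_def using pos[of y]
      by (auto intro!: derivative_eq_intros simp: field_simps)
    have eq: "(\<lambda>y. f (cmod (Complex r y))) = (\<lambda>y. f (\<rho> y))" by (simp add: complex_norm \<rho>_def)
    have "deriv (\<lambda>y. f (\<rho> y)) y = f' (\<rho> y) * (y / \<rho> y)" for y
      using DERIV_chain2[OF f'[OF \<rho>_pos] \<rho>'] by (rule DERIV_imp_deriv)
    then have d: "deriv (\<lambda>y. f (cmod (Complex r y))) = (\<lambda>y. f' (\<rho> y) * (y / \<rho> y))" unfolding eq by auto
    have \<rho>0: "\<rho> 0 = r" using r by (simp add: \<rho>_def)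
    have "((\<lambda>y. f' (\<rho> y)) has_real_derivative f'' * (0 / \<rho> 0)) (at 0)"
      by (rule DERIV_chain2[OF _ \<rho>']) (use f'' \<rho>0 in simp)
    moreover have "((\<lambda>y. y / \<rho> y) has_real_derivative 1 / r) (at 0)"
      using \<rho>'[of 0] r \<rho>0 by (auto intro!: derivative_eq_intros)
    ultimately have "((\<lambda>y. f' (\<rho> y) * (y / \<rho> y)) has_real_derivative f'' * (0 / \<rho> 0) * (0 / \<rho> 0) + 1 / r * f' (\<rho> 0)) (at 0)"
      by (rule DERIV_mult)
    then show ?thesis unfolding d using \<rho>0 by (simp add: DERIV_imp_deriv)
  qed
  ultimately show ?thesis by (simp add: laplacian_def)
qed

text \<open>On the positive axis the radial function is its profile. The profile at negative
  arguments is arbitrary, hence \<open>r > 0\<close>.\<close>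

lemma radial_profile_differentiable:
  assumes "(\<lambda>z::complex. \<tau> (cmod z)) differentiable_on UNIV" and r: "r > 0"
  shows "((\<tau> :: real \<Rightarrow> real) has_real_derivative deriv \<tau> r) (at r)"
proof -
  have "(\<lambda>z::complex. \<tau> (cmod z)) differentiable (at (complex_of_real r))"
    using assms by (simp add: differentiable_on_def)
  moreover have "complex_of_real differentiable (at r)"
    by (intro bounded_linear_imp_differentiable bounded_linear_of_real)
  ultimately have "((\<lambda>z::complex. \<tau> (cmod z)) \<circ> complex_of_real) differentiable (at r)"
    by (intro differentiable_chain_at)
  then have d: "(\<lambda>x. \<tau> (cmod (complex_of_real x))) differentiable (at r)" by (simp add: comp_def)
  then obtain D where D: "((\<lambda>x. \<tau> (cmod (complex_of_real x))) has_real_derivative D) (at r)"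
    using real_differentiable_def by blast
  have "eventually (\<lambda>x. x \<in> {0<..}) (nhds r)" using r by (intro eventually_nhds_in_open) auto
  then have "eventually (\<lambda>x. \<tau> (cmod (complex_of_real x)) = \<tau> x) (nhds r)"
    by eventually_elim simp
  then have "(\<tau> has_real_derivative D) (at r)"
    using D DERIV_cong_ev[OF refl _ refl] by fastforce
  then show ?thesis using DERIV_imp_deriv by blast
qed

text \<open>The slope is nonnegative because it increases and tends to 0 at minus infinity, where
  \<open>\<psi>' (exp x)\<close> converges and the factor \<open>exp x\<close> vanishes. The limit
  of \<open>\<omega>'\<close> follows from those of \<open>deriv \<tau>\<close> and
  \<open>\<omega>\<close>, of which it is the difference.\<close>

lemma admissible_weight_imp_fock_weight:
  assumes "admissible_weight \<psi>"
  shows "\<exists>\<tau> \<omega> \<omega>' s v \<kappa>. fock_weight \<psi> \<tau> \<omega> \<omega>' s v \<kappa>"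
proof -
  from assms have C2: "C2_halfline \<psi>" and nonneg: "\<forall>r\<ge>0. 0 \<le> \<psi> r"
    and lap: "\<forall>z. z \<noteq> 0 \<longrightarrow> 0 < laplacian (\<lambda>w. \<psi> (cmod w)) z"
    unfolding admissible_weight_def by blast+
  from assms obtain \<tau> :: "real \<Rightarrow> real" where \<tau>_pos: "\<forall>r\<ge>0. 0 < \<tau> r"
    and \<tau>_diff: "(\<lambda>z::complex. \<tau> (cmod z)) differentiable_on UNIV"
    and \<tau>_comp: "comparable_on {z. 1 \<le> cmod z} (\<lambda>z. \<tau> (cmod z)) (\<lambda>z. laplacian (\<lambda>w. \<psi> (cmod w)) z powr (- 1 / 2))"
    and \<tau>_lim: "(\<tau> \<longlongrightarrow> 0) at_top" and \<tau>'_lim: "(deriv \<tau> \<longlongrightarrow> 0) at_top"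
    unfolding admissible_weight_def by blast
  obtain \<psi>' \<psi>'' where p1: "\<forall>r\<ge>0. (\<psi> has_real_derivative \<psi>' r) (at r within {0..})"
    and p2: "\<forall>r\<ge>0. (\<psi>' has_real_derivative \<psi>'' r) (at r within {0..})"
    using C2 unfolding C2_halfline_def by blast
  have at_eq: "at r within {0..} = at r" if "r > 0" for r :: real
    using that by (intro at_within_interior) (simp add: interior_real_atLeast)
  have d1: "(\<psi> has_real_derivative \<psi>' r) (at r)" if "r > 0" for r
    using p1 that by (metis at_eq less_imp_le)
  have d2: "(\<psi>' has_real_derivative \<psi>'' r) (at r)" if "r > 0" for r
    using p2 that by (metis at_eq less_imp_le)
  define Lap where "Lap r = \<psi>'' r + \<psi>' r / r" for r
  have Lap_eq: "laplacian (\<lambda>w. \<psi> (cmod w)) (complex_of_real r) = Lap r" if "r > 0" for r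
    unfolding Lap_def by (rule laplacian_radial[OF d1 d2]) (use that in auto)
  have Lap_pos: "Lap r > 0" if "r > 0" for r
    using lap[rule_format, of "complex_of_real r"] Lap_eq[OF that] that by simp
  define s where "s x = \<psi>' (exp x) * exp x" for x
  define v where "v x = exp x * exp x * Lap (exp x)" for x
  define \<omega> where "\<omega> x = \<tau> (exp x) / exp x" for x
  define \<omega>' where "\<omega>' x = deriv \<tau> (exp x) - \<omega> x" for x
  obtain C where C: "C > 0" and comp: "\<forall>z\<in>{z. 1 \<le> cmod z}.
      inverse C * laplacian (\<lambda>w. \<psi> (cmod w)) z powr (- 1 / 2) \<le> \<tau> (cmod z) \<and>
      \<tau> (cmod z) \<le> C * laplacian (\<lambda>w. \<psi> (cmod w)) z powr (- 1 / 2)"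
    using \<tau>_comp unfolding comparable_on_def by blast
  \<comment> \<open>Squaring the comparison of \<open>\<tau>\<close> with the power
    \<open>- 1 / 2\<close> of the Laplacian squares its constant.\<close>
  define \<kappa> where "\<kappa> = max 1 (C\<^sup>2)"
  have ds: "((\<lambda>x. \<psi> (exp x)) has_real_derivative s x) (at x)" for x
    unfolding s_def by (rule DERIV_chain2[OF d1 DERIV_exp]) simp
  have dv: "(s has_real_derivative v x) (at x)" for x
  proof -
    have "((\<lambda>x. \<psi>' (exp x) * exp x) has_real_derivative \<psi>'' (exp x) * exp x * exp x + exp x * \<psi>' (exp x)) (at x)"
      by (rule DERIV_mult[OF DERIV_chain2[OF d2 DERIV_exp] DERIV_exp]) simp
    moreover have "\<psi>'' (exp x) * exp x * exp x + exp x * \<psi>' (exp x) = v x"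
      by (simp add: v_def Lap_def field_simps)
    ultimately show ?thesis by (simp add: s_def [abs_def])
  qed
  have v_pos: "0 < v x" for x by (simp add: v_def Lap_pos)
  have s_mono: "s x \<le> s y" if "x \<le> y" for x y
    using DERIV_nonneg_imp_nondecreasing[OF that] dv v_pos less_imp_le by blast
  have s_lim: "(s \<longlongrightarrow> 0) at_bot"
  proof -
    have "(\<psi>' \<longlongrightarrow> \<psi>' 0) (at 0 within {0..})"
      using p2 by (meson DERIV_continuous continuous_within order_refl)
    then have "(\<psi>' \<longlongrightarrow> \<psi>' 0) (at_right 0)" by (rule tendsto_within_subset) auto
    moreover have "filterlim exp (at_right (0::real)) at_bot"
      by (rule filterlim_at_withinI[OF exp_at_bot]) auto
    ultimately have "((\<lambda>x. \<psi>' (exp x)) \<longlongrightarrow> \<psi>' 0) at_bot" by (rule filterlim_compose)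
    from tendsto_mult[OF this exp_at_bot] show ?thesis by (simp add: s_def [abs_def])
  qed
  have s_nonneg: "0 \<le> s x" for x
  proof (rule tendsto_upperbound[OF s_lim])
    show "eventually (\<lambda>y. s y \<le> s x) at_bot"
      using eventually_le_at_bot[of x] by eventually_elim (rule s_mono)
  qed simp
  have v_bounds: "1 / (\<kappa> * (\<omega> x)\<^sup>2) \<le> v x \<and> v x \<le> \<kappa> / (\<omega> x)\<^sup>2" if "0 \<le> x" for x
  proof -
    define L where "L = Lap (exp x)"
    define t where "t = \<tau> (exp x)"
    have L: "L > 0" by (simp add: L_def Lap_pos)
    have t: "t > 0" using \<tau>_pos by (simp add: t_def)
    have "inverse C * L powr (- 1 / 2) \<le> t" "t \<le> C * L powr (- 1 / 2)"
      using comp[rule_format, of "complex_of_real (exp x)"] that Lap_eq[of "exp x"] by (auto simp: L_def t_def)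
    then have "(inverse C * L powr (- 1 / 2))\<^sup>2 \<le> t\<^sup>2" "t\<^sup>2 \<le> (C * L powr (- 1 / 2))\<^sup>2"
      using C t by (auto intro!: power_mono)
    moreover have "(L powr (- 1 / 2))\<^sup>2 = 1 / L"
    proof -
      have "(L powr (- 1 / 2))\<^sup>2 = L powr (- 1 / 2 + - 1 / 2)" by (simp only: power2_eq_square powr_add)
      also have "\<dots> = L powr - 1" by simp
      also have "\<dots> = 1 / L" using L by (simp add: powr_minus_divide)
      finally show ?thesis .
    qed
    ultimately have lo: "(inverse C)\<^sup>2 * (1 / L) \<le> t\<^sup>2" and hi: "t\<^sup>2 \<le> C\<^sup>2 * (1 / L)"
      by (simp_all only: power_mult_distrib)
    have \<kappa>: "C\<^sup>2 \<le> \<kappa>" "0 < \<kappa>" by (auto simp: \<kappa>_def)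
    have "1 / L = C\<^sup>2 * ((inverse C)\<^sup>2 * (1 / L))" using C by (simp add: power_inverse)
    also have "\<dots> \<le> C\<^sup>2 * t\<^sup>2" using lo by (rule mult_left_mono) simp
    also have "\<dots> \<le> \<kappa> * t\<^sup>2" using \<kappa>(1) by (rule mult_right_mono) simp
    finally have lo': "1 / (\<kappa> * t\<^sup>2) \<le> L" using L t \<kappa>(2) by (simp add: field_simps)
    have "C\<^sup>2 * (1 / L) \<le> \<kappa> * (1 / L)" using \<kappa>(1) L by (intro mult_right_mono) auto
    with hi have "t\<^sup>2 \<le> \<kappa> * (1 / L)" by (rule order_trans)
    then have hi': "L \<le> \<kappa> / t\<^sup>2" using L t by (simp add: field_simps)
    have \<omega>: "(\<omega> x)\<^sup>2 = t\<^sup>2 / (exp x * exp x)" by (simp add: \<omega>_def t_def power2_eq_square)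
    have "1 / (\<kappa> * (\<omega> x)\<^sup>2) = exp x * exp x * (1 / (\<kappa> * t\<^sup>2))" by (simp add: \<omega>)
    also have "\<dots> \<le> v x" unfolding v_def L_def[symmetric] using lo' by (intro mult_left_mono) auto
    finally have 1: "1 / (\<kappa> * (\<omega> x)\<^sup>2) \<le> v x" .
    have "v x \<le> exp x * exp x * (\<kappa> / t\<^sup>2)"
      unfolding v_def L_def[symmetric] using hi' by (intro mult_left_mono) auto
    also have "\<dots> = \<kappa> / (\<omega> x)\<^sup>2" by (simp add: \<omega>)
    finally show ?thesis using 1 by simp
  qed
  have d\<omega>: "(\<omega> has_real_derivative \<omega>' x) (at x)" for x
  proof -
    have "((\<lambda>x. \<tau> (exp x)) has_real_derivative deriv \<tau> (exp x) * exp x) (at x)"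
      by (rule DERIV_chain2[OF radial_profile_differentiable[OF \<tau>_diff] DERIV_exp]) simp
    from DERIV_divide[OF this DERIV_exp]
    have "(\<omega> has_real_derivative (deriv \<tau> (exp x) * exp x * exp x - \<tau> (exp x) * exp x) / (exp x * exp x)) (at x)"
      by (simp add: \<omega>_def [abs_def])
    moreover have "(deriv \<tau> (exp x) * exp x * exp x - \<tau> (exp x) * exp x) / (exp x * exp x) = \<omega>' x"
      by (simp add: \<omega>'_def \<omega>_def field_simps)
    ultimately show ?thesis by simp
  qed
  have \<omega>'_lim: "(\<omega>' \<longlongrightarrow> 0) at_top"
  proof -
    have "(\<omega> \<longlongrightarrow> 0) at_top"
      unfolding \<omega>_def [abs_def]
      by (intro real_tendsto_divide_at_top[OF filterlim_compose[OF \<tau>_lim exp_at_top]] exp_at_top)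
    from tendsto_diff[OF filterlim_compose[OF \<tau>'_lim exp_at_top] this]
    show ?thesis by (simp add: \<omega>'_def [abs_def])
  qed
  have "fock_weight \<psi> \<tau> \<omega> \<omega>' s v \<kappa>"
  proof unfold_locales
    show "continuous_on {0..} \<psi>" using p1 by (auto intro: DERIV_continuous_on)
    show "1 \<le> \<kappa>" by (simp add: \<kappa>_def)
    show "continuous_on UNIV (\<lambda>z::complex. \<tau> (cmod z))"
      by (rule differentiable_imp_continuous_on[OF \<tau>_diff])
  qed (use nonneg ds dv v_pos s_nonneg v_bounds \<tau>_pos \<tau>_lim d\<omega> \<omega>'_lim \<omega>_def in auto)
  then show ?thesis by blast
qed

context fock_weight
begin

section \<open>The equivalences for either operator\<close>

lemma symbol_operator_zero:
  assumes "symbol_operator (\<lambda>z. 0) T"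
  shows "T f = (\<lambda>z. 0)"
  using assms by (auto simp: symbol_operator_def mult_op_def integral_op_def fun_eq_iff)

lemma bounded_symbol_iff_zero:
  assumes p: "0 < p" and q: "0 < q" and pq: "p \<noteq> q" and T: "symbol_operator g T" and g: "g holomorphic_on UNIV"
  shows "bounded_operator \<psi> p q T \<longleftrightarrow> g = (\<lambda>z. 0)"
proof
  assume "bounded_operator \<psi> p q T"
  then show "g = (\<lambda>z. 0)"
    using bounded_symbol_zero_less[OF p _ T g] bounded_symbol_zero_greater[OF q _ T g] pq
    by (metis linorder_neqE)
next
  assume "g = (\<lambda>z. 0)"
  then show "bounded_operator \<psi> p q T"
    using T symbol_operator_zero by (intro bounded_operator_zero) blast
qed

lemma bounded_symbol_iff_constant:
  assumes p: "0 < p" and T: "symbol_operator g T" and g: "g holomorphic_on UNIV"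
  shows "bounded_operator \<psi> p p T \<longleftrightarrow> g constant_on UNIV"
proof
  assume "g constant_on UNIV"
  then obtain c where c: "g = (\<lambda>z. c)" by (auto simp: constant_on_def)
  show "bounded_operator \<psi> p p T"
    using T bounded_mult_op_const[OF p, of c] bounded_integral_op_const[OF p one_in_fock_space[OF p], of c]
    by (auto simp: symbol_operator_def c)
qed (rule bounded_symbol_constant[OF p T g])

lemma compact_symbol_iff_zero:
  assumes p: "0 < p" and T: "symbol_operator g T" and g: "g holomorphic_on UNIV"
  shows "compact_operator \<psi> p p T \<longleftrightarrow> g = (\<lambda>z. 0)"
proof
  assume "g = (\<lambda>z. 0)"
  then show "compact_operator \<psi> p p T"
    using T symbol_operator_zero by (intro compact_operator_zero[OF p]) blast
qed (rule compact_symbol_zero[OF p T g])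

end

theorem theorem1p2:
  fixes \<psi> :: "real \<Rightarrow> real" and p q :: ennreal and g :: "complex \<Rightarrow> complex"
  assumes "admissible_weight \<psi>"
    and "0 < p" and "0 < q"
    and "g holomorphic_on UNIV"
  shows
    "(p \<noteq> q \<longrightarrow>
        (bounded_operator \<psi> p q (integral_op g) \<longleftrightarrow> bounded_operator \<psi> p q (mult_op g)) \<and>
        (bounded_operator \<psi> p q (mult_op g) \<longleftrightarrow> g = (\<lambda>z. 0))) \<and>
     ((bounded_operator \<psi> p p (integral_op g) \<longleftrightarrow> bounded_operator \<psi> p p (mult_op g)) \<and>
        (bounded_operator \<psi> p p (mult_op g) \<longleftrightarrow> g constant_on UNIV)) \<and>
     ((compact_operator \<psi> p p (integral_op g) \<longleftrightarrow> compact_operator \<psi> p p (mult_op g)) \<and>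
        (compact_operator \<psi> p p (mult_op g) \<longleftrightarrow> g = (\<lambda>z. 0)))"
proof -
  obtain \<tau> \<omega> \<omega>' s v \<kappa> where "fock_weight \<psi> \<tau> \<omega> \<omega>' s v \<kappa>"
    using admissible_weight_imp_fock_weight[OF assms(1)] by blast
  then interpret fock_weight \<psi> \<tau> \<omega> \<omega>' s v \<kappa> .
  have M: "symbol_operator g (mult_op g)" and I: "symbol_operator g (integral_op g)"
    by (simp_all add: symbol_operator_def)
  show ?thesis
    using bounded_symbol_iff_zero[OF assms(2,3) _ M assms(4)] bounded_symbol_iff_zero[OF assms(2,3) _ I assms(4)]
      bounded_symbol_iff_constant[OF assms(2) M assms(4)] bounded_symbol_iff_constant[OF assms(2) I assms(4)]
      compact_symbol_iff_zero[OF assms(2) M assms(4)] compact_symbol_iff_zero[OF assms(2) I assms(4)]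
    by blast
qed

end
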